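(* Let $\mathfrak g=\mathfrak{osp}(m|2n;\mathbb C)$ with $m>7$, $n>1$ and $M=m-2n\notin\{0,1,2\}$. Then the $\mathfrak g$-module $\mathfrak g\otimes\mathfrak g$ (with $\mathfrak g$ the adjoint representation) is completely reducible and decomposes into irreducible summands as $$\mathfrak g\otimes\mathfrak g\cong K_{2\epsilon_1+2\epsilon_2}\oplus K_{2\epsilon_1+\epsilon_2+\epsilon_3}\oplus K_{2\epsilon_1}\oplus K_{\epsilon_1+\epsilon_2+\epsilon_3+\epsilon_4}\oplus K_{\epsilon_1+\epsilon_2}\oplus K_0,$$ equivalently, in terms of the standard positive system and listing the same summands in the same order, $$\mathfrak g\otimes\mathfrak g\cong L_{2\delta_1+2\delta_2}\oplus L_{3\delta_1+\delta_2}\oplus L_{\delta_1+\delta_2}\oplus L_{4\delta_1}\oplus L_{2\delta_1}\oplus L_0 .$$ The super-symmetric part $\mathfrak g\odot\mathfrak g$ is the sum of the first, third, fourth and sixth summands, and the super-antisymmetric part $\mathfrak g\wedge\mathfrak g$ is the sum of the second and fifth.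
   Context: $\mathfrak{osp}(m|2n)$ is the complex orthosymplectic Lie superalgebra; write $m=2d$ or $m=2d+1$. Weights are written in terms of $\epsilon_1,\dots,\epsilon_d$ (the $\mathfrak{so}(m)$ part) and $\delta_1,\dots,\delta_n$ (the $\mathfrak{sp}(2n)$ part) of the standard Cartan subalgebra. The standard positive system has simple roots $\delta_1-\delta_2,\dots,\delta_{n-1}-\delta_n,\delta_n-\epsilon_1,\epsilon_1-\epsilon_2,\dots,\epsilon_{d-1}-\epsilon_d$ together with $\epsilon_d$ (if $m=2d+1$) or $\epsilon_{d-1}+\epsilon_d$ (if $m=2d$). The non-standard positive system has simple roots $\epsilon_1-\epsilon_2,\dots,\epsilon_{d-1}-\epsilon_d,\epsilon_d-\delta_1,\delta_1-\delta_2,\dots,\delta_{n-1}-\delta_n$ together with $\delta_n$ (if $m=2d+1$) or $2\delta_n$ (if $m=2d$). $K_\mu$ denotes the irreducible highest weight $\mathfrak g$-module of highest weight $\mu$ with respect to the non-standard positive system, and $L_\lambda$ the irreducible highest weight module of highest weight $\lambda$ with respect to the standard positive system. For a $\mathfrak g$-module $U$, $U\otimes U=U\odot U\oplus U\wedge U$, where $U\odot U$ (resp. $U\wedge U$) is spanned by $X\otimes Y+(-1)^{|X||Y|}Y\otimes X$ (resp. $X\otimes Y-(-1)^{|X||Y|}Y\otimes X$) for homogeneous $X,Y$. *)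

theory Defs
  imports Complex_Main
begin

text \<open>Concrete model of osp(m|2n) inside gl(m|2n). Matrices are functions
  nat => nat => complex supported on indices below N = m + 2n; index i is even
  iff i < m. Tensors in gl(m|2n) (x) gl(m|2n) are 4-index arrays.\<close>

type_synonym mat = "nat \<Rightarrow> nat \<Rightarrow> complex"
type_synonym tens = "nat \<Rightarrow> nat \<Rightarrow> nat \<Rightarrow> nat \<Rightarrow> complex"

definition idxN :: "nat \<Rightarrow> nat \<Rightarrow> nat" where
  "idxN m n = m + 2 * n"

definition podd :: "nat \<Rightarrow> nat \<Rightarrow> bool" where
  "podd m i = (m \<le> i)"

text \<open>Even supersymmetric nondegenerate bilinear form B.
  Basis: e_i, e_(d+i) (i<d) paired; e_(2d) with B=1 if m odd;
  f_j = index m+j, f_(n+j) = index m+n+j with B(f_j,f_(n+j)) = 1 = -B(f_(n+j),f_j).\<close>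
definition Bform :: "nat \<Rightarrow> nat \<Rightarrow> nat \<Rightarrow> nat \<Rightarrow> complex" where
  "Bform m n a b =
    (let d = m div 2 in
     if a < d \<and> b = a + d then 1
     else if d \<le> a \<and> a < 2 * d \<and> b + d = a then 1
     else if odd m \<and> a = 2 * d \<and> b = 2 * d then 1
     else if m \<le> a \<and> a < m + n \<and> b = a + n then 1
     else if m + n \<le> a \<and> a < m + 2 * n \<and> b + n = a then -1
     else 0)"

text \<open>Homogeneous elements of osp(m|2n) of parity s (False = even, True = odd):
  B(Xu,v) + (-1)^(|X||u|) B(u,Xv) = 0 for homogeneous basis vectors u, v.\<close>
definition osp_par :: "nat \<Rightarrow> nat \<Rightarrow> bool \<Rightarrow> mat \<Rightarrow> bool" where
  "osp_par m n s X \<longleftrightarrow>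
     (\<forall>i j. (idxN m n \<le> i \<or> idxN m n \<le> j) \<longrightarrow> X i j = 0) \<and>
     (\<forall>i j. ((podd m i \<noteq> podd m j) \<noteq> s) \<longrightarrow> X i j = 0) \<and>
     (\<forall>a < idxN m n. \<forall>b < idxN m n.
        (\<Sum>c<idxN m n. X c a * Bform m n c b)
        + (if s \<and> podd m a then -1 else 1) * (\<Sum>c<idxN m n. Bform m n a c * X c b) = 0)"

definition osp :: "nat \<Rightarrow> nat \<Rightarrow> mat set" where
  "osp m n = {(\<lambda>i j. X i j + Y i j) | X Y. osp_par m n False X \<and> osp_par m n True Y}"

definition ev_part :: "nat \<Rightarrow> mat \<Rightarrow> mat" where
  "ev_part m X = (\<lambda>i j. if podd m i = podd m j then X i j else 0)"

definition od_part :: "nat \<Rightarrow> mat \<Rightarrow> mat" where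
  "od_part m X = (\<lambda>i j. if podd m i = podd m j then 0 else X i j)"

definition mm :: "nat \<Rightarrow> mat \<Rightarrow> mat \<Rightarrow> mat" where
  "mm N X Y = (\<lambda>i j. \<Sum>k<N. X i k * Y k j)"

text \<open>Supercommutator, extended bilinearly from [X,Y] = XY - (-1)^(|X||Y|) YX.\<close>
definition sbr :: "nat \<Rightarrow> nat \<Rightarrow> mat \<Rightarrow> mat \<Rightarrow> mat" where
  "sbr m n X Y = (let N = idxN m n; X0 = ev_part m X; X1 = od_part m X;
                      Y0 = ev_part m Y; Y1 = od_part m Y in
     (\<lambda>i j. mm N X Y i j - (mm N Y0 X0 i j + mm N Y1 X0 i j + mm N Y0 X1 i j
                             - mm N Y1 X1 i j)))"

definition tp :: "mat \<Rightarrow> mat \<Rightarrow> tens" where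
  "tp X Y = (\<lambda>i j k l. X i j * Y k l)"

definition tadd :: "tens \<Rightarrow> tens \<Rightarrow> tens" where
  "tadd S T = (\<lambda>i j k l. S i j k l + T i j k l)"

definition tscale :: "complex \<Rightarrow> tens \<Rightarrow> tens" where
  "tscale c T = (\<lambda>i j k l. c * T i j k l)"

definition tzero :: tens where
  "tzero = (\<lambda>i j k l. 0)"

definition tsum :: "(nat \<Rightarrow> tens) \<Rightarrow> nat set \<Rightarrow> tens" where
  "tsum v I = (\<lambda>i j k l. \<Sum>r\<in>I. v r i j k l)"

definition lin_span :: "tens set \<Rightarrow> tens set" where
  "lin_span S = {(\<lambda>i j k l. \<Sum>r<K. c r * v r i j k l) | (K::nat) (c::nat \<Rightarrow> complex) v. \<forall>r<K. v r \<in> S}"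

definition is_subspace :: "tens set \<Rightarrow> bool" where
  "is_subspace V \<longleftrightarrow> tzero \<in> V \<and> (\<forall>x\<in>V. \<forall>y\<in>V. tadd x y \<in> V)
                    \<and> (\<forall>c. \<forall>x\<in>V. tscale c x \<in> V)"

text \<open>Action of g on g (x) g: Z.(X (x) Y) = [Z,X] (x) Y + (-1)^(|Z||X|) X (x) [Z,Y].\<close>
definition act1 :: "nat \<Rightarrow> nat \<Rightarrow> mat \<Rightarrow> tens \<Rightarrow> tens" where
  "act1 m n Z T = (\<lambda>i j k l. sbr m n Z (\<lambda>a b. T a b k l) i j)"

definition act2 :: "nat \<Rightarrow> nat \<Rightarrow> mat \<Rightarrow> tens \<Rightarrow> tens" where
  "act2 m n Z T = (\<lambda>i j k l. sbr m n Z (\<lambda>a b. T i j a b) k l)"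

definition par1 :: "nat \<Rightarrow> tens \<Rightarrow> tens" where
  "par1 m T = (\<lambda>i j k l. (if podd m i = podd m j then 1 else -1) * T i j k l)"

definition act :: "nat \<Rightarrow> nat \<Rightarrow> mat \<Rightarrow> tens \<Rightarrow> tens" where
  "act m n Z T = tadd (act1 m n Z T)
                   (tadd (act2 m n (ev_part m Z) T) (act2 m n (od_part m Z) (par1 m T)))"

definition gtg :: "nat \<Rightarrow> nat \<Rightarrow> tens set" where
  "gtg m n = lin_span {tp X Y | X Y. X \<in> osp m n \<and> Y \<in> osp m n}"

definition gsym :: "nat \<Rightarrow> nat \<Rightarrow> tens set" where
  "gsym m n = lin_span {tadd (tp X Y) (tscale (if s \<and> t then -1 else 1) (tp Y X)) | X Y s t.
                          osp_par m n s X \<and> osp_par m n t Y}"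

definition gwedge :: "nat \<Rightarrow> nat \<Rightarrow> tens set" where
  "gwedge m n = lin_span {tadd (tp X Y) (tscale (if s \<and> t then 1 else -1) (tp Y X)) | X Y s t.
                          osp_par m n s X \<and> osp_par m n t Y}"

definition submodule :: "nat \<Rightarrow> nat \<Rightarrow> tens set \<Rightarrow> bool" where
  "submodule m n V \<longleftrightarrow> V \<subseteq> gtg m n \<and> is_subspace V \<and>
     (\<forall>X\<in>osp m n. \<forall>v\<in>V. act m n X v \<in> V)"

definition irreducible_submodule :: "nat \<Rightarrow> nat \<Rightarrow> tens set \<Rightarrow> bool" where
  "irreducible_submodule m n V \<longleftrightarrow> submodule m n V \<and> V \<noteq> {tzero} \<and>
     (\<forall>U. submodule m n U \<and> U \<subseteq> V \<longrightarrow> U = {tzero} \<or> U = V)"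

definition is_direct_sum :: "tens set \<Rightarrow> (nat \<Rightarrow> tens set) \<Rightarrow> nat set \<Rightarrow> bool" where
  "is_direct_sum W V I \<longleftrightarrow>
     W = {tsum v I | v. \<forall>i\<in>I. v i \<in> V i} \<and>
     (\<forall>v. (\<forall>i\<in>I. v i \<in> V i) \<and> tsum v I = tzero \<longrightarrow> (\<forall>i\<in>I. v i = tzero))"

text \<open>Cartan subalgebra (diagonal elements) and weights. A weight is given by its
  coefficient lists w.r.t. epsilon_1..epsilon_d and delta_1..delta_n
  (epsilon_(i+1) is H -> H i i, delta_(j+1) is H -> H (m+j) (m+j)).\<close>
definition cartan :: "nat \<Rightarrow> nat \<Rightarrow> mat set" where
  "cartan m n = {H \<in> osp m n. \<forall>i j. i \<noteq> j \<longrightarrow> H i j = 0}"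

definition wt :: "nat \<Rightarrow> nat \<Rightarrow> (nat \<Rightarrow> complex) \<Rightarrow> (nat \<Rightarrow> complex) \<Rightarrow> mat \<Rightarrow> complex" where
  "wt m n a b H = (\<Sum>i<m div 2. a i * H i i) + (\<Sum>j<n. b j * H (m + j) (m + j))"

definition coef :: "complex list \<Rightarrow> nat \<Rightarrow> complex" where
  "coef xs i = (if i < length xs then xs ! i else 0)"

text \<open>Positive systems, cut out by regular integral functionals on roots
  (c = epsilon coefficients, e = delta coefficients).
  Standard: delta_1 > ... > delta_n > epsilon_1 > ... > epsilon_d > 0.
  Non-standard: epsilon_1 > ... > epsilon_d > delta_1 > ... > delta_n > 0.\<close>
definition pos_std :: "nat \<Rightarrow> nat \<Rightarrow> (nat \<Rightarrow> int) \<Rightarrow> (nat \<Rightarrow> int) \<Rightarrow> bool" where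
  "pos_std m n c e \<longleftrightarrow>
     (\<Sum>i<m div 2. c i * int (m div 2 - i)) + (\<Sum>j<n. e j * int (m div 2 + n - j)) > 0"

definition pos_nonstd :: "nat \<Rightarrow> nat \<Rightarrow> (nat \<Rightarrow> int) \<Rightarrow> (nat \<Rightarrow> int) \<Rightarrow> bool" where
  "pos_nonstd m n c e \<longleftrightarrow>
     (\<Sum>i<m div 2. c i * int (n + m div 2 - i)) + (\<Sum>j<n. e j * int (n - j)) > 0"

definition has_hw_vector ::
  "nat \<Rightarrow> nat \<Rightarrow> ((nat \<Rightarrow> int) \<Rightarrow> (nat \<Rightarrow> int) \<Rightarrow> bool) \<Rightarrow> tens set
     \<Rightarrow> complex list \<times> complex list \<Rightarrow> bool" where
  "has_hw_vector m n pos V w \<longleftrightarrow>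
     (\<exists>v\<in>V. v \<noteq> tzero \<and>
        (\<forall>H\<in>cartan m n. act m n H v = tscale (wt m n (coef (fst w)) (coef (snd w)) H) v) \<and>
        (\<forall>X\<in>osp m n. \<forall>c e. pos c e \<and>
            (\<forall>H\<in>cartan m n. sbr m n H X =
               (\<lambda>i j. wt m n (\<lambda>k. of_int (c k)) (\<lambda>k. of_int (e k)) H * X i j))
            \<longrightarrow> act m n X v = tzero))"

definition K_weights :: "(complex list \<times> complex list) list" where
  "K_weights = [([2,2],[]), ([2,1,1],[]), ([2],[]), ([1,1,1,1],[]), ([1,1],[]), ([],[])]"

definition L_weights :: "(complex list \<times> complex list) list" where
  "L_weights = [([],[2,2]), ([],[3,1]), ([],[1,1]), ([],[4]), ([],[2]), ([],[])]"

end

theory Submission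
  imports Defs
begin

text \<open>
  Lowering an index turns osp(m|2n) into the super-antisymmetric square of V, and the tensor
  square of osp into the space W of tensors with four legs that are super-antisymmetric in the
  first two and in the last two legs. The vectors of W annihilated by all positive root vectors of
  the non-standard system can be computed from the component equations: they are spanned by six
  explicit vectors of different weights. There is a contravariant bilinear form on W, for which
  raising and lowering operators are adjoint. The six vectors are orthogonal for it, and their
  norms are nonzero multiples of 1, M - 2 and M (M - 1), which is where M = m - 2n must
  avoid 0, 1 and 2. A singular vector is orthogonal to the image of all lowering operators, and
  every nonzero submodule contains a singular vector. Hence each of the six vectors generates an
  irreducible submodule, these submodules are mutually orthogonal, and the orthogonal complement
  of their sum vanishes because it contains no singular vector. Odd root vectors of weight
  delta_j - epsilon_i carry the six vectors to highest weight vectors for the standard system.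
\<close>

section \<open>A separating functional\<close>

text \<open>Semisimplicity cannot be quoted for a Lie superalgebra, and the contravariant form is
  complex bilinear, so no positivity is available. It is replaced by arithmetic: the six norms are
  computed and seen to be nonzero. The exceptional values of M come from one contraction. Placing a
  two-leg tensor h next to the dual of B, skewing, and contracting with B again returns (M - 2) h
  plus the trace of h times the dual of B. Trace-free h thus gives M - 2, while the dual of B
  itself, of trace M, gives 2 (M - 1), to be multiplied by its own norm M. The other three vectors
  are built without B, and their norms do not involve M. In the non-standard order the highest
  letters e_0, ..., e_3 are even and span an isotropic space of dimension four, which is what m > 7
  provides; n > 1 provides the two odd letters of the standard weights. Passing to the standard
  order transposes each weight, read as a partition, because odd letters exchange the roles of
  symmetric and antisymmetric tensors.\<close>

lemma separating_functional:
  fixes U :: "('a \<Rightarrow> complex) set"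
  assumes "finite A"
    and "\<And>u. u \<in> U \<Longrightarrow> \<forall>k. k \<notin> A \<longrightarrow> u k = 0"
    and "(\<lambda>k. 0) \<in> U"
    and "\<And>u v a. u \<in> U \<Longrightarrow> v \<in> U \<Longrightarrow> (\<lambda>k. u k + a * v k) \<in> U"
    and "\<forall>k. k \<notin> A \<longrightarrow> T k = 0"
    and "T \<notin> U"
  shows "\<exists>c. (\<forall>u\<in>U. (\<Sum>k\<in>A. c k * u k) = 0) \<and> (\<Sum>k\<in>A. c k * T k) \<noteq> 0"
  using assms
proof (induction A arbitrary: U T rule: finite_induct)
  case empty
  then have "T = (\<lambda>k. 0)" by auto
  with empty show ?case by simp
next
  case (insert q A)
  note comb = insert.prems(3)
  show ?case
  proof (cases "\<exists>u\<in>U. u q \<noteq> 0")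
    case True
    then obtain u1 where u1: "u1 \<in> U" "u1 q \<noteq> 0" by blast
    define u0 where "u0 = (\<lambda>k. u1 k / u1 q)"
    have u0: "u0 \<in> U" "u0 q = 1"
      using comb[OF insert.prems(2) u1(1), of "1 / u1 q"] u1(2) by (auto simp: u0_def)
    \<comment> \<open>Elimination with the pivot \<open>u0\<close>: induction separates
      \<open>T'\<close> from \<open>U'\<close> on the coordinates in \<open>A\<close>, and the value
      \<open>- s\<close> at \<open>q\<close> makes the extended functional vanish on
      \<open>u0\<close>.\<close>
    define U' where "U' = {u \<in> U. u q = 0}"
    define T' where "T' = (\<lambda>k. T k + (- T q) * u0 k)"
    have T': "T' \<notin> U'"
    proof
      assume "T' \<in> U'"
      then have "T' \<in> U" by (simp add: U'_def)
      from comb[OF this u0(1), of "T q"] have "T \<in> U" by (simp add: T'_def)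
      with insert.prems show False by simp
    qed
    have supp: "u k = 0" if "u \<in> U" "k \<notin> insert q A" for u k
      using insert.prems(1)[OF that(1)] that(2) by blast
    have Tsupp: "T k = 0" if "k \<notin> insert q A" for k
      using insert.prems(4) that by blast
    have "\<exists>c. (\<forall>u\<in>U'. (\<Sum>k\<in>A. c k * u k) = 0) \<and> (\<Sum>k\<in>A. c k * T' k) \<noteq> 0"
    proof (rule insert.IH)
      fix u assume "u \<in> U'"
      then show "\<forall>k. k \<notin> A \<longrightarrow> u k = 0" using supp unfolding U'_def by (metis (mono_tags, lifting) insert_iff mem_Collect_eq)
    next
      show "(\<lambda>k. 0) \<in> U'" using insert.prems by (simp add: U'_def)
    next
      fix u v a assume "u \<in> U'" "v \<in> U'"
      then show "(\<lambda>k. u k + a * v k) \<in> U'" using comb by (simp add: U'_def)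
    next
      show "\<forall>k. k \<notin> A \<longrightarrow> T' k = 0"
        using Tsupp supp[OF u0(1)] u0(2) by (auto simp: T'_def) (metis insert_iff mult_zero_right mult.right_neutral)
    qed (rule T')
    then obtain c where c: "\<And>u. u \<in> U' \<Longrightarrow> (\<Sum>k\<in>A. c k * u k) = 0" "(\<Sum>k\<in>A. c k * T' k) \<noteq> 0"
      by blast
    define s where "s = (\<Sum>k\<in>A. c k * u0 k)"
    define c' where "c' = c(q := - s)"
    have c'_eq: "(\<Sum>k\<in>insert q A. c' k * w k) = (\<Sum>k\<in>A. c k * (w k + (- w q) * u0 k))" for w
    proof -
      have "(\<Sum>k\<in>A. c' k * w k) = (\<Sum>k\<in>A. c k * w k)"
        using insert.hyps by (intro sum.cong) (auto simp: c'_def)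
      then show ?thesis
        using insert.hyps
        by (simp add: c'_def s_def algebra_simps sum.distrib sum_subtractf sum_distrib_left)
    qed
    show ?thesis
    proof (intro exI[of _ c'] conjI ballI)
      fix u assume u: "u \<in> U"
      have "(\<lambda>k. u k + (- u q) * u0 k) \<in> U'"
        using comb[OF u u0(1), of "- u q"] u0(2) by (simp add: U'_def)
      then show "(\<Sum>k\<in>insert q A. c' k * u k) = 0" unfolding c'_eq by (rule c(1))
    next
      show "(\<Sum>k\<in>insert q A. c' k * T k) \<noteq> 0" unfolding c'_eq using c(2) by (simp add: T'_def)
    qed
  next
    case False
    then have z: "u q = 0" if "u \<in> U" for u using that by blast
    show ?thesis
    proof (cases "T q = 0")
      case True
      have "\<exists>c. (\<forall>u\<in>U. (\<Sum>k\<in>A. c k * u k) = 0) \<and> (\<Sum>k\<in>A. c k * T k) \<noteq> 0"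
      proof (rule insert.IH)
        fix u assume u: "u \<in> U"
        show "\<forall>k. k \<notin> A \<longrightarrow> u k = 0" using insert.prems(1)[OF u] z[OF u] by auto
      next
        show "\<forall>k. k \<notin> A \<longrightarrow> T k = 0" using insert.prems(4) True by (metis insert_iff)
      qed (use insert.prems comb in auto)
      then obtain c where "\<forall>u\<in>U. (\<Sum>k\<in>A. c k * u k) = 0" "(\<Sum>k\<in>A. c k * T k) \<noteq> 0" by blast
      then show ?thesis using insert.hyps z True by (intro exI[of _ c]) auto
    next
      case False
      have "(\<Sum>k\<in>insert q A. (if k = q then 1 else 0) * w k) = w q" for w :: "'a \<Rightarrow> complex"
      proof -
        have "(\<Sum>k\<in>insert q A. (if k = q then 1 else 0) * w k) = (\<Sum>k\<in>insert q A. if k = q then w k else 0)"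
          by (rule sum.cong) auto
        then show ?thesis using insert.hyps by simp
      qed
      then show ?thesis using False z by (intro exI[of _ "\<lambda>k. if k = q then 1 else 0"]) auto
    qed
  qed
qed

section \<open>The Koszul sign of two parities\<close>

definition ksign :: "bool \<Rightarrow> bool \<Rightarrow> complex" where
  "ksign x y = (if x \<and> y then -1 else 1)"

lemma ksign_simps [simp]:
  "ksign False y = 1" "ksign x False = 1" "ksign True True = -1"
  by (simp_all add: ksign_def)

lemma ksign_commute: "ksign x y = ksign y x"
  by (simp add: ksign_def)

lemma ksign_neq_left:
  "ksign (x \<noteq> y) z = ksign x z * ksign y z" "ksign (x = (\<not> y)) z = ksign x z * ksign y z"
  by (auto simp: ksign_def)

lemma ksign_square [simp]: "ksign x y * ksign x y = 1" "ksign x y * (ksign x y * c) = c"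
  by (simp_all add: ksign_def)

lemma ksign_nonzero [simp]: "ksign x y \<noteq> 0"
  by (simp add: ksign_def)

section \<open>Tensors over an index set with parity and duality\<close>

text \<open>The basis vector e_i pairs only with e_(st i), and B(e_i, e_(st i)) = eta i.\<close>

locale super_index =
  fixes N :: nat and p :: "nat \<Rightarrow> bool" and st :: "nat \<Rightarrow> nat" and eta :: "nat \<Rightarrow> complex"
  assumes st_st [simp]: "st (st i) = i"
    and st_less: "i < N \<Longrightarrow> st i < N"
    and p_st [simp]: "p (st i) = p i"
    and eta_square [simp]: "eta i * eta i = 1"
    and eta_st: "i < N \<Longrightarrow> eta (st i) = ksign (p i) (p i) * eta i"
begin

lemma st_less_iff [simp]: "st i < N \<longleftrightarrow> i < N"
  using st_less[of i] st_less[of "st i"] by auto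

lemma st_eq_iff [simp]: "st i = st j \<longleftrightarrow> i = j"
  by (metis st_st)

lemma eta_square' [simp]: "eta i * (eta i * c) = c"
  by (simp add: mult.assoc[symmetric])

lemma eta_nonzero [simp]: "eta i \<noteq> 0"
  using eta_square[of i] by (metis mult_zero_left zero_neq_one)

lemma eta_eta_st: "i < N \<Longrightarrow> eta i * eta (st i) = ksign (p i) (p i)"
  by (simp add: eta_st ksign_def)

section \<open>Homogeneous operators on the fourth tensor power of V\<close>

definition leg1 :: "mat \<Rightarrow> tens \<Rightarrow> tens" where
  "leg1 X T = (\<lambda>a b c d. \<Sum>x<N. X a x * T x b c d)"
definition leg2 :: "bool \<Rightarrow> mat \<Rightarrow> tens \<Rightarrow> tens" where
  "leg2 z X T = (\<lambda>a b c d. ksign z (p a) * (\<Sum>x<N. X b x * T a x c d))"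
definition leg3 :: "bool \<Rightarrow> mat \<Rightarrow> tens \<Rightarrow> tens" where
  "leg3 z X T = (\<lambda>a b c d. ksign z (p a) * ksign z (p b) * (\<Sum>x<N. X c x * T a b x d))"
definition leg4 :: "bool \<Rightarrow> mat \<Rightarrow> tens \<Rightarrow> tens" where
  "leg4 z X T = (\<lambda>a b c d. ksign z (p a) * ksign z (p b) * ksign z (p c) * (\<Sum>x<N. X d x * T a b c x))"

text \<open>The parity \<open>z\<close> attributed to \<open>X\<close> is a separate argument
  because it determines the Koszul sign for moving \<open>X\<close> past the earlier legs.\<close>

definition Act :: "bool \<Rightarrow> mat \<Rightarrow> tens \<Rightarrow> tens" where
  "Act z X T = (\<lambda>a b c d. leg1 X T a b c d + leg2 z X T a b c d + leg3 z X T a b c d + leg4 z X T a b c d)"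

lemmas leg_defs = leg1_def leg2_def leg3_def leg4_def

definition Act2 :: "bool \<Rightarrow> mat \<Rightarrow> mat \<Rightarrow> mat" where
  "Act2 z X h = (\<lambda>a b. (\<Sum>x<N. X a x * h x b) + ksign z (p a) * (\<Sum>x<N. X b x * h a x))"

definition homog :: "bool \<Rightarrow> mat \<Rightarrow> bool" where
  "homog z X \<longleftrightarrow> (\<forall>i j. X i j \<noteq> 0 \<longrightarrow> (p i \<noteq> p j) = z)"

text \<open>The homogeneous elements of osp of parity z.\<close>

definition osp_h :: "bool \<Rightarrow> mat \<Rightarrow> bool" where
  "osp_h z X \<longleftrightarrow> (\<forall>i j. X i j \<noteq> 0 \<longrightarrow> i < N \<and> j < N) \<and> homog z X \<and>
     (\<forall>b<N. \<forall>c<N. X b c * eta b = - ksign z (p c) * eta c * X (st c) (st b))"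

text \<open>The image of the tensor square of osp in the fourth tensor power of V.\<close>

definition W :: "tens set" where
  "W = {T. (\<forall>a b c d. T a b c d \<noteq> 0 \<longrightarrow> a < N \<and> b < N \<and> c < N \<and> d < N) \<and>
           (\<forall>a b c d. T b a c d = - ksign (p a) (p b) * T a b c d) \<and>
           (\<forall>a b c d. T a b d c = - ksign (p c) (p d) * T a b c d)}"

lemma osp_h_homog: "osp_h z X \<Longrightarrow> homog z X"
  by (simp add: osp_h_def)

lemma homog_ksign:
  assumes "homog z X" "X i j \<noteq> 0"
  shows "ksign (p j) y = ksign z y * ksign (p i) y" "ksign y (p j) = ksign y z * ksign y (p i)"
  using assms by (auto simp: homog_def ksign_def)

lemma Act_add: "Act z X (tadd S T) = tadd (Act z X S) (Act z X T)"
  by (intro ext) (simp add: Act_def leg_defs tadd_def distrib_left sum.distrib add.assoc add.left_commute add.commute)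

lemma Act_scale: "Act z X (tscale k T) = tscale k (Act z X T)"
  by (intro ext) (simp add: Act_def leg_defs tscale_def sum_distrib_left mult.left_commute distrib_left mult.assoc)

lemma Act_zero: "Act z X tzero = tzero"
  by (intro ext) (simp add: Act_def leg_defs tzero_def)

lemma Act_matrix_add: "Act z (\<lambda>i j. X i j + Y i j) T = tadd (Act z X T) (Act z Y T)"
  by (intro ext) (simp add: Act_def leg_defs tadd_def distrib_left distrib_right sum.distrib)

section \<open>The action respects the superbracket\<close>

definition br :: "bool \<Rightarrow> bool \<Rightarrow> mat \<Rightarrow> mat \<Rightarrow> mat" where
  "br x y X Y = (\<lambda>a b. (\<Sum>k<N. X a k * Y k b) - ksign x y * (\<Sum>k<N. Y a k * X k b))"

text \<open>Operators on two different legs interact only through the sign \<open>s u\<close>, which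
  is constant on the support of the row \<open>A\<close> and can therefore leave both sums.\<close>

lemma cross_sum:
  fixes A B s :: "nat \<Rightarrow> complex" and G :: "nat \<Rightarrow> nat \<Rightarrow> complex"
  assumes "\<And>u. A u \<noteq> 0 \<Longrightarrow> s u = k * s0"
  shows "(\<Sum>u<N. A u * (r * s u * (\<Sum>v<N. B v * G u v))) = r * k * s0 * (\<Sum>v<N. B v * (\<Sum>u<N. A u * G u v))"
proof -
  have "(\<Sum>u<N. A u * (r * s u * (\<Sum>v<N. B v * G u v)))
      = (\<Sum>u<N. \<Sum>v<N. r * k * s0 * (B v * (A u * G u v)))"
  proof (intro sum.cong refl)
    fix u
    show "A u * (r * s u * (\<Sum>v<N. B v * G u v)) = (\<Sum>v<N. r * k * s0 * (B v * (A u * G u v)))"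
      using assms[of u] by (cases "A u = 0") (simp_all add: sum_distrib_left mult_ac)
  qed
  also have "\<dots> = r * k * s0 * (\<Sum>v<N. B v * (\<Sum>u<N. A u * G u v))"
    by (subst sum.swap) (simp add: sum_distrib_left)
  finally show ?thesis .
qed

lemma leg_same: 
  "(\<Sum>u<N. X a u * (\<Sum>v<N. Y u v * G v)) = ksign x y * (\<Sum>u<N. Y a u * (\<Sum>v<N. X u v * G v)) + (\<Sum>v<N. br x y X Y a v * G v)"
proof -
  have *: "(\<Sum>u<N. X a u * (\<Sum>v<N. Y u v * G v)) = (\<Sum>v<N. (\<Sum>u<N. X a u * Y u v) * G v)" for X Y
    by (simp add: sum_distrib_left sum_distrib_right mult.assoc) (rule sum.swap)
  show ?thesis unfolding * br_def
    by (simp add: left_diff_distrib sum_subtractf sum_distrib_left[symmetric] mult.assoc)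
qed

lemma legs_bracket:
  assumes "homog x X" "homog y Y"
  shows "leg1 X (leg1 Y T) a b c d = ksign x y * leg1 Y (leg1 X T) a b c d + leg1 (br x y X Y) T a b c d"
    and "leg2 x X (leg2 y Y T) a b c d = ksign x y * leg2 y Y (leg2 x X T) a b c d + leg2 (x \<noteq> y) (br x y X Y) T a b c d"
    and "leg3 x X (leg3 y Y T) a b c d = ksign x y * leg3 y Y (leg3 x X T) a b c d + leg3 (x \<noteq> y) (br x y X Y) T a b c d"
    and "leg4 x X (leg4 y Y T) a b c d = ksign x y * leg4 y Y (leg4 x X T) a b c d + leg4 (x \<noteq> y) (br x y X Y) T a b c d"
proof -
  have pull: "(\<Sum>u<N. A u * (r * G u)) = r * (\<Sum>u<N. A u * G u)" for A r and G :: "nat \<Rightarrow> complex"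
    by (simp add: sum_distrib_left mult_ac)
  show "leg1 X (leg1 Y T) a b c d = ksign x y * leg1 Y (leg1 X T) a b c d + leg1 (br x y X Y) T a b c d"
    by (simp add: leg_defs leg_same[of X a Y _ x y])
  show "leg2 x X (leg2 y Y T) a b c d = ksign x y * leg2 y Y (leg2 x X T) a b c d + leg2 (x \<noteq> y) (br x y X Y) T a b c d"
    by (simp add: leg_defs pull leg_same[of X b Y _ x y] ksign_neq_left algebra_simps)
  show "leg3 x X (leg3 y Y T) a b c d = ksign x y * leg3 y Y (leg3 x X T) a b c d + leg3 (x \<noteq> y) (br x y X Y) T a b c d"
    by (simp add: leg_defs pull leg_same[of X c Y _ x y] ksign_neq_left algebra_simps)
  show "leg4 x X (leg4 y Y T) a b c d = ksign x y * leg4 y Y (leg4 x X T) a b c d + leg4 (x \<noteq> y) (br x y X Y) T a b c d"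
    by (simp add: leg_defs pull leg_same[of X d Y _ x y] ksign_neq_left algebra_simps)
qed

lemma legs_cross:
  assumes "homog x X"
  shows "leg1 X (leg2 y Y T) a b c d = ksign x y * leg2 y Y (leg1 X T) a b c d"
    and "leg1 X (leg3 y Y T) a b c d = ksign x y * leg3 y Y (leg1 X T) a b c d"
    and "leg1 X (leg4 y Y T) a b c d = ksign x y * leg4 y Y (leg1 X T) a b c d"
    and "leg2 x X (leg3 y Y T) a b c d = ksign x y * leg3 y Y (leg2 x X T) a b c d"
    and "leg2 x X (leg4 y Y T) a b c d = ksign x y * leg4 y Y (leg2 x X T) a b c d"
    and "leg3 x X (leg4 y Y T) a b c d = ksign x y * leg4 y Y (leg3 x X T) a b c d"
proof -
  have k: "X i u \<noteq> 0 \<Longrightarrow> ksign y (p u) = ksign y x * ksign y (p i)" for i u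
    by (rule homog_ksign(2)[OF assms])
  have pull: "(\<Sum>u<N. A u * (r * G u)) = r * (\<Sum>u<N. A u * G u)" for A r and G :: "nat \<Rightarrow> complex"
    by (simp add: sum_distrib_left mult_ac)
  have c: "(\<Sum>u<N. X i u * (r * ksign y (p u) * (\<Sum>v<N. B v * G u v)))
      = r * ksign y x * ksign y (p i) * (\<Sum>v<N. B v * (\<Sum>u<N. X i u * G u v))" for r i B G
    by (rule cross_sum) (rule k)
  show "leg1 X (leg2 y Y T) a b c d = ksign x y * leg2 y Y (leg1 X T) a b c d"
    using c[where r = 1 and i = a and B = "Y b" and G = "\<lambda>u v. T u v c d"]
    by (simp add: leg_defs ksign_commute[of x y])
  show "leg1 X (leg3 y Y T) a b c d = ksign x y * leg3 y Y (leg1 X T) a b c d"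
    using c[where r = "ksign y (p b)" and i = a and B = "Y c" and G = "\<lambda>u v. T u b v d"]
    by (simp add: leg_defs ksign_commute[of x y] mult_ac)
  show "leg1 X (leg4 y Y T) a b c d = ksign x y * leg4 y Y (leg1 X T) a b c d"
    using c[where r = "ksign y (p b) * ksign y (p c)" and i = a and B = "Y d" and G = "\<lambda>u v. T u b c v"]
    by (simp add: leg_defs ksign_commute[of x y] mult_ac)
  show "leg2 x X (leg3 y Y T) a b c d = ksign x y * leg3 y Y (leg2 x X T) a b c d"
    using c[where r = 1 and i = b and B = "Y c" and G = "\<lambda>u v. T a u v d"]
    by (simp add: leg_defs ksign_commute[of x y] mult_ac pull)
  show "leg2 x X (leg4 y Y T) a b c d = ksign x y * leg4 y Y (leg2 x X T) a b c d"
    using c[where r = 1 and i = b and B = "Y d" and G = "\<lambda>u v. T a u c v"]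
    by (simp add: leg_defs ksign_commute[of x y] mult_ac pull)
  show "leg3 x X (leg4 y Y T) a b c d = ksign x y * leg4 y Y (leg3 x X T) a b c d"
    using c[where r = 1 and i = c and B = "Y d" and G = "\<lambda>u v. T a b u v"]
    by (simp add: leg_defs ksign_commute[of x y] mult_ac pull)
qed

lemma leg_sum:
  "leg1 X (\<lambda>a b c d. P a b c d + Q a b c d) = (\<lambda>a b c d. leg1 X P a b c d + leg1 X Q a b c d)"
  "leg2 z X (\<lambda>a b c d. P a b c d + Q a b c d) = (\<lambda>a b c d. leg2 z X P a b c d + leg2 z X Q a b c d)"
  "leg3 z X (\<lambda>a b c d. P a b c d + Q a b c d) = (\<lambda>a b c d. leg3 z X P a b c d + leg3 z X Q a b c d)"
  "leg4 z X (\<lambda>a b c d. P a b c d + Q a b c d) = (\<lambda>a b c d. leg4 z X P a b c d + leg4 z X Q a b c d)"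
  by (intro ext; simp add: leg_defs distrib_left sum.distrib)+

text \<open>Of the sixteen products of legs, the four with equal legs produce the bracket and the
  twelve mixed ones supercommute. This relation is what later allows operators to be
  reordered.\<close>

lemma Act_bracket:
  assumes X: "homog x X" and Y: "homog y Y"
  shows "Act x X (Act y Y T) = tadd (tscale (ksign x y) (Act y Y (Act x X T))) (Act (x \<noteq> y) (br x y X Y) T)"
proof (intro ext)
  fix a b c d
  have q: "ksign x y * (ksign y x * t) = t" for t
    by (simp add: ksign_commute[of y x])
  show "Act x X (Act y Y T) a b c d = tadd (tscale (ksign x y) (Act y Y (Act x X T))) (Act (x \<noteq> y) (br x y X Y) T) a b c d"
    unfolding Act_def leg_sum tadd_def tscale_def
    by (simp only: legs_bracket[OF X Y] legs_cross[OF X] legs_cross[OF Y] distrib_left q mult.assoc)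
      (simp add: algebra_simps)
qed

lemma osp_h_relation:
  assumes "osp_h z X" "b < N" "c < N"
  shows "X b c = - ksign z (p c) * eta b * eta c * X (st c) (st b)"
proof -
  have "X b c * eta b = - ksign z (p c) * eta c * X (st c) (st b)" using assms by (simp add: osp_h_def)
  then have "X b c * eta b * eta b = - ksign z (p c) * eta c * X (st c) (st b) * eta b" by simp
  then show ?thesis by (simp add: mult_ac)
qed

lemma osp_h_supp: "osp_h z X \<Longrightarrow> X i j \<noteq> 0 \<Longrightarrow> i < N \<and> j < N"
  by (simp add: osp_h_def)

lemma sum_st: "(\<Sum>k<N. G (st k)) = (\<Sum>k<N. G k)"
  by (rule sum.reindex_bij_witness[where i = st and j = st]) auto

lemma osp_hI:
  assumes "\<And>i j. X i j \<noteq> 0 \<Longrightarrow> i < N \<and> j < N" "homog z X"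
    "\<And>b c. b < N \<Longrightarrow> c < N \<Longrightarrow> X b c = - ksign z (p c) * eta b * eta c * X (st c) (st b)"
  shows "osp_h z X"
  unfolding osp_h_def
proof (intro conjI allI impI)
  fix b c assume b: "b < N" and c: "c < N"
  have "X b c * eta b = (- ksign z (p c) * eta b * eta c * X (st c) (st b)) * eta b"
    by (subst assms(3)[OF b c]) (rule refl)
  then show "X b c * eta b = - ksign z (p c) * eta c * X (st c) (st b)" by (simp add: mult_ac)
qed (use assms(1,2) in auto)

text \<open>Passing to the negative B-adjoint reverses products: the two minus signs from the
  relations of \<open>X\<close> and \<open>Y\<close> cancel and a Koszul sign remains. Two instances
  together give closure of osp under \<open>br\<close>.\<close>

lemma osp_h_product:
  assumes X: "osp_h x X" and Y: "osp_h y Y" and "b < N" "c < N"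
  shows "(\<Sum>k<N. X b k * Y k c) = ksign x y * ksign (x \<noteq> y) (p c) * eta b * eta c * (\<Sum>k<N. Y (st c) k * X k (st b))"
proof -
  have "(\<Sum>k<N. X b k * Y k c) = (\<Sum>k<N. ksign x y * ksign (x \<noteq> y) (p c) * eta b * eta c * (Y (st c) (st k) * X (st k) (st b)))"
  proof (rule sum.cong)
    fix k assume "k \<in> {..<N}"
    then have k: "k < N" by simp
    show "X b k * Y k c = ksign x y * ksign (x \<noteq> y) (p c) * eta b * eta c * (Y (st c) (st k) * X (st k) (st b))"
    proof (cases "Y k c = 0")
      case True
      then have "Y (st c) (st k) = 0" using osp_h_relation[OF Y k \<open>c < N\<close>] by simp
      with True show ?thesis by simp
    next
      case False
      then have "(p k \<noteq> p c) = y" using osp_h_homog[OF Y] by (auto simp: homog_def)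
      then have "ksign x (p k) * ksign y (p c) = ksign x y * ksign (x \<noteq> y) (p c)"
        by (auto simp: ksign_def)
      then have "X b k * Y k c = ksign x y * ksign (x \<noteq> y) (p c) * (eta b * (eta k * (eta k * (eta c * (Y (st c) (st k) * X (st k) (st b))))))"
        unfolding osp_h_relation[OF X \<open>b < N\<close> k] osp_h_relation[OF Y k \<open>c < N\<close>]
        by (simp add: mult_ac)
      then show ?thesis by (simp add: mult_ac)
    qed
  qed simp
  also have "\<dots> = ksign x y * ksign (x \<noteq> y) (p c) * eta b * eta c * (\<Sum>k<N. Y (st c) (st k) * X (st k) (st b))"
    by (simp add: sum_distrib_left)
  finally show ?thesis by (simp add: sum_st[where G = "\<lambda>k. Y (st c) k * X k (st b)"])
qed

lemma osp_h_br:
  assumes X: "osp_h x X" and Y: "osp_h y Y"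
  shows "osp_h (x \<noteq> y) (br x y X Y)"
proof (rule osp_hI)
  have nz: "(\<exists>k. X i k \<noteq> 0 \<and> Y k j \<noteq> 0) \<or> (\<exists>k. Y i k \<noteq> 0 \<and> X k j \<noteq> 0)" if "br x y X Y i j \<noteq> 0" for i j
  proof (rule ccontr)
    assume "\<not> ?thesis"
    then have "X i k * Y k j = 0" "Y i k * X k j = 0" for k by auto
    then have "br x y X Y i j = 0" by (simp only: br_def sum.neutral_const) simp
    with that show False by simp
  qed
  show "i < N \<and> j < N" if "br x y X Y i j \<noteq> 0" for i j
    using nz[OF that] osp_h_supp[OF X] osp_h_supp[OF Y] by blast
  show "homog (x \<noteq> y) (br x y X Y)"
    unfolding homog_def
  proof (intro allI impI)
    fix i j assume "br x y X Y i j \<noteq> 0"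
    from nz[OF this] obtain k where "X i k \<noteq> 0 \<and> Y k j \<noteq> 0 \<or> Y i k \<noteq> 0 \<and> X k j \<noteq> 0" by blast
    then have "(p i \<noteq> p k) = x \<and> (p k \<noteq> p j) = y \<or> (p i \<noteq> p k) = y \<and> (p k \<noteq> p j) = x"
      using osp_h_homog[OF X, unfolded homog_def, rule_format] osp_h_homog[OF Y, unfolded homog_def, rule_format] by metis
    then show "(p i \<noteq> p j) = (x \<noteq> y)" by (cases "p i"; cases "p j"; cases "p k") auto
  qed
  fix b c assume b: "b < N" and c: "c < N"
  have comm: "(y \<noteq> x) = (x \<noteq> y)" by (cases x; cases y) simp_all
  have id: "s * k * eb * ec * P - s * (s * k * eb * ec * Q) = - k * eb * ec * (Q - s * P)"
    if "s * s = 1" for s k eb ec P Q :: complex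
    using that by algebra
  show "br x y X Y b c = - ksign (x \<noteq> y) (p c) * eta b * eta c * br x y X Y (st c) (st b)"
    unfolding br_def osp_h_product[OF X Y b c] osp_h_product[OF Y X b c] comm ksign_commute[of y x]
    by (rule id) simp
qed


section \<open>Permutations of the legs commute with the action\<close>

definition sw12 :: "tens \<Rightarrow> tens" where
  "sw12 T = (\<lambda>a b c d. ksign (p a) (p b) * T b a c d)"
definition sw23 :: "tens \<Rightarrow> tens" where
  "sw23 T = (\<lambda>a b c d. ksign (p b) (p c) * T a c b d)"
definition sw34 :: "tens \<Rightarrow> tens" where
  "sw34 T = (\<lambda>a b c d. ksign (p c) (p d) * T a b d c)"

lemma sum_homog_sign:
  assumes "homog z X"
  shows "(\<Sum>x<N. X i x * (ksign (p x) y * G x)) = ksign (p i) y * (ksign z y * (\<Sum>x<N. X i x * G x))"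
    and "(\<Sum>x<N. X i x * (ksign y (p x) * G x)) = ksign (p i) y * (ksign z y * (\<Sum>x<N. X i x * G x))"
proof -
  have "(\<Sum>x<N. X i x * (ksign (p x) y * G x)) = (\<Sum>x<N. ksign (p i) y * (ksign z y * (X i x * G x)))"
  proof (intro sum.cong refl)
    fix x show "X i x * (ksign (p x) y * G x) = ksign (p i) y * (ksign z y * (X i x * G x))"
      by (cases "X i x = 0") (simp_all add: homog_ksign(1)[OF assms] mult_ac)
  qed
  then show "(\<Sum>x<N. X i x * (ksign (p x) y * G x)) = ksign (p i) y * (ksign z y * (\<Sum>x<N. X i x * G x))"
    by (simp add: sum_distrib_left)
  then show "(\<Sum>x<N. X i x * (ksign y (p x) * G x)) = ksign (p i) y * (ksign z y * (\<Sum>x<N. X i x * G x))"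
    by (simp add: ksign_commute)
qed

lemma sum_pull: "(\<Sum>u<N. A u * (r * G u)) = r * (\<Sum>u<N. A u * G u)" for r :: complex
  by (simp add: sum_distrib_left mult_ac)

lemma Act_sw12:
  assumes "homog z X"
  shows "Act z X (sw12 T) = sw12 (Act z X T)"
  by (intro ext)
    (simp add: Act_def leg_defs sw12_def sum_homog_sign[OF assms] sum_pull distrib_left mult.assoc mult.left_commute ksign_commute)

lemma Act_sw23:
  assumes "homog z X"
  shows "Act z X (sw23 T) = sw23 (Act z X T)"
  by (intro ext)
    (simp add: Act_def leg_defs sw23_def sum_homog_sign[OF assms] sum_pull distrib_left mult.assoc mult.left_commute ksign_commute)

lemma Act_sw34:
  assumes "homog z X"
  shows "Act z X (sw34 T) = sw34 (Act z X T)"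
  by (intro ext)
    (simp add: Act_def leg_defs sw34_def sum_homog_sign[OF assms] sum_pull distrib_left mult.assoc mult.left_commute ksign_commute)

text \<open>The super flip of the two copies of osp, signed by the total parities of the two pairs.
  Its eigenvalues 1 and -1 will single out the super-symmetric and the super-antisymmetric
  part.\<close>

definition bsw :: "tens \<Rightarrow> tens" where
  "bsw T = (\<lambda>a b c d. ksign (p a \<noteq> p b) (p c \<noteq> p d) * T c d a b)"

text \<open>Moving legs 3 and 4 past legs 1 and 2 takes four adjacent transpositions, so
  equivariance of the flip reduces to theirs.\<close>

lemma bsw_eq: "bsw T = sw23 (sw12 (sw34 (sw23 T)))"
  by (intro ext) (simp add: bsw_def sw12_def sw23_def sw34_def ksign_def)

lemma Act_bsw: "homog z X \<Longrightarrow> Act z X (bsw T) = bsw (Act z X T)"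
  by (simp add: bsw_eq Act_sw12 Act_sw23 Act_sw34)

definition supp :: "tens \<Rightarrow> bool" where
  "supp T \<longleftrightarrow> (\<forall>a b c d. T a b c d \<noteq> 0 \<longrightarrow> a < N \<and> b < N \<and> c < N \<and> d < N)"

lemma W_iff: "T \<in> W \<longleftrightarrow> supp T \<and> sw12 T = tscale (-1) T \<and> sw34 T = tscale (-1) T"
proof -
  have *: "x = - (ksign q r * y) \<longleftrightarrow> ksign q r * x = - y" for x y q r
    by (auto simp: ksign_def)
  have 1: "(\<forall>a b c d. T b a c d = - ksign (p a) (p b) * T a b c d) \<longleftrightarrow> sw12 T = tscale (-1) T"
    by (simp add: fun_eq_iff sw12_def tscale_def *)
  have 2: "(\<forall>a b c d. T a b d c = - ksign (p c) (p d) * T a b c d) \<longleftrightarrow> sw34 T = tscale (-1) T"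
    by (simp add: fun_eq_iff sw34_def tscale_def *)
  show ?thesis unfolding W_def supp_def using 1 2 by simp
qed

lemma osp_h_parity: "osp_h z X \<Longrightarrow> X i j \<noteq> 0 \<Longrightarrow> (p i \<noteq> p j) = z"
  unfolding osp_h_def homog_def by blast

lemma sum_nonzero_ex: "(\<Sum>x<N. A x) \<noteq> 0 \<Longrightarrow> \<exists>x<N. A x \<noteq> (0::complex)"
  by (metis lessThan_iff sum.neutral)

lemma Act_nonzeroE:
  assumes "Act z X T a b c d \<noteq> 0"
  obtains x where "X a x \<noteq> 0" "T x b c d \<noteq> 0" | x where "X b x \<noteq> 0" "T a x c d \<noteq> 0"
    | x where "X c x \<noteq> 0" "T a b x d \<noteq> 0" | x where "X d x \<noteq> 0" "T a b c x \<noteq> 0"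
proof -
  have "leg1 X T a b c d \<noteq> 0 \<or> leg2 z X T a b c d \<noteq> 0 \<or> leg3 z X T a b c d \<noteq> 0 \<or> leg4 z X T a b c d \<noteq> 0"
    using assms by (auto simp: Act_def)
  then obtain x where "X a x * T x b c d \<noteq> 0 \<or> X b x * T a x c d \<noteq> 0
       \<or> X c x * T a b x d \<noteq> 0 \<or> X d x * T a b c x \<noteq> 0"
    unfolding leg_defs mult_eq_0_iff de_Morgan_disj by (elim disjE conjE) (drule sum_nonzero_ex, auto)+
  then show thesis using that unfolding mult_eq_0_iff de_Morgan_disj by blast
qed

lemma supp_Act:
  assumes "osp_h z X" "supp T"
  shows "supp (Act z X T)"
  unfolding supp_def
proof (intro allI impI)
  fix a b c d
  assume "Act z X T a b c d \<noteq> 0"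
  then show "a < N \<and> b < N \<and> c < N \<and> d < N"
    by (cases rule: Act_nonzeroE) (use assms(2) osp_h_supp[OF assms(1)] in \<open>auto simp: supp_def\<close>)
qed

lemma W_Act:
  assumes "osp_h z X" "T \<in> W"
  shows "Act z X T \<in> W"
proof -
  have "homog z X" by (rule osp_h_homog[OF assms(1)])
  then show ?thesis
    using assms supp_Act[of z X T] unfolding W_iff
    by (metis Act_scale Act_sw12 Act_sw34)
qed

lemma W_subspace: "is_subspace W"
  unfolding is_subspace_def
proof (intro conjI ballI allI)
  show "tzero \<in> W" by (simp add: W_def tzero_def)
  fix S T assume S: "S \<in> W" and T: "T \<in> W"
  have "S a b c d \<noteq> 0 \<or> T a b c d \<noteq> 0" if "tadd S T a b c d \<noteq> 0" for a b c d
    using that by (auto simp: tadd_def)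
  then have "supp (tadd S T)" using S T unfolding W_iff supp_def by blast
  moreover have "sw12 (tadd S T) = tadd (sw12 S) (sw12 T)" "sw34 (tadd S T) = tadd (sw34 S) (sw34 T)"
    by (intro ext; simp add: tadd_def sw12_def sw34_def distrib_left)+
  ultimately show "tadd S T \<in> W" using S T
    by (simp add: W_iff) (simp add: tadd_def tscale_def)
next
  fix c T assume "T \<in> W"
  moreover have "sw12 (tscale c T) = tscale c (sw12 T)" "sw34 (tscale c T) = tscale c (sw34 T)"
    by (intro ext; simp add: tscale_def sw12_def sw34_def)+
  moreover have "supp (tscale c T)" if "supp T"
    using that unfolding supp_def tscale_def mult_eq_0_iff by blast
  ultimately show "tscale c T \<in> W" by (simp add: W_iff) (simp add: tscale_def)
qed

section \<open>The contravariant form\<close>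

text \<open>The factor i on odd indices makes the transpose of an odd element of osp lie in osp again.\<close>

definition om :: "nat \<Rightarrow> complex" where
  "om a = (if p a then \<i> else 1)"

definition form :: "tens \<Rightarrow> tens \<Rightarrow> complex" where
  "form T S = (\<Sum>a<N. \<Sum>b<N. \<Sum>c<N. \<Sum>d<N. om a * om b * om c * om d * T a b c d * S a b c d)"

text \<open>The transpose conjugated by the diagonal matrix of \<open>om\<close>. Transposition
  exchanges raising and lowering elements; the conjugation corrects a sign on odd entries.\<close>

definition dag :: "mat \<Rightarrow> mat" where
  "dag X = (\<lambda>b c. om c / om b * X c b)"

lemma om_nonzero [simp]: "om a \<noteq> 0"
  by (simp add: om_def)

lemma om_st [simp]: "om (st a) = om a"
  by (simp add: om_def)

lemma om_square: "om a * om a = ksign (p a) (p a)"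
  by (simp add: om_def ksign_def)

lemma dag_sum: "(\<Sum>a<N. om a * (\<Sum>x<N. X a x * G x) * H a) = (\<Sum>a<N. om a * G a * (\<Sum>x<N. dag X a x * H x))"
proof -
  have "(\<Sum>a<N. om a * (\<Sum>x<N. X a x * G x) * H a) = (\<Sum>a<N. \<Sum>x<N. om a * X a x * G x * H a)"
    by (simp add: sum_distrib_left sum_distrib_right mult_ac)
  also have "\<dots> = (\<Sum>x<N. \<Sum>a<N. om a * X a x * G x * H a)" by (rule sum.swap)
  also have "\<dots> = (\<Sum>x<N. om x * G x * (\<Sum>a<N. dag X x a * H a))"
    by (simp add: sum_distrib_left dag_def mult_ac)
  finally show ?thesis .
qed

lemma sum3_inner: "(\<Sum>b<N. \<Sum>c<N. \<Sum>d<N. G b c d) = (\<Sum>c<N. \<Sum>d<N. \<Sum>b<N. G b c d)"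
  by (subst sum.swap) (intro sum.cong refl sum.swap)

lemma sum4_inner1: "(\<Sum>a<N. \<Sum>b<N. \<Sum>c<N. \<Sum>d<N. G a b c d) = (\<Sum>b<N. \<Sum>c<N. \<Sum>d<N. \<Sum>a<N. G a b c d)"
  by (subst sum.swap) (intro sum.cong refl sum3_inner)

lemma sum4_inner2: "(\<Sum>a<N. \<Sum>b<N. \<Sum>c<N. \<Sum>d<N. G a b c d) = (\<Sum>a<N. \<Sum>c<N. \<Sum>d<N. \<Sum>b<N. G a b c d)"
  by (intro sum.cong refl sum3_inner)

lemma sum4_inner3: "(\<Sum>a<N. \<Sum>b<N. \<Sum>c<N. \<Sum>d<N. G a b c d) = (\<Sum>a<N. \<Sum>b<N. \<Sum>d<N. \<Sum>c<N. G a b c d)"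
  by (intro sum.cong refl sum.swap)

lemma dag_sum':
  "(\<Sum>a<N. k * (om a * (\<Sum>x<N. X a x * G x) * H a)) = (\<Sum>a<N. k * (om a * G a * (\<Sum>x<N. dag X a x * H x)))"
  unfolding sum_distrib_left[symmetric] dag_sum ..

text \<open>The Koszul sign on a leg involves only the indices before it, which the operator on that
  leg leaves alone. Each adjunction is thus the one-index identity for \<open>dag\<close> under the
  three other sums.\<close>

lemma form_leg: "form (leg1 X T) S = form T (leg1 (dag X) S)" "form (leg2 z X T) S = form T (leg2 z (dag X) S)"
  "form (leg3 z X T) S = form T (leg3 z (dag X) S)" "form (leg4 z X T) S = form T (leg4 z (dag X) S)"
proof -
  have "form (leg1 X T) S = (\<Sum>b<N. \<Sum>c<N. \<Sum>d<N. \<Sum>a<N. (om b * om c * om d) * (om a * (\<Sum>x<N. X a x * T x b c d) * S a b c d))"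
    unfolding form_def leg_defs by (subst sum4_inner1) (simp only: mult_ac)
  then show "form (leg1 X T) S = form T (leg1 (dag X) S)"
    unfolding dag_sum' form_def leg_defs by (subst (2) sum4_inner1) (simp only: mult_ac)
  have "form (leg2 z X T) S = (\<Sum>a<N. \<Sum>c<N. \<Sum>d<N. \<Sum>b<N. (ksign z (p a) * om a * om c * om d) * (om b * (\<Sum>x<N. X b x * T a x c d) * S a b c d))"
    unfolding form_def leg_defs by (subst sum4_inner2) (simp only: mult_ac)
  then show "form (leg2 z X T) S = form T (leg2 z (dag X) S)"
    unfolding dag_sum' form_def leg_defs by (subst (2) sum4_inner2) (simp only: mult_ac)
  have "form (leg3 z X T) S = (\<Sum>a<N. \<Sum>b<N. \<Sum>d<N. \<Sum>c<N. (ksign z (p a) * ksign z (p b) * om a * om b * om d) * (om c * (\<Sum>x<N. X c x * T a b x d) * S a b c d))"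
    unfolding form_def leg_defs by (subst sum4_inner3) (simp only: mult_ac)
  then show "form (leg3 z X T) S = form T (leg3 z (dag X) S)"
    unfolding dag_sum' form_def leg_defs by (subst (2) sum4_inner3) (simp only: mult_ac)
  have "form (leg4 z X T) S = (\<Sum>a<N. \<Sum>b<N. \<Sum>c<N. \<Sum>d<N. (ksign z (p a) * ksign z (p b) * ksign z (p c) * om a * om b * om c) * (om d * (\<Sum>x<N. X d x * T a b c x) * S a b c d))"
    unfolding form_def leg_defs by (simp only: mult_ac)
  then show "form (leg4 z X T) S = form T (leg4 z (dag X) S)"
    unfolding dag_sum' form_def leg_defs by (simp only: mult_ac)
qed

lemma form_add_left: "form (\<lambda>a b c d. P a b c d + Q a b c d) S = form P S + form Q S"
  by (simp add: form_def distrib_left distrib_right sum.distrib)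

lemma form_commute: "form T S = form S T"
  by (simp add: form_def mult_ac)

lemma form_add_right: "form S (\<lambda>a b c d. P a b c d + Q a b c d) = form S P + form S Q"
  by (simp add: form_def distrib_left sum.distrib)

lemma form_tadd: "form (tadd P Q) S = form P S + form Q S" "form S (tadd P Q) = form S P + form S Q"
  by (simp_all add: tadd_def form_add_left form_add_right)

lemma form_tscale: "form (tscale k P) S = k * form P S" "form S (tscale k P) = k * form S P"
  by (simp_all add: tscale_def form_def sum_distrib_left mult_ac)

lemma form_tzero: "form tzero S = 0" "form S tzero = 0"
  by (simp_all add: tzero_def form_def)

lemma form_Act: "form (Act z X T) S = form T (Act z (dag X) S)"
  by (simp add: Act_def form_add_left form_add_right form_leg)

lemma osp_h_dag:
  assumes "osp_h z X"
  shows "osp_h z (dag X)"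
proof (rule osp_hI)
  show "i < N \<and> j < N" if "dag X i j \<noteq> 0" for i j
    using that osp_h_supp[OF assms, of j i] by (simp add: dag_def)
  show "homog z (dag X)"
    using osp_h_homog[OF assms] by (auto simp: homog_def dag_def)
  fix b c assume b: "b < N" and c: "c < N"
  show "dag X b c = - ksign z (p c) * eta b * eta c * dag X (st c) (st b)"
  proof (cases "X (st b) (st c) = 0")
    case True
    then show ?thesis using osp_h_relation[OF assms c b] by (simp add: dag_def)
  next
    case False
    then have "(p b \<noteq> p c) = z" using osp_h_parity[OF assms False] by simp
    \<comment> \<open>For odd \<open>X\<close> the quotient is i or -i, so inverting it costs the
      factor -1, which is also the cost of exchanging \<open>p b\<close> and \<open>p c\<close> in
      the sign. For even \<open>X\<close> the quotient is 1.\<close>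
    then have "om c / om b * ksign z (p b) = ksign z (p c) * (om b / om c)"
      by (auto simp: om_def ksign_def)
    then have "(om c / om b * ksign z (p b)) * (eta b * eta c * X (st b) (st c))
        = (ksign z (p c) * (om b / om c)) * (eta b * eta c * X (st b) (st c))" by simp
    then show ?thesis unfolding dag_def osp_h_relation[OF assms c b] by (simp add: mult_ac)
  qed
qed

lemma form_sw12: "form (sw12 T) S = form T (sw12 S)"
  unfolding form_def sw12_def by (subst sum.swap) (simp add: mult_ac ksign_commute)

lemma form_sw34: "form (sw34 T) S = form T (sw34 S)"
  unfolding form_def sw34_def by (subst sum4_inner3) (simp add: mult_ac ksign_commute)

text \<open>Left unnormalised: a quarter of it is the projection onto \<open>W\<close>, and it is
  self-adjoint for \<open>form\<close>.\<close>

definition skew :: "tens \<Rightarrow> tens" where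
  "skew T = tadd (tadd T (tscale (-1) (sw12 T))) (tadd (tscale (-1) (sw34 T)) (sw12 (sw34 T)))"

lemma skew_in_W:
  assumes "supp T"
  shows "skew T \<in> W"
proof -
  have "supp (skew T)"
    unfolding supp_def
  proof (intro allI impI)
    fix i j k l assume "skew T i j k l \<noteq> 0"
    then have "T i j k l \<noteq> 0 \<or> T j i k l \<noteq> 0 \<or> T i j l k \<noteq> 0 \<or> T j i l k \<noteq> 0"
      by (auto simp: skew_def tadd_def tscale_def sw12_def sw34_def)
    then show "i < N \<and> j < N \<and> k < N \<and> l < N" using assms unfolding supp_def by blast
  qed
  moreover have "sw12 (skew T) = tscale (-1) (skew T)" "sw34 (skew T) = tscale (-1) (skew T)"
    by (intro ext; simp add: skew_def tadd_def sw12_def sw34_def tscale_def ksign_commute algebra_simps)+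
  ultimately show ?thesis by (simp add: W_iff)
qed

lemma form_skew:
  assumes "R \<in> W"
  shows "form (skew T) R = 4 * form T R"
proof -
  have R: "sw12 R = tscale (-1) R" "sw34 R = tscale (-1) R" using assms by (simp_all add: W_iff)
  have "sw34 (tscale (-1) R) = tscale (-1) (sw34 R)" by (intro ext) (simp add: sw34_def tscale_def)
  then show ?thesis
    unfolding skew_def by (simp add: form_tadd form_tscale form_sw12 form_sw34 R)
qed

lemma Act_skew: "homog z X \<Longrightarrow> Act z X (skew T) = skew (Act z X T)"
  unfolding skew_def by (simp add: Act_add Act_scale Act_sw12 Act_sw34)

text \<open>The invariant tensor dual to B. Inserting it into the middle legs embeds the
  tensor square of V equivariantly into W.\<close>

definition Kt :: mat where
  "Kt b c = (if b = st c \<and> c < N then eta c else 0)"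

definition ins :: "mat \<Rightarrow> tens" where
  "ins h = (\<lambda>a b c d. h a d * Kt b c)"

text \<open>Up to sign conventions, the super version of the Kulkarni-Nomizu product of
  \<open>h\<close> with the dual of B.\<close>

definition psi :: "mat \<Rightarrow> tens" where
  "psi h = skew (ins h)"

lemma Kt_nonzero: "Kt b c \<noteq> 0 \<Longrightarrow> p b = p c \<and> b < N \<and> c < N"
  by (auto simp: Kt_def split: if_splits)

lemma Kt_sum1: "c < N \<Longrightarrow> (\<Sum>x<N. A x * Kt x c) = A (st c) * eta c"
proof -
  assume c: "c < N"
  have "(\<Sum>x<N. A x * Kt x c) = (\<Sum>x<N. if x = st c then A (st c) * eta c else 0)"
    by (rule sum.cong) (auto simp: Kt_def c)
  then show ?thesis using c by simp
qed

lemma Kt_sum2: "b < N \<Longrightarrow> (\<Sum>x<N. A x * Kt b x) = A (st b) * eta (st b)"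
proof -
  assume b: "b < N"
  have "(\<Sum>x<N. A x * Kt b x) = (\<Sum>x<N. if x = st b then A (st b) * eta (st b) else 0)"
    by (rule sum.cong) (use b in \<open>auto simp: Kt_def\<close>)
  then show ?thesis using b by simp
qed

lemma Kt_invariant:
  assumes "osp_h z X"
  shows "Act2 z X Kt b c = 0"
proof (cases "b < N \<and> c < N")
  case True
  then have b: "b < N" and c: "c < N" by auto
  show ?thesis
  proof (cases "X c (st b) = 0")
    case True
    then have "X b (st c) = 0" using osp_h_relation[OF assms, of b "st c"] b c by simp
    then show ?thesis using True b c by (simp add: Act2_def Kt_sum1 Kt_sum2)
  next
    case False
    then have "(p c \<noteq> p b) = z" using osp_h_parity[OF assms False] by simp
    then have s: "ksign z (p c) * ksign (p c) (p c) = ksign z (p b) * ksign (p b) (p b)"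
      by (auto simp: ksign_def)
    have "X b (st c) * eta c = - (ksign z (p c) * ksign (p c) (p c)) * eta b * (eta c * (eta c * X c (st b)))"
      using osp_h_relation[OF assms, of b "st c"] b c by (simp add: eta_st mult_ac)
    then show ?thesis using b c s by (simp add: Act2_def Kt_sum1 Kt_sum2 eta_st mult_ac)
  qed
next
  case False
  have "X b x * Kt x c = 0" "X c x * Kt b x = 0" for x
    using False osp_h_supp[OF assms, of b x] osp_h_supp[OF assms, of c x] Kt_nonzero[of x c] Kt_nonzero[of b x]
    by auto
  then show ?thesis by (simp only: Act2_def) simp
qed

lemma Act_ins:
  assumes "osp_h z X"
  shows "Act z X (ins h) = ins (Act2 z X h)"
proof (intro ext)
  fix a b c d
  have "Act z X (ins h) a b c d
    = Kt b c * (\<Sum>x<N. X a x * h x d) + ksign z (p a) * h a d * Act2 z X Kt b c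
      + ksign z (p a) * (ksign z (p b) * ksign z (p c) * Kt b c) * (\<Sum>x<N. X d x * h a x)"
  proof -
    have "(\<Sum>x<N. X a x * (h x d * Kt b c)) = Kt b c * (\<Sum>x<N. X a x * h x d)"
      by (simp add: sum_distrib_left mult_ac)
    moreover have "(\<Sum>x<N. X d x * (h a x * Kt b c)) = Kt b c * (\<Sum>x<N. X d x * h a x)"
      by (simp add: sum_distrib_left mult_ac)
    ultimately show ?thesis
      unfolding Act_def leg_defs ins_def Act2_def by (simp add: sum_pull distrib_left)
  qed
  \<comment> \<open>\<open>Kt\<close> joins indices of equal parity, so an operator passes both
    middle legs without a sign.\<close>
  moreover have "ksign z (p b) * ksign z (p c) * Kt b c = Kt b c"
    using Kt_nonzero[of b c] by (cases "Kt b c = 0") auto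
  ultimately have "Act z X (ins h) a b c d = Kt b c * (\<Sum>x<N. X a x * h x d)
      + ksign z (p a) * Kt b c * (\<Sum>x<N. X d x * h a x)"
    by (simp only: Kt_invariant[OF assms]) simp
  then show "Act z X (ins h) a b c d = ins (Act2 z X h) a b c d"
    by (simp add: ins_def Act2_def algebra_simps)
qed

lemma Act_psi: "osp_h z X \<Longrightarrow> Act z X (psi h) = psi (Act2 z X h)"
  by (simp add: psi_def Act_skew Act_ins osp_h_homog)

lemma psi_component:
  "psi h a b c d = h a d * Kt b c - ksign (p a) (p b) * h b d * Kt a c - ksign (p c) (p d) * h a c * Kt b d
     + ksign (p a) (p b) * ksign (p c) (p d) * h b c * Kt a d"
  by (simp add: psi_def skew_def tadd_def tscale_def ins_def sw12_def sw34_def)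

lemma psi_in_W:
  assumes "\<And>a b. h a b \<noteq> 0 \<Longrightarrow> a < N \<and> b < N"
  shows "psi h \<in> W"
  unfolding psi_def by (rule skew_in_W) (use assms Kt_nonzero in \<open>auto simp: supp_def ins_def\<close>)

text \<open>Contraction of the middle legs with B; it is adjoint to \<open>ins\<close> with respect
  to \<open>form\<close> and \<open>form2\<close>.\<close>

definition tr :: "tens \<Rightarrow> mat" where
  "tr T = (\<lambda>a d. \<Sum>b<N. eta b * T a b (st b) d)"

definition form2 :: "mat \<Rightarrow> mat \<Rightarrow> complex" where
  "form2 h k = (\<Sum>a<N. \<Sum>d<N. om a * om d * h a d * k a d)"

lemma form_ins: "form (ins h) T = form2 h (tr T)"
proof -
  have "form (ins h) T = (\<Sum>a<N. \<Sum>d<N. \<Sum>b<N. \<Sum>c<N. om a * om d * h a d * (om b * om c * T a b c d * Kt b c))"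
  proof -
    have "form (ins h) T = (\<Sum>a<N. \<Sum>b<N. \<Sum>d<N. \<Sum>c<N. om a * om b * om c * om d * ins h a b c d * T a b c d)"
      unfolding form_def by (rule sum4_inner3)
    also have "\<dots> = (\<Sum>a<N. \<Sum>d<N. \<Sum>b<N. \<Sum>c<N. om a * om b * om c * om d * ins h a b c d * T a b c d)"
      by (intro sum.cong refl sum.swap)
    finally show ?thesis by (simp add: ins_def mult_ac)
  qed
  also have "\<dots> = (\<Sum>a<N. \<Sum>d<N. om a * om d * h a d * (\<Sum>b<N. \<Sum>c<N. om b * om c * T a b c d * Kt b c))"
    by (simp add: sum_distrib_left)
  also have "\<dots> = form2 h (tr T)"
  proof -
    have "(\<Sum>c<N. om b * om c * T a b c d * Kt b c) = eta b * T a b (st b) d" if "b < N" for a b d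
    proof -
      have "(\<Sum>c<N. om b * om c * T a b c d * Kt b c) = (om b * om b) * T a b (st b) d * eta (st b)"
        using that by (simp add: Kt_sum2)
      then show ?thesis using that by (simp add: om_square eta_st)
    qed
    then show ?thesis unfolding form2_def tr_def by simp
  qed
  finally show ?thesis .
qed

lemma form_psi: "T \<in> W \<Longrightarrow> form (psi h) T = 4 * form2 h (tr T)"
  by (simp add: psi_def form_skew form_ins)

text \<open>The four terms of \<open>psi h\<close> contract to the superdimension times
  \<open>h\<close>, to \<open>- h\<close> twice, and to the trace of \<open>h\<close> times
  \<open>Kt\<close>. The factors M - 2 and M - 1 of the norms originate here.\<close>

lemma tr_psi:
  assumes "a < N" "d < N"
  shows "tr (psi h) a d = ((\<Sum>b<N. ksign (p b) (p b)) - 2) * h a d + (\<Sum>b<N. eta b * h b (st b)) * Kt a d"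
proof -
  have 1: "(\<Sum>b<N. eta b * (h a d * Kt b (st b))) = (\<Sum>b<N. ksign (p b) (p b)) * h a d"
    by (simp add: sum_distrib_right) (rule sum.cong, auto simp: Kt_def eta_eta_st mult_ac simp flip: mult.assoc)
  have 2: "(\<Sum>b<N. eta b * (ksign (p a) (p b) * h b d * Kt a (st b))) = h a d"
  proof -
    have "(\<Sum>b<N. eta b * (ksign (p a) (p b) * h b d * Kt a (st b))) = (\<Sum>b<N. if b = a then h a d else 0)"
      using assms by (intro sum.cong) (auto simp: Kt_def eta_st mult_ac)
    then show ?thesis using assms by simp
  qed
  have 3: "(\<Sum>b<N. eta b * (ksign (p b) (p d) * h a (st b) * Kt b d)) = h a d"
  proof -
    have "(\<Sum>b<N. eta b * (ksign (p b) (p d) * h a (st b) * Kt b d)) = (\<Sum>b<N. if b = st d then h a d else 0)"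
      using assms by (intro sum.cong) (auto simp: Kt_def eta_st mult_ac)
    then show ?thesis using assms by simp
  qed
  have 4: "(\<Sum>b<N. eta b * (ksign (p a) (p b) * ksign (p b) (p d) * h b (st b) * Kt a d)) = (\<Sum>b<N. eta b * h b (st b)) * Kt a d"
    unfolding sum_distrib_right using Kt_nonzero[of a d]
    by (intro sum.cong refl) (cases "Kt a d = 0"; auto simp: ksign_def)
  show ?thesis
    unfolding tr_def psi_component
    by (simp add: distrib_left right_diff_distrib sum.distrib sum_subtractf 1 2 3 4[simplified mult.assoc] mult.assoc)
      (use 1 2 3 4 in \<open>simp add: algebra_simps\<close>)
qed


section \<open>Singular vectors for the non-standard Borel subalgebra\<close>

text \<open>The element of osp that corresponds to e_a wedge e_b when osp is identified with the
  super exterior square of V.\<close>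

definition Fm :: "nat \<Rightarrow> nat \<Rightarrow> mat" where
  "Fm a b = (\<lambda>i j. (if i = a \<and> j = st b then eta b else 0) - ksign (p a) (p b) * (if i = b \<and> j = st a then eta a else 0))"

lemma osp_h_Fm:
  assumes "a < N" "b < N"
  shows "osp_h (p a \<noteq> p b) (Fm a b)"
proof (rule osp_hI)
  show "i < N \<and> j < N" if "Fm a b i j \<noteq> 0" for i j
    using that assms by (auto simp: Fm_def split: if_splits)
  show "homog (p a \<noteq> p b) (Fm a b)"
    unfolding homog_def
  proof (intro allI impI)
    fix i j assume "Fm a b i j \<noteq> 0"
    then have "i = a \<and> j = st b \<or> i = b \<and> j = st a" by (auto simp: Fm_def split: if_splits)
    then show "(p i \<noteq> p j) = (p a \<noteq> p b)" by auto
  qed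
  fix i j assume ij: "i < N" "j < N"
  have st: "st j = a \<longleftrightarrow> j = st a" "st j = b \<longleftrightarrow> j = st b" by (metis st_st)+
  consider "i = a \<and> j = st b" | "i = b \<and> j = st a" "\<not> (i = a \<and> j = st b)"
    | "\<not> (i = a \<and> j = st b)" "\<not> (i = b \<and> j = st a)" by blast
  then show "Fm a b i j = - ksign (p a \<noteq> p b) (p j) * eta i * eta j * Fm a b (st j) (st i)"
  proof cases
    case 1
    then show ?thesis using assms
      by (cases "a = b") (auto simp: Fm_def eta_st ksign_def st)
  next
    case 2
    then show ?thesis using assms
      by (auto simp: Fm_def eta_st ksign_def st)
  next
    case 3
    then have "\<not> (st j = a \<and> st i = st b)" "\<not> (st j = b \<and> st i = st a)" by (auto simp: st)
    with 3 have "Fm a b i j = 0" "Fm a b (st j) (st i) = 0"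
      unfolding Fm_def by (simp_all only: if_False mult_zero_right diff_zero)
    then show ?thesis by simp
  qed
qed

lemma Fm_row:
  assumes "a < N" "b < N"
  shows "(\<Sum>x<N. Fm a b c x * G x)
    = (if c = a then eta b * G (st b) else 0) - ksign (p a) (p b) * (if c = b then eta a * G (st a) else 0)"
proof -
  have "(\<Sum>x<N. Fm a b c x * G x)
     = (\<Sum>x<N. (if x = st b then (if c = a then eta b * G x else 0) else 0)
        - ksign (p a) (p b) * (if x = st a then (if c = b then eta a * G x else 0) else 0))"
    by (rule sum.cong) (auto simp: Fm_def left_diff_distrib)
  then show ?thesis using assms by (simp add: sum_subtractf sum_distrib_left[symmetric])
qed

text \<open>A Borel subalgebra is encoded by a height on the basis of V: the entry (i, j) sends e_j
  to e_i, so raising matrices strictly increase the height. The same notions then serve both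
  positive systems.\<close>

definition raising :: "(nat \<Rightarrow> int) \<Rightarrow> mat \<Rightarrow> bool" where
  "raising ht X \<longleftrightarrow> (\<forall>i j. X i j \<noteq> 0 \<longrightarrow> ht j < ht i)"

definition hwv :: "(nat \<Rightarrow> int) \<Rightarrow> tens \<Rightarrow> bool" where
  "hwv ht T \<longleftrightarrow> (\<forall>z X. osp_h z X \<and> raising ht X \<longrightarrow> Act z X T = tzero)"

end

text \<open>The indices 0, ..., 3 carry epsilon_1, ..., epsilon_4 and lie above all others. The odd
  index \<open>f\<close> enters the elimination once, for epsilon_4, and will carry delta_1.\<close>

locale osp_weights = super_index +
  fixes ht :: "nat \<Rightarrow> int" and f :: nat
  assumes four_le_N: "4 \<le> N"
    and p_low: "i < 4 \<Longrightarrow> \<not> p i"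
    and eta_low: "i < 4 \<Longrightarrow> eta i = 1"
    and st_low: "i < 4 \<Longrightarrow> 4 \<le> st i"
    and f_less: "f < N" and p_f: "p f"
    and ht_st: "i < N \<Longrightarrow> ht (st i) = - ht i"
    and ht_inj: "inj_on ht {..<N}"
    and ht_low: "i < 4 \<Longrightarrow> i < j \<Longrightarrow> j < N \<Longrightarrow> ht j < ht i"
begin

text \<open>The indices different from 0, ..., a and from their duals.\<close>

definition V :: "nat \<Rightarrow> nat set" where
  "V a = {w. w < N \<and> a < w \<and> a < st w}"

definition row :: "nat \<Rightarrow> nat \<Rightarrow> nat \<Rightarrow> (nat \<Rightarrow> complex) \<Rightarrow> complex" where
  "row a w c G = (if c = a then eta w * G (st w) else 0) - (if c = w then G (st a) else 0)"

text \<open>Up to signs, \<open>Fm a w\<close> sends e_(st w) to e_a and e_(st a) to e_w. Since a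
  lies above st w, duality puts w above st a, so both entries raise.\<close>

lemma hwv_row:
  assumes "hwv ht T" "a < 4" "w \<in> V a"
  shows "row a w i (\<lambda>x. T x j k l) + ksign (p w) (p i) * row a w j (\<lambda>x. T i x k l)
      + ksign (p w) (p i) * ksign (p w) (p j) * row a w k (\<lambda>x. T i j x l)
      + ksign (p w) (p i) * ksign (p w) (p j) * ksign (p w) (p k) * row a w l (\<lambda>x. T i j k x) = 0"
proof -
  have a: "a < N" "w < N" "\<not> p a" "eta a = 1" "a < w" "a < st w" "st w < N"
    using assms(2,3) four_le_N p_low eta_low by (auto simp: V_def)
  have "osp_h (p w) (Fm a w)" using osp_h_Fm[OF a(1,2)] a(3) by simp
  moreover have "raising ht (Fm a w)"
  proof -
    have "ht (st w) < ht a" using ht_low[OF assms(2), of "st w"] a by simp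
    then have "ht (st a) < ht w" using ht_st[of a] ht_st[of w] a by simp
    with \<open>ht (st w) < ht a\<close> show ?thesis
      by (auto simp: raising_def Fm_def split: if_splits)
  qed
  ultimately have "Act (p w) (Fm a w) T i j k l = 0"
    using assms(1) by (simp add: hwv_def tzero_def)
  moreover have "(\<Sum>x<N. Fm a w c x * G x) = row a w c G" for c G
    using a by (simp add: Fm_row row_def)
  ultimately show ?thesis by (simp add: Act_def leg_defs)
qed

lemma p_simps [simp]: "p 0 = False" "p (Suc 0) = False" "p 1 = False" "p 2 = False" "p 3 = False"
  using p_low[of 0] p_low[of 1] p_low[of 2] p_low[of 3] by auto

lemma eta_simps [simp]: "eta 0 = 1" "eta (Suc 0) = 1" "eta 1 = 1" "eta 2 = 1" "eta 3 = 1"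
  using eta_low[of 0] eta_low[of 1] eta_low[of 2] eta_low[of 3] by auto

lemma eta_st_simps [simp]: "eta (st 0) = 1" "eta (st (Suc 0)) = 1" "eta (st 1) = 1" "eta (st 2) = 1" "eta (st 3) = 1"
  using eta_st[of 0] eta_st[of 1] eta_st[of 2] eta_st[of 3] four_le_N by auto

lemma less_N_simps [simp]: "0 < N" "Suc 0 < N" "1 < N" "2 < N" "3 < N"
  using four_le_N by auto

lemma st_neq_simps [simp]:
  assumes "i < 4"
  shows "st i \<noteq> 0" "st i \<noteq> Suc 0" "st i \<noteq> 1" "st i \<noteq> 2" "st i \<noteq> 3"
    "0 \<noteq> st i" "Suc 0 \<noteq> st i" "1 \<noteq> st i" "2 \<noteq> st i" "3 \<noteq> st i"
  using st_low[OF assms] by auto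

lemma V_simps [simp]: 
  "1 \<in> V 0" "Suc 0 \<in> V 0" "2 \<in> V 0" "3 \<in> V 0" "2 \<in> V 1" "3 \<in> V 1" "2 \<in> V (Suc 0)" "3 \<in> V (Suc 0)" "3 \<in> V 2"
  using st_low[of 1] st_low[of 2] st_low[of 3] by (auto simp: V_def)

lemma V_st [simp]: "st x \<in> V a \<longleftrightarrow> x \<in> V a"
  by (auto simp: V_def)

lemma f_in_V: "f \<in> V 3"
proof -
  have "3 < i" if "p i" for i using that p_low[of i] by force
  then show ?thesis using f_less p_f by (simp add: V_def)
qed

lemma V_neq:
  assumes "x \<in> V a"
  shows "x < N" "\<And>i. i \<le> a \<Longrightarrow> x \<noteq> i" "\<And>i. i \<le> a \<Longrightarrow> x \<noteq> st i" 
  using assms by (auto simp: V_def)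

lemma V_mono: "x \<in> V a \<Longrightarrow> b \<le> a \<Longrightarrow> x \<in> V b"
  by (auto simp: V_def)

text \<open>When \<open>w\<close> occurs once in a component and is far from its other indices, the
  row equation of \<open>Fm 0 w\<close> has few terms and isolates one component. Four candidates
  suffice against three exclusions.\<close>

lemma choose_V0: "\<exists>w\<in>V 0. w \<noteq> x \<and> w \<noteq> y \<and> w \<noteq> z"
proof -
  have "card {x, y, z} \<le> 3" by (simp add: card_insert_if)
  moreover have "card {1, st 1, 2, st 2} = 4" by simp
  ultimately have "\<not> {1, st 1, 2, st 2} \<subseteq> {x, y, z}"
    using card_mono[of "{x, y, z}" "{1, st 1, 2, st 2}"] by (auto simp del: One_nat_def card_insert_disjoint)
  then show ?thesis by auto
qed

text \<open>The dual pairs of 1, 2 and 3 are disjoint, so two given indices leave one of them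
  untouched. A whole even pair is wanted because comparing \<open>w\<close> with \<open>st w\<close>
  produces an equation t = - t.\<close>

lemma choose_V0_pair: "\<exists>w\<in>V 0. \<not> p w \<and> eta w = 1 \<and> eta (st w) = 1 \<and> w \<noteq> st w \<and> w \<noteq> y \<and> w \<noteq> z \<and> st w \<noteq> y \<and> st w \<noteq> z"
proof -
  define P where "P x i \<longleftrightarrow> x = i \<or> x = st i" for x i
  have "\<not> (P x 1 \<and> P x 2)" "\<not> (P x 1 \<and> P x 3)" "\<not> (P x 2 \<and> P x 3)" for x
    unfolding P_def by (auto simp del: One_nat_def)
  then have "(\<not> P y 1 \<and> \<not> P z 1) \<or> (\<not> P y 2 \<and> \<not> P z 2) \<or> (\<not> P y 3 \<and> \<not> P z 3)"
    by blast
  then show ?thesis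
    unfolding P_def
    by (elim disjE) (rule bexI[of _ 1] bexI[of _ 2] bexI[of _ 3]; force simp del: One_nat_def)+
qed

lemma choose_V1: "\<exists>w\<in>V 1. w \<noteq> y \<and> w \<noteq> z"
proof -
  have "2 \<in> V 1" "st 2 \<in> V 1" "3 \<in> V 1" "st 2 \<noteq> 2" "st 2 \<noteq> 3" "2 \<noteq> (3::nat)" by simp_all
  then show ?thesis by metis
qed

lemma choose_V1_pair: "\<exists>w\<in>V 1. \<not> p w \<and> eta w = 1 \<and> eta (st w) = 1 \<and> w \<noteq> st w \<and> w \<noteq> z \<and> st w \<noteq> z"
proof -
  have "(z \<noteq> 2 \<and> z \<noteq> st 2) \<or> (z \<noteq> 3 \<and> z \<noteq> st 3)" by auto
  then show ?thesis
    by (elim disjE) (rule bexI[of _ 2] bexI[of _ 3]; force)+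
qed


text \<open>The components of T are eliminated in the order of their degree with respect to epsilon_1
  (from -2 to 2); in degrees 1 and 2 the remaining tensor on the orthogonal complement of e_0
  is treated in the same way with epsilon_2, epsilon_3 and epsilon_4. The six vanishing
  hypotheses are coordinates that separate the six singular vectors.\<close>

lemma hwv_zero:
  assumes T: "T \<in> W" and hw: "hwv ht T"
    and q0: "T 0 1 0 1 = 0" and q1: "T 0 1 0 2 = 0" and q2: "T 0 1 0 (st 1) = 0"
    and q3: "T 0 1 2 3 = 0" and q4: "T 0 (st 0) 0 1 = 0" and q5: "T 0 (st 0) 0 (st 0) = 0"
  shows "T = tzero"
proof -
  let ?o = "st 0"
  note [simp del] = One_nat_def
  note eq = hwv_row[OF hw]
  have sk1: "T b a c d = - ksign (p a) (p b) * T a b c d" for a b c d using T unfolding W_def by blast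
  have sk2: "T a b d c = - ksign (p c) (p d) * T a b c d" for a b c d using T unfolding W_def by blast
  have v0: "x < N \<and> x \<noteq> 0 \<and> x \<noteq> ?o \<and> 0 \<noteq> x \<and> ?o \<noteq> x" if "x \<in> V 0" for x
    using V_neq[OF that] by force
  have v1: "x \<in> V 0 \<and> x \<noteq> 1 \<and> x \<noteq> st 1 \<and> x < N \<and> x \<noteq> 0 \<and> x \<noteq> ?o" if "x \<in> V 1" for x
    using V_neq[OF that] V_mono[OF that, of 0] by force
  have v2: "x \<in> V 1 \<and> x \<in> V 0 \<and> x \<noteq> 2 \<and> x \<noteq> st 2 \<and> x \<noteq> 1 \<and> x \<noteq> st 1 \<and> x < N \<and> x \<noteq> 0 \<and> x \<noteq> ?o" if "x \<in> V 2" for x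
    using V_neq[OF that] V_mono[OF that, of 0] V_mono[OF that, of 1] by force
  have v3: "x \<in> V 2 \<and> x \<in> V 1 \<and> x \<in> V 0 \<and> x \<noteq> 3 \<and> x \<noteq> st 3 \<and> x \<noteq> 2 \<and> x \<noteq> st 2 \<and> x \<noteq> 1 \<and> x \<noteq> st 1 \<and> x < N \<and> x \<noteq> 0 \<and> x \<noteq> ?o" if "x \<in> V 3" for x
    using V_neq[OF that] V_mono[OF that, of 0] V_mono[OF that, of 1] V_mono[OF that, of 2] by force
  have even_skew1: "T b a c d = - T a b c d" if "\<not> p a \<or> \<not> p b" for a b c d
    using sk1[of b a c d] that by auto
  have even_skew2: "T a b d c = - T a b c d" if "\<not> p c \<or> \<not> p d" for a b c d
    using sk2[of a b d c] that by auto

  \<comment> \<open>Degrees -2 and -1: an otherwise absent \<open>w\<close> leaves one term of the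
    row equation, or a second one that is already known to vanish.\<close>
  have A1: "T ?o x ?o y = 0" if x: "x \<in> V 0" and y: "y \<in> V 0" for x y
  proof -
    obtain w where w: "w \<in> V 0" "w \<noteq> x" "w \<noteq> y" using choose_V0[of x y y] by blast
    show ?thesis using eq[of 0 w w x ?o y] w v0[OF w(1)] v0[OF x] v0[OF y] by (simp add: row_def)
  qed
  have B1: "T ?o x y z = 0" if x: "x \<in> V 0" and y: "y \<in> V 0" and z: "z \<in> V 0" for x y z
  proof -
    obtain w where w: "w \<in> V 0" "w \<noteq> x" "w \<noteq> y" "w \<noteq> z" using choose_V0[of x y z] by blast
    show ?thesis using eq[of 0 w w x y z] w v0[OF w(1)] v0[OF x] v0[OF y] v0[OF z] by (simp add: row_def)
  qed
  have B2: "T x y ?o z = 0" if x: "x \<in> V 0" and y: "y \<in> V 0" and z: "z \<in> V 0" for x y z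
  proof -
    obtain w where w: "w \<in> V 0" "w \<noteq> x" "w \<noteq> y" "w \<noteq> z" using choose_V0[of x y z] by blast
    show ?thesis using eq[of 0 w x y w z] w v0[OF w(1)] v0[OF x] v0[OF y] v0[OF z] by (simp add: row_def)
  qed
  have B3: "T ?o 0 ?o x = 0" if x: "x \<in> V 0" for x
  proof -
    obtain w where w: "w \<in> V 0" "w \<noteq> x" using choose_V0[of x x x] by blast
    show ?thesis using eq[of 0 w w 0 ?o x] w v0[OF w(1)] v0[OF x] B2[of w "st w" x] x by (simp add: row_def)
  qed
  have B4: "T ?o x ?o 0 = 0" if x: "x \<in> V 0" for x
  proof -
    obtain w where w: "w \<in> V 0" "w \<noteq> x" using choose_V0[of x x x] by blast
    show ?thesis using eq[of 0 w ?o x w 0] w v0[OF w(1)] v0[OF x] B1[of x w "st w"] x by (simp add: row_def)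
  qed
  \<comment> \<open>Degree 0: the root vectors for \<open>w\<close> and for \<open>st w\<close>
    equate this component with two components that are opposite by antisymmetry.\<close>
  have C1: "T 0 ?o y z = 0" if y: "y \<in> V 0" and z: "z \<in> V 0" for y z
  proof -
    obtain w where w: "w \<in> V 0" "\<not> p w" "eta w = 1" "eta (st w) = 1" "w \<noteq> st w" "w \<noteq> y" "w \<noteq> z" "st w \<noteq> y" "st w \<noteq> z"
      using choose_V0_pair[of y z] by blast
    have "T (st w) w y z = T 0 ?o y z"
      using eq[of 0 w 0 w y z] w v0[OF w(1)] v0[OF y] v0[OF z] by (simp add: row_def)
    moreover have "T w (st w) y z = T 0 ?o y z"
      using eq[of 0 "st w" 0 "st w" y z] w v0[of "st w"] v0[OF y] v0[OF z] by (simp add: row_def)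
    ultimately show ?thesis using even_skew1[of w "st w" y z] w(2) by simp
  qed
  have C2: "T y z 0 ?o = 0" if y: "y \<in> V 0" and z: "z \<in> V 0" for y z
  proof -
    obtain w where w: "w \<in> V 0" "\<not> p w" "eta w = 1" "eta (st w) = 1" "w \<noteq> st w" "w \<noteq> y" "w \<noteq> z" "st w \<noteq> y" "st w \<noteq> z"
      using choose_V0_pair[of y z] by blast
    have "T y z (st w) w = T y z 0 ?o"
      using eq[of 0 w y z 0 w] w v0[OF w(1)] v0[OF y] v0[OF z] by (simp add: row_def)
    moreover have "T y z w (st w) = T y z 0 ?o"
      using eq[of 0 "st w" y z 0 "st w"] w v0[of "st w"] v0[OF y] v0[OF z] by (simp add: row_def)
    ultimately show ?thesis using even_skew2[of w "st w" y z] w(2) by simp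
  qed
  \<comment> \<open>\<open>q5\<close> enters when x = st y, where the last leg contributes the
    component at (0, st 0, 0, st 0).\<close>
  have C3: "T ?o y 0 x = 0" if y: "y \<in> V 0" and x: "x \<in> V 0" for x y
    using eq[of 0 "st y" 0 ?o 0 x] v0[of "st y"] v0[OF y] v0[OF x] C1[of y x] y x q5 even_skew1[of ?o y 0 x]
    by (auto simp: row_def split: if_splits)
  have C4: "T 0 x ?o y = 0" if y: "y \<in> V 0" and x: "x \<in> V 0" for x y
    using eq[of 0 "st y" 0 x 0 ?o] v0[of "st y"] v0[OF y] v0[OF x] C2[of y x] y x q5 even_skew2[of ?o y 0 x]
    by (auto simp: row_def split: if_splits)
  have C5: "T u x y z = 0" if u: "u \<in> V 0" and x: "x \<in> V 0" and y: "y \<in> V 0" and z: "z \<in> V 0" for u x y z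
    using eq[of 0 "st u" 0 x y z] v0[of "st u"] v0[OF u] v0[OF x] v0[OF y] v0[OF z] u x y z
      C1[OF y z] C4[OF z x] C4[OF y x] even_skew2[of ?o y 0 x]
    by (simp add: row_def split: if_splits)

  \<comment> \<open>Degree 1 contains a vector of the complement of e_0 and e_(st 0), whose highest
    coordinate is \<open>q4\<close>, and a three-leg tensor on that complement.\<close>
  have G: "T 0 ?o 0 x = 0" if x: "x \<in> V 0" for x
  proof -
    have st1: "T 0 ?o 0 (st 1) = 0" using eq[of 1 2 0 ?o 0 2] by (simp add: row_def)
    show ?thesis
    proof (cases "x = 1 \<or> x = st 1")
      case True
      then show ?thesis using st1 q4 by auto
    next
      case False
      then have "x \<noteq> 1" "st x \<noteq> 1" by (metis st_st)+
      then have "st x \<in> V 1" using x by (auto simp: V_def)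
      then show ?thesis using eq[of 1 "st x" 0 ?o 0 1] v1[of "st x"] by (simp add: row_def)
    qed
  qed
  \<comment> \<open>Exchange relation between components with the leg 0 in the second pair and
    components with it in the first; the right-hand side is removed by \<open>D\<close>.\<close>
  have ab: "T u x 0 y + ksign (p u) (p x) * T 0 x u y
      = (if y = st u then ksign (p u) (p x) * eta (st u) * T 0 x 0 ?o else 0)"
    if u: "u \<in> V 0" and x: "x \<in> V 0" and y: "y \<in> V 0" for u x y
  proof -
    have "eta (st u) * (T u x 0 y + ksign (p u) (p x) * T 0 x u y)
        = (if y = st u then ksign (p u) (p x) * T 0 x 0 ?o else 0)"
      using eq[of 0 "st u" 0 x 0 y] v0[of "st u"] v0[OF u] v0[OF x] v0[OF y] u x y G[OF y]
      by (simp add: row_def algebra_simps split: if_splits)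
    then have "eta (st u) * (eta (st u) * (T u x 0 y + ksign (p u) (p x) * T 0 x u y))
        = eta (st u) * (if y = st u then ksign (p u) (p x) * T 0 x 0 ?o else 0)" by simp
    then show ?thesis by (simp split: if_splits)
  qed
  \<comment> \<open>The exchange relation is applied with both members of an even dual pair. In the
    sum of the two expressions for the component everything cancels by antisymmetry, so twice the
    component is zero.\<close>
  have D: "T 0 x 0 ?o = 0" if x: "x \<in> V 0" for x
  proof -
    obtain u where u: "u \<in> V 0" "\<not> p u" "eta u = 1" "eta (st u) = 1" "u \<noteq> st u" "u \<noteq> x" "st u \<noteq> x"
      using choose_V0_pair[of x x] by blast
    have su: "st u \<in> V 0" using u by simp
    have n: "x \<noteq> u" "x \<noteq> st u" "u \<noteq> st x" "st u \<noteq> st x" using u by auto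
    have e: "T 0 x 0 ?o = T 0 u x (st u) + T 0 x u (st u)"
      using ab[OF u(1) x su] ab[OF x u(1) su] u n even_skew1[of u x 0 "st u"] by simp
    have e': "T 0 x 0 ?o = T 0 (st u) x u + T 0 x (st u) u"
      using ab[OF su x u(1)] ab[OF x su u(1)] u n even_skew1[of "st u" x 0 u] by simp
    have "T 0 (st u) u x + T 0 u (st u) x = 0"
      using ab[OF u(1) su x] ab[OF su u(1) x] u n even_skew1[of u "st u" 0 x] by (simp add: add.commute)
    moreover have "T 0 u (st u) x = - T 0 u x (st u)" "T 0 (st u) u x = - T 0 (st u) x u"
      "T 0 x (st u) u = - T 0 x u (st u)"
      using u even_skew2[of x "st u" 0 u] even_skew2[of x u 0 "st u"] even_skew2[of u "st u" 0 x] by simp_all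
    ultimately have "2 * T 0 x 0 ?o = 0"
      using e e' by algebra
    then show ?thesis by simp
  qed
  have beta: "T u x 0 y = - ksign (p u) (p x) * T 0 x u y" if "u \<in> V 0" "x \<in> V 0" "y \<in> V 0" for u x y
    using ab[OF that] D[OF that(2)] by (simp add: add_eq_0_iff2 split: if_splits)
  \<comment> \<open>Together with the antisymmetry of the second pair this makes
    \<open>T 0 x u y\<close> totally super-antisymmetric in x, u, y: an element of the third
    exterior power of the complement, with highest coordinate \<open>q3\<close>.\<close>
  have alt: "T 0 x u y = - ksign (p u) (p x) * T 0 u x y" if u: "u \<in> V 0" and x: "x \<in> V 0" and y: "y \<in> V 0" for u x y
    using beta[OF u x y] beta[OF x u y] sk1[of x u 0 y] by (simp add: ksign_commute[of "p x" "p u"])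
  have F1: "T 0 (st 1) y z = 0" if y: "y \<in> V 1" and z: "z \<in> V 1" for y z
  proof -
    obtain w where w: "w \<in> V 1" "w \<noteq> y" "w \<noteq> z" using choose_V1[of y z] by blast
    show ?thesis using eq[of 1 w 0 w y z] w v1[OF w(1)] v1[OF y] v1[OF z] by (simp add: row_def)
  qed
  have F2: "T 0 1 (st 1) z = 0" if z: "z \<in> V 1" for z
  proof -
    obtain w where w: "w \<in> V 1" "\<not> p w" "eta w = 1" "eta (st w) = 1" "w \<noteq> st w" "w \<noteq> z" "st w \<noteq> z"
      using choose_V1_pair[of z] by blast
    have sw: "st w \<in> V 1" using w by simp
    have "T 0 (st w) w z = T 0 1 (st 1) z"
      using eq[of 1 w 0 1 w z] w v1[OF w(1)] v1[OF z] by (simp add: row_def)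
    moreover have "T 0 w (st w) z = T 0 1 (st 1) z"
      using eq[of 1 "st w" 0 1 "st w" z] w v1[OF sw] v1[OF z] by (simp add: row_def)
    moreover have "T 0 (st w) w z = - T 0 w (st w) z"
      using alt[of w "st w" z] w v1[OF w(1)] v1[OF sw] v1[OF z] by simp
    ultimately show ?thesis by simp
  qed
  have F3: "T 0 x y z = 0" if x: "x \<in> V 1" and y: "y \<in> V 1" and z: "z \<in> V 1" for x y z
  proof -
    have "st x \<in> V 1" using x by simp
    then show ?thesis
      using eq[of 1 "st x" 0 1 y z] v1[of "st x"] v1[OF x] v1[OF y] v1[OF z]
        F2[OF z] F2[OF y] even_skew2[of "st 1" y 0 1]
      by (simp add: row_def split: if_splits)
  qed
  have H1: "T 0 1 (st 2) z = 0" if z: "z \<in> V 2" for z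
  proof -
    have "3 \<in> V 2" "st 3 \<in> V 2" "st 3 \<noteq> 3" by simp_all
    then obtain w where w: "w \<in> V 2" "w \<noteq> z" by metis
    show ?thesis using eq[of 2 w 0 1 w z] w v2[OF w(1)] v2[OF z] by (simp add: row_def)
  qed
  have H2: "T 0 1 2 (st 2) = 0"
  proof -
    have "T 0 1 (st 3) 3 = T 0 1 2 (st 2)" using eq[of 2 3 0 1 2 3] by (simp add: row_def)
    moreover have "T 0 1 3 (st 3) = T 0 1 2 (st 2)" using eq[of 2 "st 3" 0 1 2 "st 3"] by (simp add: row_def)
    ultimately show ?thesis using even_skew2[of 3 "st 3" 0 1] by simp
  qed
  have H3: "T 0 1 y z = 0" if y: "y \<in> V 2" and z: "z \<in> V 2" for y z
  proof -
    have "st y \<in> V 2" using y by simp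
    then show ?thesis
      using eq[of 2 "st y" 0 1 2 z] v2[of "st y"] v2[OF y] v2[OF z] H2 by (simp add: row_def split: if_splits)
  qed
  have H4: "T 0 1 2 z = 0" if z: "z \<in> V 2" for z
  proof (cases "z = 3 \<or> z = st 3")
    case True
    \<comment> \<open>Here the odd index is decisive. For so(8) alone the fourth exterior power has
      a second singular vector, with st 3 in place of 3, and no further even index excludes it; the
      odd root vector joining 3 to \<open>f\<close> does.\<close>
    have "T 0 1 2 (st 3) = 0" using eq[of 3 f 0 1 2 f] f_in_V v3[OF f_in_V] by (simp add: row_def)
    then show ?thesis using True q3 by auto
  next
    case False
    then have "z \<noteq> 3" "st z \<noteq> 3" by (metis st_st)+
    then have "st z \<in> V 3" using z by (auto simp: V_def)
    then show ?thesis using eq[of 3 "st z" 0 1 2 3] v3[of "st z"] by (simp add: row_def)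
  qed
  have split1: "x = 1 \<or> x = st 1 \<or> x \<in> V 1" if "x \<in> V 0" for x
  proof (cases "x = 1 \<or> x = st 1")
    case False
    then have "x \<noteq> 1" "st x \<noteq> 1" by (metis st_st)+
    then show ?thesis using that by (auto simp: V_def)
  qed auto
  have split2: "x = 2 \<or> x = st 2 \<or> x \<in> V 2" if "x \<in> V 1" for x
  proof (cases "x = 2 \<or> x = st 2")
    case False
    then have "x \<noteq> 2" "st x \<noteq> 2" by (metis st_st)+
    then show ?thesis using that by (auto simp: V_def)
  qed auto
  have diag1: "T 0 x x y = 0" if "\<not> p x" "x \<in> V 0" "y \<in> V 0" for x y
    using alt[of x x y] that by simp
  have diag2: "T x y z z = 0" if "\<not> p z" for x y z
    using even_skew2[of z z x y] that by simp
  have H: "T 0 1 y z = 0" if y: "y \<in> V 1" and z: "z \<in> V 1" for y z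
    using split2[OF y] split2[OF z] H1 H2 H3 H4 diag2[of 2 0 1] diag2[of "st 2" 0 1]
      even_skew2[of 2 "st 2" 0 1] even_skew2[of 2 y 0 1] even_skew2[of "st 2" y 0 1] y z
    by (elim disjE) simp_all
  have J1: "T 0 1 y z = 0" if y: "y \<in> V 0" and z: "z \<in> V 0" for y z
  proof -
    have a1: "T 0 1 1 z' = 0" if "z' \<in> V 0" for z' using diag1[of 1 z'] that by simp
    have a2: "T 0 1 (st 1) z' = 0" if "z' \<in> V 0" for z'
      using split1[OF that] F2[of z'] a1[of "st 1"] even_skew2[of 1 "st 1" 0 1] diag2[of "st 1" 0 1]
      by (elim disjE) simp_all
    have a3: "T 0 1 z' 1 = 0" "T 0 1 z' (st 1) = 0" if "z' \<in> V 0" for z'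
      using even_skew2[of 1 z' 0 1] even_skew2[of "st 1" z' 0 1] a1[OF that] a2[OF that] by simp_all
    show ?thesis
      using split1[OF y] split1[OF z] H[of y z] a1[OF z] a2[OF z] a3[OF y]
      by (elim disjE) simp_all
  qed
  have J2: "T 0 (st 1) y z = 0" if y: "y \<in> V 0" and z: "z \<in> V 0" for y z
  proof -
    have a1: "T 0 (st 1) 1 z' = 0" "T 0 (st 1) (st 1) z' = 0" if "z' \<in> V 0" for z'
      using alt[of 1 "st 1" z'] diag1[of "st 1" z'] that J1[of "st 1" z'] by simp_all
    have a3: "T 0 (st 1) z' 1 = 0" "T 0 (st 1) z' (st 1) = 0" if "z' \<in> V 0" for z'
      using even_skew2[of 1 z' 0 "st 1"] even_skew2[of "st 1" z' 0 "st 1"] a1[OF that] by simp_all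
    show ?thesis
      using split1[OF y] split1[OF z] F1[of y z] a1[OF z] a3[OF y]
      by (elim disjE) simp_all
  qed
  have K: "T 0 x y z = 0" if x: "x \<in> V 0" and y: "y \<in> V 0" and z: "z \<in> V 0" for x y z
  proof -
    have a1: "T 0 x 1 z' = 0" "T 0 x (st 1) z' = 0" if "z' \<in> V 0" for z'
      using alt[of 1 x z'] alt[of "st 1" x z'] that x J1[of x z'] J2[of x z'] by simp_all
    have a3: "T 0 x y 1 = 0" "T 0 x y (st 1) = 0"
      using even_skew2[of 1 y 0 x] even_skew2[of "st 1" y 0 x] a1[OF y] by simp_all
    show ?thesis
      using split1[OF x] split1[OF y] split1[OF z] F3[of x y z] a1[OF z] a3 J1[OF y z] J2[OF y z]
      by (elim disjE) simp_all
  qed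
  have K': "T x y 0 z = 0" if "x \<in> V 0" "y \<in> V 0" "z \<in> V 0" for x y z
    using beta[OF that] K[of y x z] that by simp

  \<comment> \<open>Degree 2 is a two-leg tensor on the complement without symmetry. Its trace-free
    symmetric part, its antisymmetric part and its trace are detected by \<open>q0\<close>,
    \<open>q1\<close> and \<open>q2\<close>.\<close>
  have L1: "T 0 (st 1) 0 y = 0" if y: "y \<in> V 0" "y \<noteq> 1" for y
  proof -
    obtain w where w: "w \<in> V 1" "w \<noteq> y" using choose_V1[of y y] by blast
    show ?thesis using eq[of 1 w 0 w 0 y] w v1[OF w(1)] v0[OF y(1)] y by (simp add: row_def)
  qed
  have L2: "T 0 x 0 (st 1) = 0" if x: "x \<in> V 1" for x
  proof -
    obtain w where w: "w \<in> V 1" "w \<noteq> x" using choose_V1[of x x] by blast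
    show ?thesis using eq[of 1 w 0 x 0 w] w v1[OF w(1)] v1[OF x] by (simp add: row_def)
  qed
  have L3: "T 0 x 0 y = 0" if x: "x \<in> V 1" and y: "y \<in> V 1" for x y
  proof -
    have "st x \<in> V 1" using x by simp
    then show ?thesis
      using eq[of 1 "st x" 0 1 0 y] v1[of "st x"] v1[OF x] v1[OF y] q2 by (simp add: row_def split: if_splits)
  qed
  have L4: "T 0 (st 1) 0 1 = 0"
    using eq[of 1 2 0 2 0 1] L3[of 2 "st 2"] by (simp add: row_def)
  have L5: "T 0 1 0 y = 0" if y: "y \<in> V 1" for y
  proof (cases "y = 2 \<or> y = st 2")
    case True
    have "T 0 1 0 (st 2) = 0" using eq[of 2 3 0 1 0 3] by (simp add: row_def)
    then show ?thesis using True q1 by auto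
  next
    case False
    then have "y \<in> V 2" using split2[OF y] by auto
    then have "st y \<in> V 2" by simp
    then show ?thesis using eq[of 2 "st y" 0 1 0 2] v2[of "st y"] by (simp add: row_def)
  qed
  have L6: "T 0 y 0 1 = 0" if y: "y \<in> V 1" for y
  proof -
    have "st y \<in> V 1" using y by simp
    then show ?thesis using eq[of 1 "st y" 0 1 0 1] v1[of "st y"] L5[OF y] by (simp add: row_def)
  qed
  have L: "T 0 x 0 y = 0" if x: "x \<in> V 0" and y: "y \<in> V 0" for x y
  proof -
    have "T 0 (st 1) 0 y = 0" using L1[OF y] L4 by (cases "y = 1") simp_all
    then show ?thesis
      using split1[OF x] split1[OF y] L2[of x] L3[of x y] L5[of y] L6[of x] q0 q2
      by (elim disjE) simp_all
  qed
  have split0: "x = 0 \<or> x = ?o \<or> x \<in> V 0" if "x < N" for x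
  proof (cases "x = 0 \<or> x = ?o")
    case False
    then have "x \<noteq> 0" "st x \<noteq> 0" by (metis st_st)+
    then show ?thesis using that by (auto simp: V_def)
  qed auto
  \<comment> \<open>Up to exchanging its two legs, a pair has one of four normal shapes or repeats
    an even index, in which case antisymmetry kills the component.\<close>
  have pairs: "(a = 0 \<and> b = ?o) \<or> (a = 0 \<and> b \<in> V 0) \<or> (a = ?o \<and> b \<in> V 0) \<or> (a \<in> V 0 \<and> b \<in> V 0)
      \<or> (b = 0 \<and> a = ?o) \<or> (b = 0 \<and> a \<in> V 0) \<or> (b = ?o \<and> a \<in> V 0) \<or> (a = b \<and> \<not> p a)" if "a < N" "b < N" for a b
    using split0[OF that(1)] split0[OF that(2)] by auto
  have normal: "T a b c d = 0"
    if ab: "(a = 0 \<and> b = ?o) \<or> (a = 0 \<and> b \<in> V 0) \<or> (a = ?o \<and> b \<in> V 0) \<or> (a \<in> V 0 \<and> b \<in> V 0)"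
    and cd: "(c = 0 \<and> d = ?o) \<or> (c = 0 \<and> d \<in> V 0) \<or> (c = ?o \<and> d \<in> V 0) \<or> (c \<in> V 0 \<and> d \<in> V 0)" for a b c d
    using ab cd q5 G C1 D L C4 K C3 A1 B1 C2 K' B2 C5 B3 B4 even_skew1[of ?o 0 ?o d] even_skew2[of ?o 0 ?o b]
    by (elim disjE conjE) simp_all
  have half: "T a b c d = 0"
    if ab: "(a = 0 \<and> b = ?o) \<or> (a = 0 \<and> b \<in> V 0) \<or> (a = ?o \<and> b \<in> V 0) \<or> (a \<in> V 0 \<and> b \<in> V 0)"
    and cd: "c < N" "d < N" for a b c d
    using pairs[OF cd] normal[OF ab, of c d] normal[OF ab, of d c] sk2[of a b d c] diag2[of c a b] by auto
  have "T a b c d = 0" if "a < N" "b < N" "c < N" "d < N" for a b c d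
    using pairs[OF that(1,2)] half[of a b c d] half[of b a c d] that(3,4) sk1[of b a c d] even_skew1[of a a c d] by auto
  moreover have "T a b c d = 0" if "\<not> (a < N \<and> b < N \<and> c < N \<and> d < N)" for a b c d
    using T that unfolding W_def by blast
  ultimately show ?thesis by (intro ext) (metis tzero_def)
qed

end

context super_index
begin

section \<open>The six highest weight vectors\<close>

definition etens :: "nat \<Rightarrow> nat \<Rightarrow> nat \<Rightarrow> nat \<Rightarrow> tens" where
  "etens a b c d = (\<lambda>i j k l. if i = a \<and> j = b \<and> k = c \<and> l = d then 1 else 0)"

definition emat :: "nat \<Rightarrow> nat \<Rightarrow> mat" where
  "emat a b = (\<lambda>i j. if i = a \<and> j = b then 1 else 0)"

text \<open>The image of e_a under \<open>X\<close> with every basis vector e_x replaced by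
  \<open>G x\<close>. Rows describe the action on components, columns the action on basis tensors,
  which is what explicit vectors call for.\<close>

definition colsum :: "mat \<Rightarrow> nat \<Rightarrow> (nat \<Rightarrow> complex) \<Rightarrow> complex" where
  "colsum X a G = (\<Sum>x<N. X x a * G x)"

lemma sum_delta_mult:
  fixes A :: "nat \<Rightarrow> complex"
  assumes "a < N"
  shows "(\<Sum>x<N. A x * (if x = a then B else 0)) = A a * B"
proof -
  have "(\<Sum>x<N. A x * (if x = a then B else 0)) = (\<Sum>x<N. if x = a then A a * B else 0)"
    by (rule sum.cong) auto
  then show ?thesis using assms by simp
qed

lemma colsum_delta:
  assumes "osp_h z X" "a < N"
  shows "colsum X a (\<lambda>x. if i = x \<and> P then 1 else 0) = (\<Sum>x<N. X i x * (if x = a \<and> P then 1 else 0))"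
proof -
  have "colsum X a (\<lambda>x. if i = x \<and> P then 1 else 0) = (if P then X i a else 0)"
  proof (cases "i < N")
    case True
    have "colsum X a (\<lambda>x. if i = x \<and> P then 1 else 0) = (\<Sum>x<N. X x a * (if x = i then (if P then 1 else 0) else 0))"
      unfolding colsum_def by (rule sum.cong) auto
    then show ?thesis using sum_delta_mult[OF True] by simp
  next
    case False
    then have "X i a = 0" using osp_h_supp[OF assms(1), of i a] by auto
    moreover have "(\<Sum>x<N. X x a * (if i = x \<and> P then 1 else 0)) = 0"
      using False by (intro sum.neutral) auto
    ultimately show ?thesis by (simp add: colsum_def)
  qed
  also have "\<dots> = (\<Sum>x<N. X i x * (if x = a then (if P then 1 else 0) else 0))"
    using sum_delta_mult[OF assms(2)] by simp
  also have "\<dots> = (\<Sum>x<N. X i x * (if x = a \<and> P then 1 else 0))"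
    by (rule sum.cong) auto
  finally show ?thesis .
qed

lemma Act_etens:
  assumes X: "osp_h z X" and "a < N" "b < N" "c < N" "d < N"
  shows "Act z X (etens a b c d) i j k l
    = colsum X a (\<lambda>x. etens x b c d i j k l) + ksign z (p a) * colsum X b (\<lambda>x. etens a x c d i j k l)
      + ksign z (p a) * ksign z (p b) * colsum X c (\<lambda>x. etens a b x d i j k l)
      + ksign z (p a) * ksign z (p b) * ksign z (p c) * colsum X d (\<lambda>x. etens a b c x i j k l)"
proof -
  have 1: "etens a b c d i j k l = (if i = a \<and> (j = b \<and> k = c \<and> l = d) then 1 else 0)"
    and 2: "etens a b c d i j k l = (if j = b \<and> (i = a \<and> k = c \<and> l = d) then 1 else 0)"
    and 3: "etens a b c d i j k l = (if k = c \<and> (i = a \<and> j = b \<and> l = d) then 1 else 0)"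
    and 4: "etens a b c d i j k l = (if l = d \<and> (i = a \<and> j = b \<and> k = c) then 1 else 0)" for a b c d i j k l
    by (auto simp: etens_def)
  note cd = colsum_delta[OF X]
  have "colsum X a (\<lambda>x. etens x b c d i j k l) = (\<Sum>x<N. X i x * etens a b c d x j k l)"
    unfolding 1 by (rule cd) fact
  moreover have "colsum X b (\<lambda>x. etens a x c d i j k l) = (\<Sum>x<N. X j x * etens a b c d i x k l)"
    unfolding 2 by (rule cd) fact
  moreover have "colsum X c (\<lambda>x. etens a b x d i j k l) = (\<Sum>x<N. X k x * etens a b c d i j x l)"
    unfolding 3 by (rule cd) fact
  moreover have "colsum X d (\<lambda>x. etens a b c x i j k l) = (\<Sum>x<N. X l x * etens a b c d i j k x)"
    unfolding 4 by (rule cd) fact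
  moreover have "i \<noteq> a \<or> j \<noteq> b \<or> k \<noteq> c \<Longrightarrow> etens a b c d i j k l = 0" for i j k l
    by (auto simp: etens_def)
  ultimately show ?thesis
    by (cases "i = a"; cases "j = b"; cases "k = c") (simp_all add: Act_def leg_defs)
qed

lemma Act2_emat:
  assumes X: "osp_h z X" and "a < N" "b < N"
  shows "Act2 z X (emat a b) i j = colsum X a (\<lambda>x. emat x b i j) + ksign z (p a) * colsum X b (\<lambda>x. emat a x i j)"
proof -
  have 2: "emat a b i j = (if j = b \<and> i = a then 1 else 0)" for a b i j by (auto simp: emat_def)
  have "colsum X a (\<lambda>x. emat x b i j) = (\<Sum>x<N. X i x * emat a b x j)"
    unfolding emat_def by (rule colsum_delta[OF X]) fact
  moreover have "colsum X b (\<lambda>x. emat a x i j) = (\<Sum>x<N. X j x * emat a b i x)"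
    unfolding 2 by (rule colsum_delta[OF X]) fact
  moreover have "i \<noteq> a \<Longrightarrow> emat a b i j = 0" for i j by (simp add: emat_def)
  ultimately show ?thesis by (cases "i = a") (simp_all add: Act2_def)
qed

lemma form_etens:
  assumes "a < N" "b < N" "c < N" "d < N" "\<not> p a" "\<not> p b" "\<not> p c" "\<not> p d"
  shows "form (etens a b c d) T = T a b c d"
proof -
  have *: "(\<Sum>x<N. (if x = y then 1 else 0) * G x) = G y" if "y < N" for y and G :: "nat \<Rightarrow> complex"
  proof -
    have "(\<Sum>x<N. (if x = y then 1 else 0) * G x) = (\<Sum>x<N. if x = y then G x else 0)"
      by (rule sum.cong) auto
    then show ?thesis using that by simp
  qed
  have "form (etens a b c d) T = (\<Sum>i<N. (if i = a then 1 else 0) * (\<Sum>j<N. (if j = b then 1 else 0) *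
      (\<Sum>k<N. (if k = c then 1 else 0) * (\<Sum>l<N. (if l = d then 1 else 0) * (om i * om j * om k * om l * T i j k l)))))"
    unfolding form_def sum_distrib_left by (intro sum.cong refl) (auto simp: etens_def)
  then show ?thesis using assms by (simp add: * om_def)
qed

text \<open>The tensor product of e_a wedge e_b and e_c wedge e_d in the super sense; for an odd
  letter, e_a wedge e_a does not vanish.\<close>

definition wdg :: "nat \<Rightarrow> nat \<Rightarrow> nat \<Rightarrow> nat \<Rightarrow> tens" where
  "wdg a b c d = skew (etens a b c d)"

lemma wdg_component:
  "wdg a b c d i j k l = etens a b c d i j k l - ksign (p a) (p b) * etens b a c d i j k l
     - ksign (p c) (p d) * etens a b d c i j k l + ksign (p a) (p b) * ksign (p c) (p d) * etens b a d c i j k l"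
proof -
  have "ksign (p i) (p j) * etens a b c d j i k l = ksign (p a) (p b) * etens b a c d i j k l"
    "ksign (p k) (p l) * etens a b c d i j l k = ksign (p c) (p d) * etens a b d c i j k l"
    for a b c d i j k l by (auto simp: etens_def ksign_commute)
  then show ?thesis
    by (simp add: wdg_def skew_def tadd_def tscale_def sw12_def sw34_def mult.left_commute)
qed

lemma wdg_in_W:
  assumes "a < N" "b < N" "c < N" "d < N"
  shows "wdg a b c d \<in> W"
  unfolding wdg_def by (rule skew_in_W) (use assms in \<open>auto simp: supp_def etens_def split: if_splits\<close>)

lemma Act_wdg:
  assumes X: "osp_h z X" and "a < N" "b < N" "c < N" "d < N"
  shows "Act z X (wdg a b c d) i j k l
    = colsum X a (\<lambda>x. wdg x b c d i j k l) + ksign z (p a) * colsum X b (\<lambda>x. wdg a x c d i j k l)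
      + ksign z (p a) * ksign z (p b) * colsum X c (\<lambda>x. wdg a b x d i j k l)
      + ksign z (p a) * ksign z (p b) * ksign z (p c) * colsum X d (\<lambda>x. wdg a b c x i j k l)"
proof -
  have "colsum X q (\<lambda>x. skew (G x) i j k l) = skew (\<lambda>i j k l. colsum X q (\<lambda>x. G x i j k l)) i j k l" for q G
    unfolding colsum_def skew_def tadd_def tscale_def sw12_def sw34_def
    by (simp add: sum_pull distrib_left sum.distrib right_diff_distrib sum_subtractf)
  moreover have "skew (\<lambda>i j k l. A i j k l + s * B i j k l + t * C i j k l + u * D i j k l) i j k l
    = skew A i j k l + s * skew B i j k l + t * skew C i j k l + u * skew D i j k l" for A B C D s t u
    by (simp add: skew_def tadd_def tscale_def sw12_def sw34_def algebra_simps)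
  moreover have "Act z X (etens a b c d) = (\<lambda>i j k l.
      colsum X a (\<lambda>x. etens x b c d i j k l) + ksign z (p a) * colsum X b (\<lambda>x. etens a x c d i j k l)
      + ksign z (p a) * ksign z (p b) * colsum X c (\<lambda>x. etens a b x d i j k l)
      + ksign z (p a) * ksign z (p b) * ksign z (p c) * colsum X d (\<lambda>x. etens a b c x i j k l))"
    by (intro ext) (rule Act_etens[OF assms])
  ultimately show ?thesis
    by (simp add: wdg_def Act_skew[OF osp_h_homog[OF X]])
qed

definition diagonal :: "mat \<Rightarrow> bool" where
  "diagonal H \<longleftrightarrow> (\<forall>i j. i \<noteq> j \<longrightarrow> H i j = 0)"

definition dmat :: "(nat \<Rightarrow> complex) \<Rightarrow> mat" where
  "dmat h = (\<lambda>i j. if i = j \<and> i < N then h i else 0)"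

lemma diagonal_dmat: "diagonal (dmat h)"
  by (simp add: diagonal_def dmat_def)

lemma osp_h_dmat:
  assumes "\<And>i. i < N \<Longrightarrow> h (st i) = - h i"
  shows "osp_h False (dmat h)"
proof (rule osp_hI)
  fix i j assume "i < N" "j < N"
  then show "dmat h i j = - ksign False (p j) * eta i * eta j * dmat h (st j) (st i)"
    by (cases "i = j") (simp_all add: dmat_def assms)
qed (auto simp: dmat_def homog_def split: if_splits)

lemma colsum_diagonal: "diagonal H \<Longrightarrow> a < N \<Longrightarrow> colsum H a G = H a a * G a"
proof -
  assume H: "diagonal H" and a: "a < N"
  have "colsum H a G = (\<Sum>x<N. if x = a then H a a * G a else 0)"
    unfolding colsum_def by (rule sum.cong) (use H in \<open>auto simp: diagonal_def\<close>)
  then show ?thesis using a by simp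
qed

lemma Act_wd_diagonal:
  "osp_h False H \<Longrightarrow> diagonal H \<Longrightarrow> a < N \<Longrightarrow> b < N \<Longrightarrow> c < N \<Longrightarrow> d < N \<Longrightarrow>
    Act False H (wdg a b c d) = tscale (H a a + H b b + H c c + H d d) (wdg a b c d)"
  by (intro ext) (simp add: Act_wdg colsum_diagonal tscale_def algebra_simps)

lemma W_add: "S \<in> W \<Longrightarrow> T \<in> W \<Longrightarrow> tadd S T \<in> W"
  and W_scale: "T \<in> W \<Longrightarrow> tscale k T \<in> W"
  using W_subspace by (simp_all add: is_subspace_def)

lemma hwv_add: "hwv ht S \<Longrightarrow> hwv ht T \<Longrightarrow> hwv ht (tadd S T)"
  unfolding hwv_def Act_add by (simp add: tadd_def tzero_def)

lemma hwv_scale: "hwv ht T \<Longrightarrow> hwv ht (tscale k T)"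
  unfolding hwv_def Act_scale by (simp add: tscale_def tzero_def)

definition weightv :: "(mat \<Rightarrow> complex) \<Rightarrow> tens \<Rightarrow> bool" where
  "weightv w T \<longleftrightarrow> (\<forall>H. osp_h False H \<and> diagonal H \<longrightarrow> Act False H T = tscale (w H) T)"

lemma psi_zero: "psi (\<lambda>i j. 0) = tzero"
  by (intro ext) (simp add: psi_component tzero_def)

lemma hwv_psi:
  assumes "\<And>z X i j. osp_h z X \<Longrightarrow> raising ht X \<Longrightarrow> Act2 z X h i j = 0"
  shows "hwv ht (psi h)"
  unfolding hwv_def
proof (intro allI impI, elim conjE)
  fix z X assume X: "osp_h z X" "raising ht X"
  have "Act2 z X h = (\<lambda>i j. 0)" using assms[OF X] by (intro ext)
  then show "Act z X (psi h) = tzero" by (simp add: Act_psi[OF X(1)] psi_zero)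
qed

lemma psi_scale: "psi (\<lambda>i j. k * h i j) = tscale k (psi h)"
  by (intro ext) (simp add: psi_component tscale_def algebra_simps)

lemma Act2_add: "Act2 z X (\<lambda>i j. g i j + h i j) i j = Act2 z X g i j + Act2 z X h i j"
  by (simp add: Act2_def distrib_left sum.distrib)

lemma Act2_scale: "Act2 z X (\<lambda>i j. k * h i j) i j = k * Act2 z X h i j"
  by (simp add: Act2_def sum_distrib_left distrib_left mult_ac)

end

context osp_weights
begin

text \<open>\<open>hw 3\<close> is the total antisymmetrisation of e_0, e_1, e_2, e_3. The entries
  2, 4 and 5 are the images under \<open>psi\<close> of the highest symmetric tensor, the highest
  antisymmetric tensor and the invariant of V tensor V.\<close>

definition hw :: "nat \<Rightarrow> tens" where
  "hw r = [wdg 0 1 0 1,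
          tadd (wdg 0 1 0 2) (tscale (-1) (wdg 0 2 0 1)),
          psi (emat 0 0),
          tadd (tadd (tadd (wdg 0 1 2 3) (wdg 2 3 0 1)) (tscale (-1) (tadd (wdg 0 2 1 3) (wdg 1 3 0 2)))) (tadd (wdg 0 3 1 2) (wdg 1 2 0 3)),
          psi (\<lambda>i j. emat 0 1 i j + (-1) * emat 1 0 i j),
          psi Kt] ! r"

definition wts :: "nat \<Rightarrow> mat \<Rightarrow> complex" where
  "wts r H = [2 * H 0 0 + 2 * H 1 1, 2 * H 0 0 + H 1 1 + H 2 2, 2 * H 0 0,
              H 0 0 + H 1 1 + H 2 2 + H 3 3, H 0 0 + H 1 1, 0] ! r"

lemma hw_simps:
  "hw 0 = wdg 0 1 0 1"
  "hw 1 = tadd (wdg 0 1 0 2) (tscale (-1) (wdg 0 2 0 1))"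
  "hw 2 = psi (emat 0 0)"
  "hw 3 = tadd (tadd (tadd (wdg 0 1 2 3) (wdg 2 3 0 1)) (tscale (-1) (tadd (wdg 0 2 1 3) (wdg 1 3 0 2)))) (tadd (wdg 0 3 1 2) (wdg 1 2 0 3))"
  "hw 4 = psi (\<lambda>i j. emat 0 1 i j + (-1) * emat 1 0 i j)"
  "hw 5 = psi Kt"
  by (simp_all add: hw_def eval_nat_numeral)

lemma wts_simps:
  "wts 0 H = 2 * H 0 0 + 2 * H 1 1" "wts 1 H = 2 * H 0 0 + H 1 1 + H 2 2" "wts 2 H = 2 * H 0 0"
  "wts 3 H = H 0 0 + H 1 1 + H 2 2 + H 3 3" "wts 4 H = H 0 0 + H 1 1" "wts 5 H = 0"
  by (simp_all add: wts_def eval_nat_numeral)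

lemma less6_cases: "r < 6 \<Longrightarrow> r = 0 \<or> r = 1 \<or> r = 2 \<or> r = 3 \<or> r = 4 \<or> r = (5::nat)"
  by auto

lemma less6_induct: "P 0 \<Longrightarrow> P 1 \<Longrightarrow> P 2 \<Longrightarrow> P 3 \<Longrightarrow> P 4 \<Longrightarrow> P 5 \<Longrightarrow> r < 6 \<Longrightarrow> P (r::nat)"
  using less6_cases by blast

text \<open>The indices above a < 4 are exactly those smaller than a, so on the top letters a
  raising element is strictly upper triangular.\<close>

lemma raising_colsum:
  assumes X: "osp_h z X" "raising ht X"
  shows "colsum X 0 G = 0" "colsum X 1 G = X 0 1 * G 0" "colsum X 2 G = X 0 2 * G 0 + X 1 2 * G 1"
    "colsum X 3 G = X 0 3 * G 0 + X 1 3 * G 1 + X 2 3 * G 2"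
proof -
  have z: "X x a = 0" if "a < 4" "a \<le> x" for a x
  proof (rule ccontr)
    assume nz: "X x a \<noteq> 0"
    then have "ht a < ht x" "x < N" using X(2) osp_h_supp[OF X(1)] by (auto simp: raising_def)
    moreover have "ht x \<le> ht a" using ht_low[OF that(1), of x] that(2) \<open>x < N\<close> by (cases "x = a") auto
    ultimately show False by simp
  qed
  have sub: "colsum X a G = (\<Sum>x<a. X x a * G x)" if "a < 4" for a
    unfolding colsum_def
    using that four_le_N z[OF that] by (intro sum.mono_neutral_right) auto
  show "colsum X 0 G = 0" "colsum X 1 G = X 0 1 * G 0" "colsum X 2 G = X 0 2 * G 0 + X 1 2 * G 1"
    "colsum X 3 G = X 0 3 * G 0 + X 1 3 * G 1 + X 2 3 * G 2"
    using sub[of 0] sub[of 1] sub[of 2] sub[of 3] by (simp_all add: eval_nat_numeral)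
qed

lemma hw_in_W: "r < 6 \<Longrightarrow> hw r \<in> W"
proof (rule less6_induct[where P = "\<lambda>r. hw r \<in> W"])
  show "hw 0 \<in> W" "hw 1 \<in> W" "hw 3 \<in> W" unfolding hw_simps by (intro W_add W_scale wdg_in_W; simp)+
  show "hw 2 \<in> W" "hw 4 \<in> W" "hw 5 \<in> W"
    unfolding hw_simps by (rule psi_in_W; auto simp: emat_def Kt_def split: if_splits)+
qed

lemma hw_hwv: "r < 6 \<Longrightarrow> hwv ht (hw r)"
proof (rule less6_induct[where P = "\<lambda>r. hwv ht (hw r)"])
  note [simp del] = One_nat_def
  have diag: "wdg a a c d i j k l = 0" "wdg c d a a i j k l = 0" if "\<not> p a" for a c d i j k l
    using that by (simp_all add: wdg_component)
  have flip: "wdg b a c d i j k l = - wdg a b c d i j k l" "wdg c d b a i j k l = - wdg c d a b i j k l"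
    if "\<not> p a" "\<not> p b" for a b c d i j k l
    using that by (simp_all add: wdg_component)
  have "Act z X (hw 0) i j k l = 0" "Act z X (hw 1) i j k l = 0" "Act z X (hw 3) i j k l = 0"
    if X: "osp_h z X" "raising ht X" for z X i j k l
    unfolding hw_simps Act_add Act_scale
    by (simp_all add: tadd_def tscale_def Act_wdg[OF X(1)] raising_colsum[OF X] diag algebra_simps
        flip[of 0 1] flip[of 0 2] flip[of 1 2])
  then show "hwv ht (hw 0)" "hwv ht (hw 1)" "hwv ht (hw 3)"
    unfolding hwv_def by (auto simp: fun_eq_iff tzero_def)
  have "Act2 z X (emat 0 0) i j = 0" "Act2 z X (\<lambda>i j. emat 0 1 i j + (-1) * emat 1 0 i j) i j = 0"
    if X: "osp_h z X" "raising ht X" for z X i j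
    by (simp_all only: Act2_add Act2_scale) (simp_all add: Act2_emat[OF X(1)] raising_colsum[OF X])
  then show "hwv ht (hw 2)" "hwv ht (hw 4)"
    unfolding hw_simps by (auto intro!: hwv_psi simp del: One_nat_def)
  show "hwv ht (hw 5)" unfolding hw_simps by (rule hwv_psi) (rule Kt_invariant)
qed

lemma psi_weight:
  assumes "osp_h False H" "\<And>i j. Act2 False H h i j = k * h i j"
  shows "Act False H (psi h) = tscale k (psi h)"
proof -
  have "Act2 False H h = (\<lambda>i j. k * h i j)" by (intro ext) (rule assms(2))
  then show ?thesis by (simp add: Act_psi[OF assms(1)] psi_scale)
qed

lemma hw_weight: "r < 6 \<Longrightarrow> weightv (wts r) (hw r)"
proof (rule less6_induct[where P = "\<lambda>r. weightv (wts r) (hw r)"])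
  note [simp del] = One_nat_def
  show "weightv (wts 0) (hw 0)"
    unfolding weightv_def hw_simps wts_simps
    by (intro allI impI ext, elim conjE) (simp add: Act_add Act_scale Act_wd_diagonal, simp add: tadd_def tscale_def algebra_simps)
  show "weightv (wts 1) (hw 1)"
    unfolding weightv_def hw_simps wts_simps
    by (intro allI impI ext, elim conjE) (simp add: Act_add Act_scale Act_wd_diagonal, simp add: tadd_def tscale_def algebra_simps)
  show "weightv (wts 3) (hw 3)"
    unfolding weightv_def hw_simps wts_simps
    by (intro allI impI ext, elim conjE) (simp add: Act_add Act_scale Act_wd_diagonal, simp add: tadd_def tscale_def algebra_simps)
  show "weightv (wts 2) (hw 2)"
    unfolding weightv_def hw_simps wts_simps
    by (intro allI impI psi_weight) (simp_all add: Act2_emat colsum_diagonal)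
  show "weightv (wts 4) (hw 4)"
    unfolding weightv_def hw_simps wts_simps
    by (intro allI impI psi_weight; elim conjE; (simp only: Act2_add Act2_scale)?) (simp_all add: Act2_emat colsum_diagonal algebra_simps)
  show "weightv (wts 5) (hw 5)"
    unfolding weightv_def hw_simps wts_simps
    by (intro allI impI psi_weight) (simp_all add: Kt_invariant)
qed

end

context super_index
begin

section \<open>Submodules generated by singular vectors\<close>

definition Wsub :: "tens set \<Rightarrow> bool" where
  "Wsub U \<longleftrightarrow> U \<subseteq> W \<and> is_subspace U \<and> (\<forall>z X T. osp_h z X \<longrightarrow> T \<in> U \<longrightarrow> Act z X T \<in> U)"

text \<open>The superdimension of V, which is M = m - 2n in the matrix model.\<close>

definition sdim :: complex where
  "sdim = (\<Sum>b<N. ksign (p b) (p b))"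

text \<open>Generation uses lowering operators only, so that orthogonality statements can be proved
  by an induction in which each step becomes a raising operator on the other side of the
  form.\<close>

inductive_set gen :: "(nat \<Rightarrow> int) \<Rightarrow> tens \<Rightarrow> tens set" for ht :: "nat \<Rightarrow> int" and u :: tens where
  base: "u \<in> gen ht u"
| zero: "tzero \<in> gen ht u"
| add: "S \<in> gen ht u \<Longrightarrow> T \<in> gen ht u \<Longrightarrow> tadd S T \<in> gen ht u"
| scale: "T \<in> gen ht u \<Longrightarrow> tscale k T \<in> gen ht u"
| lower: "T \<in> gen ht u \<Longrightarrow> osp_h z X \<Longrightarrow> raising (\<lambda>i. - ht i) X \<Longrightarrow> Act z X T \<in> gen ht u"

lemma gen_subspace: "is_subspace (gen ht u)"
  unfolding is_subspace_def by (auto intro: gen.intros)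

lemma gen_subset: "Wsub U \<Longrightarrow> u \<in> U \<Longrightarrow> gen ht u \<subseteq> U"
proof
  fix T assume U: "Wsub U" "u \<in> U" and "T \<in> gen ht u"
  from this(3) show "T \<in> U"
    by induction (use U in \<open>auto simp: Wsub_def is_subspace_def\<close>)
qed

lemma Wsub_W: "Wsub W"
  by (simp add: Wsub_def W_subspace W_Act)

lemma raising_dag: "raising (\<lambda>i. - ht i) X \<Longrightarrow> raising ht (dag X)"
  by (simp add: raising_def dag_def)

text \<open>Moved across the form, the outermost lowering operator becomes a raising one and
  annihilates \<open>w\<close>; only multiples of \<open>u\<close> itself can pair with
  \<open>w\<close>.\<close>

lemma gen_orth:
  assumes "hwv ht w" "form w u = 0" "T \<in> gen ht u"
  shows "form w T = 0"
  using assms(3)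
proof induction
  case (lower T z X)
  have "form w (Act z X T) = form T (Act z (dag X) w)"
    by (simp add: form_commute[of w] form_Act)
  also have "Act z (dag X) w = tzero"
    using assms(1) lower osp_h_dag raising_dag by (simp add: hwv_def)
  finally show ?case by (simp add: form_tzero)
qed (use assms in \<open>simp_all add: form_tadd form_tscale form_tzero\<close>)

lemma Act_zero_matrix: "Act z (\<lambda>i j. 0) T = tzero"
  by (intro ext) (simp add: Act_def leg_defs tzero_def)

text \<open>The relation defining osp couples the position (b, c) only with (st c, st b), so any set
  of positions stable under this exchange may be cut out.\<close>

lemma osp_h_restrict:
  assumes X: "osp_h z X" and P: "\<And>i j. i < N \<Longrightarrow> j < N \<Longrightarrow> P (st j) (st i) = P i j"
  shows "osp_h z (\<lambda>i j. if P i j then X i j else 0)"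
proof (rule osp_hI)
  fix b c assume b: "b < N" and c: "c < N"
  have "X b c = - ksign z (p c) * eta b * eta c * X (st c) (st b)" by (rule osp_h_relation[OF X b c])
  then show "(if P b c then X b c else 0) = - ksign z (p c) * eta b * eta c * (if P (st c) (st b) then X (st c) (st b) else 0)"
    using P[OF b c] by simp
qed (use osp_h_supp[OF X] osp_h_homog[OF X] in \<open>auto simp: homog_def split: if_splits\<close>)

text \<open>Closure under lowering operators suffices: a general X is moved past each lowering
  operator at the cost of a bracket acting on a shorter product.\<close>

lemma gen_stable:
  assumes ht: "\<And>i. i < N \<Longrightarrow> ht (st i) = - ht i" "inj_on ht {..<N}"
    and u: "hwv ht u" "weightv w u"
    and T: "T \<in> gen ht u" and X: "osp_h z X"
  shows "Act z X T \<in> gen ht u"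
  using T X
proof (induction arbitrary: z X)
  case base
  \<comment> \<open>Triangular decomposition by height: \<open>X1\<close> annihilates
    \<open>u\<close>, \<open>X2\<close> is a lowering operator, and \<open>X0\<close> is diagonal
    because \<open>ht\<close> is injective on the indices.\<close>
  define X1 where "X1 = (\<lambda>i j. if ht j < ht i then X i j else 0)"
  define X2 where "X2 = (\<lambda>i j. if ht j > ht i then X i j else 0)"
  define X0 where "X0 = (\<lambda>i j. if ht j = ht i then X i j else 0)"
  have osp_h: "osp_h z X1" "osp_h z X2" "osp_h z X0"
    unfolding X1_def X2_def X0_def by (rule osp_h_restrict[OF base]; use ht(1) in auto)+
  have "X = (\<lambda>i j. (X1 i j + X2 i j) + X0 i j)"
    by (intro ext) (auto simp: X1_def X2_def X0_def)
  then have "Act z X u = tadd (tadd (Act z X1 u) (Act z X2 u)) (Act z X0 u)"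
    using Act_matrix_add[of z "\<lambda>i j. X1 i j + X2 i j" X0 u] Act_matrix_add[of z X1 X2 u] by simp
  moreover have "Act z X1 u = tzero"
    using u(1) osp_h(1) by (auto simp: hwv_def raising_def X1_def)
  moreover have "Act z X2 u \<in> gen ht u"
    by (rule gen.lower[OF gen.base osp_h(2)]) (auto simp: raising_def X2_def)
  moreover have "Act z X0 u \<in> gen ht u"
  proof -
    have d: "diagonal X0"
      unfolding diagonal_def
    proof (intro allI impI)
      fix i j :: nat assume "i \<noteq> j"
      then show "X0 i j = 0"
        using osp_h_supp[OF base, of i j] inj_onD[OF ht(2), of i j] by (cases "X i j = 0") (auto simp: X0_def)
    qed
    show ?thesis
    proof (cases z)
      case True
      \<comment> \<open>A diagonal entry joins equal parities, so an odd diagonal element is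
        zero.\<close>
      have "X0 i i = 0" for i using osp_h_parity[OF osp_h(3), of i i] True by auto
      then have "X0 = (\<lambda>i j. 0)" using d unfolding diagonal_def by (intro ext) metis
      then show ?thesis by (simp add: Act_zero_matrix gen.zero)
    next
      case False
      then have "Act z X0 u = tscale (w X0) u" using u(2) osp_h(3) d by (simp add: weightv_def)
      then show ?thesis by (simp add: gen.scale gen.base)
    qed
  qed
  ultimately show ?case by (simp add: gen.intros)
next
  case (lower T y Y)
  have "Act z X (Act y Y T) = tadd (tscale (ksign z y) (Act y Y (Act z X T))) (Act (z \<noteq> y) (br z y X Y) T)"
    by (rule Act_bracket) (use lower osp_h_homog in auto)
  moreover have "Act (z \<noteq> y) (br z y X Y) T \<in> gen ht u"
    by (rule lower.IH[OF osp_h_br]) (use lower in auto)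
  moreover have "Act y Y (Act z X T) \<in> gen ht u"
    by (rule gen.lower[OF lower.IH]) (use lower in auto)
  ultimately show ?case by (simp only: gen.add gen.scale)
qed (simp_all add: Act_zero Act_add Act_scale gen.intros)

lemma gen_Wsub:
  assumes "\<And>i. i < N \<Longrightarrow> ht (st i) = - ht i" "inj_on ht {..<N}" "hwv ht u" "weightv w u" "u \<in> W"
  shows "Wsub (gen ht u)"
  unfolding Wsub_def
  using gen_subset[OF Wsub_W assms(5)] gen_subspace gen_stable[OF assms(1-4)] by blast

text \<open>Induction on the first vector: each lowering operator is moved to the second one, whose
  module is stable under all of osp, until \<open>u\<close> is left and \<open>gen_orth\<close>
  applies.\<close>

lemma gen_orthogonal:
  assumes ht: "\<And>i. i < N \<Longrightarrow> ht (st i) = - ht i" "inj_on ht {..<N}"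
    and u: "hwv ht u" "form u u' = 0" and u': "hwv ht u'" "weightv w u'"
    and S: "S \<in> gen ht u" and T: "T \<in> gen ht u'"
  shows "form S T = 0"
  using S T
proof (induction arbitrary: T)
  case base
  then show ?case using gen_orth[OF u] by simp
next
  case (lower S z X)
  have "Act z (dag X) T \<in> gen ht u'"
    by (rule gen_stable[OF ht u' lower.prems osp_h_dag[OF lower.hyps(2)]])
  then show ?case by (simp add: form_Act lower.IH)
qed (simp_all add: form_tadd form_tscale form_tzero)

text \<open>Raising operators strictly increase the minimal height of the support.\<close>

lemma exists_hwv:
  assumes U: "Wsub U" and ne: "U \<noteq> {tzero}"
  shows "\<exists>T\<in>U. T \<noteq> tzero \<and> hwv ht T"
proof -
  define lev where "lev T k \<longleftrightarrow> (\<forall>a b c d. T a b c d \<noteq> 0 \<longrightarrow> k \<le> ht a + ht b + ht c + ht d)" for T :: tens and k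
  define C where "C = (\<Sum>i<N. \<bar>ht i\<bar>)"
  have C: "\<bar>ht i\<bar> \<le> C" if "i < N" for i
    unfolding C_def using that by (intro member_le_sum) auto
  have C4: "\<bar>ht a + ht b + ht c + ht d\<bar> \<le> 4 * C" if "a < N" "b < N" "c < N" "d < N" for a b c d
    using C[OF that(1)] C[OF that(2)] C[OF that(3)] C[OF that(4)] by linarith
  have supp: "a < N \<and> b < N \<and> c < N \<and> d < N" if "T \<in> U" "T a b c d \<noteq> 0" for T a b c d
  proof -
    have "T \<in> W" using that(1) U by (auto simp: Wsub_def)
    then show ?thesis using that(2) by (simp add: W_iff supp_def)
  qed
  \<comment> \<open>The height of a component lies between -4C and 4C. The shift by 4C turns levels
    into natural numbers bounded by 8C, so a greatest attained level exists.\<close>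
  define Q where "Q k \<longleftrightarrow> (\<exists>T\<in>U. T \<noteq> tzero \<and> lev T (int k - 4 * C))" for k :: nat
  have "tzero \<in> U" using U by (simp add: Wsub_def is_subspace_def)
  then obtain T0 where T0: "T0 \<in> U" "T0 \<noteq> tzero" using ne by blast
  have "lev T0 (int 0 - 4 * C)"
    unfolding lev_def
  proof (intro allI impI)
    fix a b c d assume "T0 a b c d \<noteq> 0"
    then have "\<bar>ht a + ht b + ht c + ht d\<bar> \<le> 4 * C" using supp[OF T0(1)] C4 by blast
    then show "int 0 - 4 * C \<le> ht a + ht b + ht c + ht d" by simp
  qed
  then have "Q 0" using T0 unfolding Q_def by blast
  moreover have bound: "k \<le> nat (8 * C)" if "Q k" for k
  proof -
    from that obtain T where T: "T \<in> U" "T \<noteq> tzero" "lev T (int k - 4 * C)" unfolding Q_def by blast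
    from T(2) obtain a b c d where nz: "T a b c d \<noteq> 0" by (auto simp: fun_eq_iff tzero_def)
    then have "int k - 4 * C \<le> ht a + ht b + ht c + ht d" using T(3) by (simp add: lev_def)
    moreover have "ht a + ht b + ht c + ht d \<le> 4 * C" using C4 supp[OF T(1) nz] abs_le_D1 by blast
    ultimately show ?thesis by linarith
  qed
  ultimately obtain k where k: "Q k" "\<And>j. Q j \<Longrightarrow> j \<le> k"
    using GreatestI_nat[of Q 0 "nat (8 * C)"] Greatest_le_nat[of Q _ "nat (8 * C)"] by blast
  then obtain T where T: "T \<in> U" "T \<noteq> tzero" "lev T (int k - 4 * C)" unfolding Q_def by blast
  have "Act z X T = tzero" if X: "osp_h z X" "raising ht X" for z X
  proof (rule ccontr)
    assume nz: "Act z X T \<noteq> tzero"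
    have "Act z X T \<in> U" using U X(1) T(1) by (simp add: Wsub_def)
    moreover have "lev (Act z X T) (int (Suc k) - 4 * C)"
      unfolding lev_def
    proof (intro allI impI)
      fix a b c d
      assume nz: "Act z X T a b c d \<noteq> 0"
      have l: "T i j q l \<noteq> 0 \<Longrightarrow> int k - 4 * C \<le> ht i + ht j + ht q + ht l" for i j q l
        using T(3) by (simp add: lev_def)
      have r: "X i j \<noteq> 0 \<Longrightarrow> ht j < ht i" for i j using X(2) by (simp add: raising_def)
      from nz show "int (Suc k) - 4 * C \<le> ht a + ht b + ht c + ht d"
        by (cases rule: Act_nonzeroE) (use l r in fastforce)+
    qed
    ultimately have "Q (Suc k)" using nz unfolding Q_def by blast
    then show False using k(2) by fastforce
  qed
  then show ?thesis using T unfolding hwv_def by blast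
qed

text \<open>A linear functional vanishing on \<open>U\<close> but not at \<open>T\<close> is
  represented by \<open>form\<close>, up to the factor 4, by an element of \<open>W\<close>.\<close>

lemma perp_nonzero:
  assumes U: "is_subspace U" "U \<subseteq> W" and T: "T \<in> W" "T \<notin> U"
  shows "\<exists>S\<in>W. S \<noteq> tzero \<and> (\<forall>u\<in>U. form S u = 0)"
proof -
  define flat where "flat T = (\<lambda>(a, b, c, d). T a b c d)" for T :: tens
  define A where "A = {..<N} \<times> {..<N} \<times> {..<N} \<times> {..<N}"
  have inj: "flat S = flat T \<longleftrightarrow> S = T" for S T by (auto simp: flat_def fun_eq_iff)
  have supp: "\<forall>k. k \<notin> A \<longrightarrow> flat S k = 0" if "S \<in> W" for S
    using that unfolding W_iff supp_def A_def flat_def by auto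
  have "\<exists>c. (\<forall>u\<in>flat ` U. (\<Sum>k\<in>A. c k * u k) = 0) \<and> (\<Sum>k\<in>A. c k * flat T k) \<noteq> 0"
  proof (rule separating_functional)
    show "finite A" by (simp add: A_def)
    show "\<forall>k. k \<notin> A \<longrightarrow> u k = 0" if "u \<in> flat ` U" for u using that U(2) supp by blast
    show "(\<lambda>k. 0) \<in> flat ` U"
      by (rule image_eqI[of _ _ tzero]) (use U(1) in \<open>auto simp: flat_def tzero_def is_subspace_def\<close>)
    show "(\<lambda>k. u k + a * w k) \<in> flat ` U" if "u \<in> flat ` U" "w \<in> flat ` U" for u w a
    proof -
      from that obtain u' w' where *: "u' \<in> U" "w' \<in> U" "u = flat u'" "w = flat w'" by blast
      then have "tadd u' (tscale a w') \<in> U" using U(1) by (simp add: is_subspace_def)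
      moreover have "(\<lambda>k. u k + a * w k) = flat (tadd u' (tscale a w'))"
        by (auto simp: * flat_def tadd_def tscale_def)
      ultimately show ?thesis by blast
    qed
    show "\<forall>k. k \<notin> A \<longrightarrow> flat T k = 0" by (rule supp[OF T(1)])
    show "flat T \<notin> flat ` U" using T(2) by (auto simp: inj)
  qed
  then obtain c where c: "\<And>u. u \<in> U \<Longrightarrow> (\<Sum>k\<in>A. c k * flat u k) = 0" "(\<Sum>k\<in>A. c k * flat T k) \<noteq> 0"
    by blast
  \<comment> \<open>Dividing by the weights of \<open>form\<close> represents the functional by an
    arbitrary tensor; \<open>skew\<close> then moves it into \<open>W\<close>, multiplying its
    values on \<open>W\<close> by 4.\<close>
  define S0 :: tens where "S0 = (\<lambda>i j k l. if i < N \<and> j < N \<and> k < N \<and> l < N then c (i, j, k, l) / (om i * om j * om k * om l) else 0)"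
  define S where "S = skew S0"
  have form_S0: "form S0 R = (\<Sum>k\<in>A. c k * flat R k)" for R
  proof -
    have "form S0 R = (\<Sum>i<N. \<Sum>j<N. \<Sum>k<N. \<Sum>l<N. c (i, j, k, l) * R i j k l)"
      unfolding form_def by (intro sum.cong refl) (simp add: S0_def)
    also have "\<dots> = (\<Sum>k\<in>A. c k * flat R k)"
      unfolding A_def by (simp add: sum.cartesian_product flat_def case_prod_unfold)
    finally show ?thesis .
  qed
  have form_S: "form S R = 4 * form S0 R" if "R \<in> W" for R
    unfolding S_def by (rule form_skew[OF that])
  have "S \<in> W"
    unfolding S_def by (rule skew_in_W) (simp add: supp_def S0_def)
  moreover have "form S u = 0" if "u \<in> U" for u
    using c(1)[OF that] form_S[of u] form_S0[of u] U(2) that by auto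
  moreover have "form S T \<noteq> 0" using form_S[OF T(1)] form_S0[of T] c(2) by simp
  then have "S \<noteq> tzero" by (auto simp: form_tzero)
  ultimately show ?thesis by blast
qed

end

locale osp_generic = osp_weights +
  assumes sdim_neq: "sdim \<noteq> 0" "sdim \<noteq> 1" "sdim \<noteq> 2"
begin

lemma hw_norm: "r < 6 \<Longrightarrow> form (hw r) (hw r) \<noteq> 0"
proof (rule less6_induct[where P = "\<lambda>r. form (hw r) (hw r) \<noteq> 0"])
  note [simp del] = One_nat_def
  have wdg: "form (wdg a b c d) T = T a b c d - T b a c d - T a b d c + T b a d c"
    if "a < 4" "b < 4" "c < 4" "d < 4" for a b c d T
  proof -
    have low: "i < N" "\<not> p i" if "i < 4" for i using that four_le_N p_low by auto
    have e: "wdg a b c d = tadd (tadd (etens a b c d) (tscale (-1) (etens b a c d))) (tadd (tscale (-1) (etens a b d c)) (etens b a d c))"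
      using that low by (intro ext) (simp add: wdg_component tadd_def tscale_def)
    from low show ?thesis using that unfolding e by (simp add: form_tadd form_tscale form_etens)
  qed
  show "form (hw 0) (hw 0) \<noteq> 0" unfolding hw_simps by (simp add: wdg) (simp add: wdg_component etens_def)
  show "form (hw 1) (hw 1) \<noteq> 0"
    unfolding hw_simps by (simp add: form_tadd form_tscale wdg) (simp add: tadd_def tscale_def wdg_component etens_def)
  show "form (hw 3) (hw 3) \<noteq> 0"
    unfolding hw_simps by (simp add: form_tadd form_tscale wdg) (simp add: tadd_def tscale_def wdg_component etens_def)
  have e2: "form2 (emat a b) k = k a b" if "a < 4" "b < 4" for a b k
  proof -
    have ab: "a < N" "b < N" "\<not> p a" "\<not> p b" using that four_le_N p_low by auto
    have "form2 (emat a b) k = (\<Sum>i<N. \<Sum>j<N. om i * om j * k i j * (if j = b then (if i = a then 1 else 0) else 0))"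
      unfolding form2_def by (intro sum.cong refl) (auto simp: emat_def)
    also have "\<dots> = (\<Sum>i<N. om i * om b * k i b * (if i = a then 1 else 0))" by (simp only: sum_delta_mult[OF ab(2)])
    also have "\<dots> = k a b" using ab by (simp only: sum_delta_mult[OF ab(1)]) (simp add: om_def)
    finally show ?thesis .
  qed
  \<comment> \<open>The letters 0, ..., 3 span an isotropic space, so the trace term of
    \<open>tr_psi\<close> vanishes and the factor M - 2 remains.\<close>
  have t: "(\<Sum>b<N. eta b * emat i j b (st b)) = 0" if "i < 4" "j < 4" for i j
  proof (rule sum.neutral, intro ballI)
    fix b show "eta b * emat i j b (st b) = 0"
      using st_low[OF that(1)] that by (auto simp: emat_def)
  qed
  show "form (hw 2) (hw 2) \<noteq> 0"
    using hw_in_W[of 2] sdim_neq unfolding hw_simps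
    by (simp add: form_psi e2 tr_psi t) (simp add: sdim_def emat_def)
  have "form (hw 4) (hw 4) = 4 * (form2 (emat 0 1) (tr (hw 4)) - form2 (emat 1 0) (tr (hw 4)))"
  proof -
    have "form2 (\<lambda>i j. emat 0 1 i j + (-1) * emat 1 0 i j) k = form2 (emat 0 1) k - form2 (emat 1 0) k" for k
      by (simp add: form2_def algebra_simps sum.distrib sum_subtractf)
    then show ?thesis using hw_in_W[of 4] form_psi[of "hw 4"] by (simp add: hw_simps)
  qed
  also have "\<dots> = 8 * (sdim - 2)"
  proof -
    have "(\<Sum>b<N. eta b * (emat 0 1 b (st b) + (-1) * emat 1 0 b (st b))) = 0"
      using t[of 0 1] t[of 1 0] by (simp add: right_diff_distrib sum_subtractf)
    then show ?thesis unfolding hw_simps by (simp add: e2 tr_psi) (simp add: sdim_def emat_def)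
  qed
  finally show "form (hw 4) (hw 4) \<noteq> 0" using sdim_neq by simp
  \<comment> \<open>For the invariant the trace term contributes a further M, so that M - 2 becomes
    2 M - 2.\<close>
  have trK: "(\<Sum>b<N. eta b * Kt b (st b)) = sdim"
    unfolding sdim_def by (intro sum.cong) (auto simp: Kt_def eta_eta_st)
  have "form (hw 5) (hw 5) = 4 * form2 Kt (tr (psi Kt))"
    using hw_in_W[of 5] by (simp add: hw_simps form_psi)
  also have "form2 Kt (tr (psi Kt)) = (2 * sdim - 2) * form2 Kt Kt"
  proof -
    have "tr (psi Kt) a d = (2 * sdim - 2) * Kt a d" if "a < N" "d < N" for a d
      using tr_psi[OF that, of Kt] trK by (simp add: sdim_def[symmetric] algebra_simps)
    then show ?thesis unfolding form2_def sum_distrib_left by (intro sum.cong refl) simp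
  qed
  also have "form2 Kt Kt = sdim"
  proof -
    have "(\<Sum>d<N. om a * om d * Kt a d * Kt a d) = ksign (p a) (p a)" if "a < N" for a
    proof -
      have "(\<Sum>d<N. om a * om d * Kt a d * Kt a d) = (om a * om a) * (eta (st a) * eta (st a)) "
        using that Kt_sum2[OF that, of "\<lambda>d. om a * om d * Kt a d"] by (simp add: Kt_def mult_ac)
      then show ?thesis by (simp add: om_square)
    qed
    then show ?thesis unfolding form2_def sdim_def by simp
  qed
  finally show "form (hw 5) (hw 5) \<noteq> 0" using sdim_neq by simp
qed

text \<open>The diagonal element h0 takes different values on the six highest weights.\<close>

definition h0 :: "nat \<Rightarrow> complex" where
  "h0 i = (if i = 0 then 8 else if i = 1 then 4 else if i = 2 then 2 else if i = 3 then 1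
       else if st i = 0 then -8 else if st i = 1 then -4 else if st i = 2 then -2 else if st i = 3 then -1 else 0)"

lemma h0_st: "h0 (st c) = - h0 c"
proof (cases "c < 4 \<or> st c < 4")
  case True
  have "h0 (st i) = - h0 i" if "i < 4" for i
  proof -
    have "i = 0 \<or> i = 1 \<or> i = 2 \<or> i = 3" using that by auto
    then show ?thesis by (elim disjE) (simp_all add: h0_def)
  qed
  from this[of c] this[of "st c"] True show ?thesis by auto
next
  case False
  then have "c \<noteq> i \<and> st c \<noteq> i" if "i < 4" for i using that by auto
  then show ?thesis by (simp add: h0_def)
qed

text \<open>A diagonal element is its own \<open>dag\<close>, so its eigenvalues on two
  non-orthogonal weight vectors agree.\<close>

lemma hw_orth:
  assumes "r < 6" "s < 6" "r \<noteq> s"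
  shows "form (hw r) (hw s) = 0"
proof -
  define H0 where "H0 = dmat h0"
  have "dag H0 i j = H0 i j" for i j by (cases "i = j") (simp_all add: dag_def H0_def dmat_def)
  then have H0: "osp_h False H0" "diagonal H0" "dag H0 = H0"
    unfolding H0_def by (auto simp: osp_h_dmat h0_st diagonal_dmat)
  have "wts r H0 * form (hw r) (hw s) = form (Act False H0 (hw r)) (hw s)"
    using hw_weight[OF assms(1)] H0 by (simp add: weightv_def form_tscale)
  also have "\<dots> = form (hw r) (Act False H0 (hw s))" by (simp add: form_Act H0)
  also have "\<dots> = wts s H0 * form (hw r) (hw s)"
    using hw_weight[OF assms(2)] H0 by (simp add: weightv_def form_tscale)
  finally have "(wts r H0 - wts s H0) * form (hw r) (hw s) = 0" by (simp add: algebra_simps)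
  moreover have "wts 0 H0 = 24" "wts 1 H0 = 22" "wts 2 H0 = 16" "wts 3 H0 = 15" "wts 4 H0 = 12" "wts 5 H0 = 0"
    unfolding wts_simps by (simp_all add: H0_def dmat_def h0_def)
  then have "wts r H0 \<noteq> wts s H0"
    using less6_cases[OF assms(1)] less6_cases[OF assms(2)] assms(3) by (elim disjE) simp_all
  ultimately show ?thesis by simp
qed

lemma hwv_span:
  assumes T: "T \<in> W" "hwv ht T"
  shows "\<exists>c. T = tsum (\<lambda>r. tscale (c r) (hw r)) {0..<6}"
proof -
  \<comment> \<open>As the weights differ, each of the six vectors is nonzero at just one of these
    coordinates. Its value there is 1, except -1 for \<open>hw 2\<close> and 2 for
    \<open>hw 5\<close>; hence the sign and the half.\<close>
  define c where "c r = [T 0 1 0 1, T 0 1 0 2, - T 0 1 0 (st 1), T 0 1 2 3, T 0 (st 0) 0 1, T 0 (st 0) 0 (st 0) / 2] ! r" for r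
  have c: "c 0 = T 0 1 0 1" "c 1 = T 0 1 0 2" "c 2 = - T 0 1 0 (st 1)" "c 3 = T 0 1 2 3" "c 4 = T 0 (st 0) 0 1"
    "c 5 = T 0 (st 0) 0 (st 0) / 2"
    by (simp_all add: c_def)
  note [simp del] = One_nat_def
  define S where "S = tadd (tadd (tadd (tscale (c 0) (hw 0)) (tscale (c 1) (hw 1))) (tadd (tscale (c 2) (hw 2)) (tscale (c 3) (hw 3))))
    (tadd (tscale (c 4) (hw 4)) (tscale (c 5) (hw 5)))"
  define R where "R = tadd T (tscale (-1) S)"
  have "S \<in> W" unfolding S_def by (intro W_add W_scale hw_in_W) simp_all
  then have RW: "R \<in> W" unfolding R_def using T by (intro W_add W_scale)
  have "hwv ht S" unfolding S_def by (intro hwv_add hwv_scale hw_hwv) simp_all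
  then have Rh: "hwv ht R" unfolding R_def using T by (intro hwv_add hwv_scale)
  note ev = R_def S_def tadd_def tscale_def hw_simps wdg_component etens_def psi_component emat_def Kt_def c
  have "R = tzero"
    by (rule hwv_zero[OF RW Rh]) (simp_all add: ev)
  then have "T = S" unfolding R_def by (auto simp: fun_eq_iff tadd_def tscale_def tzero_def)
  moreover have "{0..<6} = {0, 1, 2, 3, 4, 5::nat}" by auto
  then have "S = tsum (\<lambda>r. tscale (c r) (hw r)) {0..<6}"
    unfolding S_def tsum_def by (intro ext) (simp add: tadd_def add.assoc)
  ultimately show ?thesis by blast
qed

end

context super_index
begin

section \<open>The decomposition\<close>

lemma tsum_insert: "finite I \<Longrightarrow> r \<notin> I \<Longrightarrow> tsum u (insert r I) = tadd (u r) (tsum u I)"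
  by (intro ext) (simp add: tsum_def tadd_def)

lemma form_tsum: "finite I \<Longrightarrow> form S (tsum u I) = (\<Sum>r\<in>I. form S (u r))"
proof (induction I rule: finite_induct)
  case empty
  then show ?case by (simp add: tsum_def form_def)
next
  case (insert r I)
  then show ?case by (simp add: tsum_insert form_tadd)
qed

lemma tsum_subspace:
  assumes "is_subspace U" "finite I" "\<And>r. r \<in> I \<Longrightarrow> u r \<in> U"
  shows "tsum u I \<in> U"
  using assms(2,3)
proof (induction I rule: finite_induct)
  case empty
  then show ?case using assms(1) by (simp add: tsum_def is_subspace_def tzero_def)
next
  case (insert r I)
  then show ?case using assms(1) by (simp add: tsum_insert is_subspace_def)
qed

lemma Act_tsum: "finite I \<Longrightarrow> Act z X (tsum u I) = tsum (\<lambda>r. Act z X (u r)) I"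
proof (induction I rule: finite_induct)
  case empty
  then show ?case using Act_zero[of z X] by (simp add: tsum_def tzero_def)
next
  case (insert r I)
  then show ?case by (simp add: tsum_insert Act_add)
qed

lemma perp_Wsub:
  assumes "Wsub U"
  shows "Wsub {S \<in> W. \<forall>T\<in>U. form S T = 0}"
  unfolding Wsub_def
proof (intro conjI allI impI)
  show "is_subspace {S \<in> W. \<forall>T\<in>U. form S T = 0}"
    using W_subspace by (auto simp: is_subspace_def form_tzero form_tadd form_tscale)
next
  fix z X S assume X: "osp_h z X" and "S \<in> {S \<in> W. \<forall>T\<in>U. form S T = 0}"
  then have S: "S \<in> W" "\<forall>T\<in>U. form S T = 0" by auto
  then show "Act z X S \<in> {S \<in> W. \<forall>T\<in>U. form S T = 0}"
    using W_Act[OF X S(1)] assms osp_h_dag[OF X] by (auto simp: Wsub_def form_Act)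
qed auto

lemma Kt_sym: "Kt c b = ksign (p b) (p c) * Kt b c"
proof (cases "b = st c \<and> c < N")
  case True
  then show ?thesis by (auto simp: Kt_def eta_st ksign_def)
next
  case False
  then have "\<not> (c = st b \<and> b < N)" by auto
  with False show ?thesis unfolding Kt_def by (simp only: if_False mult_zero_right)
qed

text \<open>Super-transposing \<open>h\<close> exchanges the outer legs of the two pairs, and
  \<open>Kt\<close> is super-symmetric. So the flip sign of \<open>psi h\<close> is the symmetry
  type of \<open>h\<close>.\<close>

lemma bsw_psi: "bsw (psi h) = psi (\<lambda>i j. ksign (p i) (p j) * h j i)"
proof (intro ext)
  fix a b c d
  have k: "p x \<noteq> p y \<Longrightarrow> Kt x y = 0" for x y using Kt_nonzero[of x y] by auto
  have s: "Kt d a = ksign (p a) (p d) * Kt a d" "Kt c a = ksign (p a) (p c) * Kt a c"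
    "Kt d b = ksign (p b) (p d) * Kt b d" "Kt c b = ksign (p b) (p c) * Kt b c" by (rule Kt_sym)+
  show "bsw (psi h) a b c d = psi (\<lambda>i j. ksign (p i) (p j) * h j i) a b c d"
    unfolding bsw_def psi_component s
    by (cases "p a"; cases "p b"; cases "p c"; cases "p d") (simp_all add: k)
qed

lemma bsw_wdg:
  assumes "\<not> p a" "\<not> p b" "\<not> p c" "\<not> p d"
  shows "bsw (wdg a b c d) = wdg c d a b"
proof (intro ext)
  fix i j k l
  have e: "ksign (p i \<noteq> p j) (p k \<noteq> p l) * etens x y z w k l i j = etens z w x y i j k l"
    if "\<not> p x" "\<not> p y" for x y z w
    using that by (auto simp: etens_def)
  have "bsw (wdg a b c d) i j k l = ksign (p i \<noteq> p j) (p k \<noteq> p l) * etens a b c d k l i j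
      - ksign (p i \<noteq> p j) (p k \<noteq> p l) * etens b a c d k l i j
      - ksign (p i \<noteq> p j) (p k \<noteq> p l) * etens a b d c k l i j
      + ksign (p i \<noteq> p j) (p k \<noteq> p l) * etens b a d c k l i j"
    unfolding bsw_def wdg_component using assms by (simp only: ksign_simps) (simp add: algebra_simps)
  then show "bsw (wdg a b c d) i j k l = wdg c d a b i j k l"
    unfolding e[OF assms(1,2)] e[OF assms(2,1)] using assms by (simp add: wdg_component)
qed

lemma bsw_add: "bsw (tadd S T) = tadd (bsw S) (bsw T)"
  and bsw_scale: "bsw (tscale k T) = tscale k (bsw T)"
  by (intro ext; simp add: bsw_def tadd_def tscale_def algebra_simps)+

definition bsw_eigen :: "complex \<Rightarrow> tens set" where
  "bsw_eigen k = {T \<in> W. bsw T = tscale k T}"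

lemma bsw_eigen_Wsub: "Wsub (bsw_eigen k)"
  unfolding Wsub_def
proof (intro conjI allI impI)
  have "bsw tzero = tzero" by (intro ext) (simp add: bsw_def tzero_def)
  moreover have "tscale k (tadd S T) = tadd (tscale k S) (tscale k T)" "tscale k tzero = tzero"
    "tscale k (tscale c T) = tscale c (tscale k T)" for S T c
    by (intro ext; simp add: tscale_def tadd_def tzero_def algebra_simps)+
  ultimately show "is_subspace (bsw_eigen k)"
    using W_subspace by (auto simp: is_subspace_def bsw_eigen_def bsw_add bsw_scale)
next
  fix z X T assume "osp_h z X" "T \<in> bsw_eigen k"
  then show "Act z X T \<in> bsw_eigen k"
    by (simp add: bsw_eigen_def W_Act Act_bsw[symmetric] osp_h_homog Act_scale)
qed (auto simp: bsw_eigen_def)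

end

context osp_generic
begin

definition summand :: "nat \<Rightarrow> tens set" where
  "summand r = gen ht (hw r)"

lemma summand_Wsub: "r < 6 \<Longrightarrow> Wsub (summand r)"
  unfolding summand_def by (rule gen_Wsub[OF ht_st ht_inj hw_hwv hw_weight hw_in_W])

lemma hw_in_summand: "hw r \<in> summand r"
  by (simp add: summand_def gen.base)

lemma summand_zero: "r < 6 \<Longrightarrow> tzero \<in> summand r"
  using summand_Wsub by (simp add: Wsub_def is_subspace_def)

lemma hw_nonzero: "r < 6 \<Longrightarrow> hw r \<noteq> tzero"
  using hw_norm[of r] by (auto simp: form_tzero)

lemma form_v_tsum:
  assumes "s < 6"
  shows "form (hw s) (tsum (\<lambda>r. tscale (c r) (hw r)) {0..<6}) = c s * form (hw s) (hw s)"
proof -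
  have "form (hw s) (tsum (\<lambda>r. tscale (c r) (hw r)) {0..<6}) = (\<Sum>r\<in>{0..<6}. c r * form (hw s) (hw r))"
    by (simp only: form_tsum finite_atLeastLessThan form_tscale)
  also have "\<dots> = (\<Sum>r\<in>{0..<6}. if r = s then c s * form (hw s) (hw s) else 0)"
    using hw_orth[OF assms] by (intro sum.cong) auto
  finally show ?thesis using assms by simp
qed

text \<open>Pairing with \<open>hw s\<close> extracts a nonzero multiple of the coefficient of
  \<open>hw s\<close>. Irreducibility, nondegeneracy and spanning all reduce to this.\<close>

lemma hwv_orth_zero:
  assumes "T \<in> W" "hwv ht T" "\<And>s. s < 6 \<Longrightarrow> form (hw s) T = 0"
  shows "T = tzero"
proof -
  obtain c where c: "T = tsum (\<lambda>r. tscale (c r) (hw r)) {0..<6}" using hwv_span[OF assms(1,2)] by blast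
  have "c s = 0" if "s < 6" for s
    using form_v_tsum[OF that, of c] assms(3)[OF that] hw_norm[OF that] c by simp
  then show ?thesis unfolding c by (intro ext) (simp add: tsum_def tscale_def tzero_def)
qed

lemma summand_irreducible:
  assumes r: "r < 6" and U: "Wsub U" "U \<subseteq> summand r" "U \<noteq> {tzero}"
  shows "U = summand r"
proof -
  obtain T where T: "T \<in> U" "T \<noteq> tzero" "hwv ht T" using exists_hwv[OF U(1,3)] by blast
  have TW: "T \<in> W" using T(1) U(1) by (auto simp: Wsub_def)
  have orth: "form (hw s) T = 0" if "s < 6" "s \<noteq> r" for s
    using gen_orth[OF hw_hwv[OF that(1)] hw_orth[OF that(1) r that(2)]] T(1) U(2) by (auto simp: summand_def)
  \<comment> \<open>\<open>k\<close> is the coefficient of the orthogonal projection of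
    \<open>T\<close> onto \<open>hw r\<close>; the difference \<open>S\<close> is again singular and
    now orthogonal to all six vectors.\<close>
  define k where "k = form (hw r) T / form (hw r) (hw r)"
  define S where "S = tadd T (tscale (- k) (hw r))"
  have "form (hw s) S = 0" if "s < 6" for s
    using orth[OF that] hw_orth[OF that r] hw_norm[OF r]
    by (cases "s = r") (simp_all add: S_def form_tadd form_tscale k_def)
  moreover have "S \<in> W" unfolding S_def using TW r by (intro W_add W_scale hw_in_W)
  moreover have "hwv ht S" unfolding S_def using T(3) r by (intro hwv_add hwv_scale hw_hwv)
  ultimately have "S = tzero" using hwv_orth_zero by blast
  then have Tk: "T = tscale k (hw r)" by (auto simp: S_def fun_eq_iff tadd_def tscale_def tzero_def)
  with T(2) have "k \<noteq> 0" by (auto simp: tscale_def tzero_def)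
  then have "hw r = tscale (1 / k) T" unfolding Tk by (simp add: tscale_def)
  then have "hw r \<in> U" using U(1) T(1) by (simp add: Wsub_def is_subspace_def)
  then show ?thesis using gen_subset[OF U(1)] U(2) by (auto simp: summand_def)
qed

lemma summand_orthogonal:
  assumes "r < 6" "s < 6" "r \<noteq> s" "S \<in> summand r" "T \<in> summand s"
  shows "form S T = 0"
  by (rule gen_orthogonal[OF ht_st ht_inj hw_hwv[OF assms(1)] hw_orth[OF assms(1-3)] hw_hwv[OF assms(2)] hw_weight[OF assms(2)]])
    (use assms(4,5) in \<open>simp_all add: summand_def\<close>)

text \<open>The radical is a submodule, and a singular vector inside it would be orthogonal to all
  six vectors.\<close>

lemma form_nondegenerate:
  assumes "S \<in> W" "\<And>T. T \<in> W \<Longrightarrow> form S T = 0"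
  shows "S = tzero"
proof (rule ccontr)
  assume "S \<noteq> tzero"
  then have "{S \<in> W. \<forall>T\<in>W. form S T = 0} \<noteq> {tzero}" using assms by blast
  from exists_hwv[OF perp_Wsub[OF Wsub_W] this, of ht]
  obtain T where "T \<in> W" "\<forall>R\<in>W. form T R = 0" "T \<noteq> tzero" "hwv ht T" by blast
  then show False using hwv_orth_zero[of T] hw_in_W by (auto simp: form_commute[of "hw _"])
qed

lemma summand_span: "W = {tsum u {0..<6} | u. \<forall>r\<in>{0..<6}. u r \<in> summand r}" (is "W = ?U")
proof
  have sub: "is_subspace ?U"
    unfolding is_subspace_def
  proof (intro conjI ballI allI)
    have "tzero = tsum (\<lambda>r. tzero) {0..<6}" by (simp add: tsum_def tzero_def)
    then show "tzero \<in> ?U" using summand_zero by (auto intro!: exI[of _ "\<lambda>r. tzero"])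
  next
    fix S T assume "S \<in> ?U" "T \<in> ?U"
    then obtain u w where uw: "S = tsum u {0..<6}" "T = tsum w {0..<6}" "\<forall>r\<in>{0..<6}. u r \<in> summand r" "\<forall>r\<in>{0..<6}. w r \<in> summand r"
      by blast
    have "tadd S T = tsum (\<lambda>r. tadd (u r) (w r)) {0..<6}" by (simp add: uw tadd_def tsum_def sum.distrib)
    moreover have "\<forall>r\<in>{0..<6}. tadd (u r) (w r) \<in> summand r" using uw summand_Wsub by (simp add: Wsub_def is_subspace_def)
    ultimately show "tadd S T \<in> ?U" by blast
  next
    fix k T assume "T \<in> ?U"
    then obtain w where w: "T = tsum w {0..<6}" "\<forall>r\<in>{0..<6}. w r \<in> summand r" by blast
    have "tscale k T = tsum (\<lambda>r. tscale k (w r)) {0..<6}" by (simp add: w tscale_def tsum_def sum_distrib_left)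
    moreover have "\<forall>r\<in>{0..<6}. tscale k (w r) \<in> summand r" using w summand_Wsub by (simp add: Wsub_def is_subspace_def)
    ultimately show "tscale k T \<in> ?U" by blast
  qed
  show UW: "?U \<subseteq> W"
  proof
    fix T assume "T \<in> ?U"
    then obtain w where w: "T = tsum w {0..<6}" "\<forall>r\<in>{0..<6}. w r \<in> summand r" by blast
    have "w r \<in> W" if "r \<in> {0..<6}" for r
    proof -
      have "summand r \<subseteq> W" using summand_Wsub[of r] that by (simp add: Wsub_def)
      then show ?thesis using w(2) that by blast
    qed
    then show "T \<in> W" unfolding w(1) by (intro tsum_subspace[OF W_subspace]) simp_all
  qed
  have U: "Wsub ?U"
    unfolding Wsub_def
  proof (intro conjI allI impI)
    fix z X T assume X: "osp_h z X" and "T \<in> ?U"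
    then obtain w where w: "T = tsum w {0..<6}" "\<forall>r\<in>{0..<6}. w r \<in> summand r" by blast
    have "Act z X T = tsum (\<lambda>r. Act z X (w r)) {0..<6}" by (simp add: w Act_tsum)
    moreover have "\<forall>r\<in>{0..<6}. Act z X (w r) \<in> summand r" using w X summand_Wsub by (simp add: Wsub_def)
    ultimately show "Act z X T \<in> ?U" by blast
  qed (use sub UW in auto)
  have vU: "hw s \<in> ?U" if "s < 6" for s
  proof -
    have "hw s = tsum (\<lambda>r. if r = s then hw s else tzero) {0..<6}"
    proof (intro ext)
      fix i j k l
      have "(\<Sum>r\<in>{0..<6}. (if r = s then hw s else tzero) i j k l) = (\<Sum>r\<in>{0..<6}. if r = s then hw s i j k l else 0)"
        by (rule sum.cong) (auto simp: tzero_def)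
      then show "hw s i j k l = tsum (\<lambda>r. if r = s then hw s else tzero) {0..<6} i j k l"
        using that by (simp add: tsum_def)
    qed
    moreover have "\<forall>r\<in>{0..<6}. (if r = s then hw s else tzero) \<in> summand r" using hw_in_summand summand_zero by auto
    ultimately show ?thesis by blast
  qed
  show "W \<subseteq> ?U"
  proof (rule ccontr)
    assume "\<not> W \<subseteq> ?U"
    then obtain T where T: "T \<in> W" "T \<notin> ?U" by blast
    obtain S where "S \<in> W" "S \<noteq> tzero" "\<forall>u\<in>?U. form S u = 0" using perp_nonzero[OF sub UW T] by blast
    then have "{S \<in> W. \<forall>T\<in>?U. form S T = 0} \<noteq> {tzero}" by blast
    from exists_hwv[OF perp_Wsub[OF U] this, of ht]
    obtain R where R: "R \<in> W" "\<forall>T\<in>?U. form R T = 0" "R \<noteq> tzero" "hwv ht R" by blast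
    have "form (hw s) R = 0" if "s < 6" for s
      using bspec[OF R(2) vU[OF that]] by (simp add: form_commute[of "hw s"])
    then show False using hwv_orth_zero[OF R(1,4)] R(3) by blast
  qed
qed

text \<open>Pairing the vanishing sum with summand r shows that \<open>u r\<close> is orthogonal to
  its own summand. It is orthogonal to the others anyway, hence lies in the radical.\<close>

lemma summand_independent:
  assumes u: "\<And>r. r < 6 \<Longrightarrow> u r \<in> summand r" and z: "tsum u {0..<6} = tzero" and r: "r < 6"
  shows "u r = tzero"
proof (rule form_nondegenerate)
  show "u r \<in> W" using u[OF r] summand_Wsub[OF r] by (auto simp: Wsub_def)
  have self: "form (u r) T = 0" if "T \<in> summand r" for T
  proof -
    have "form T (tsum u {0..<6}) = (\<Sum>s\<in>{0..<6}. form T (u s))" by (simp only: form_tsum finite_atLeastLessThan)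
    also have "\<dots> = (\<Sum>s\<in>{0..<6}. if s = r then form T (u r) else 0)"
      using summand_orthogonal[OF r _ _ that u] by (intro sum.cong) auto
    finally show ?thesis using r by (simp add: z form_tzero form_commute)
  qed
  fix T assume "T \<in> W"
  then obtain w where w: "T = tsum w {0..<6}" "\<forall>s\<in>{0..<6}. w s \<in> summand s" using summand_span by blast
  have "form (u r) (w s) = 0" if "s < 6" for s
    using self summand_orthogonal[OF r that _ u[OF r], of "w s"] w(2) that by (cases "s = r") auto
  then show "form (u r) T = 0" by (simp add: w(1) form_tsum)
qed

lemma tsum_extend:
  assumes "I \<subseteq> {0..<6}"
  shows "tsum u I = tsum (\<lambda>r. if r \<in> I then u r else tzero) {0..<6}"
proof (intro ext)
  fix i j k l
  have "(\<Sum>r\<in>{0..<6}. (if r \<in> I then u r else tzero) i j k l) = (\<Sum>r\<in>I. (if r \<in> I then u r else tzero) i j k l)"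
    using assms by (intro sum.mono_neutral_right) (auto simp: tzero_def)
  then show "tsum u I i j k l = tsum (\<lambda>r. if r \<in> I then u r else tzero) {0..<6} i j k l"
    by (simp add: tsum_def)
qed

lemma summand_independent_on:
  assumes "I \<subseteq> {0..<6}" "\<forall>r\<in>I. u r \<in> summand r" "tsum u I = tzero" "r \<in> I"
  shows "u r = tzero"
  using summand_independent[of "\<lambda>r. if r \<in> I then u r else tzero" r] assms tsum_extend[OF assms(1), of u] summand_zero
  by auto

lemma W_direct_sum: "is_direct_sum W summand {0..<6}"
  unfolding is_direct_sum_def using summand_span summand_independent_on[OF subset_refl] by blast

definition sgn_of :: "nat \<Rightarrow> complex" where
  "sgn_of r = (if r = 1 \<or> r = 4 then -1 else 1)"

text \<open>The flip commutes with the action, so its sign on a generator is its sign on the whole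
  summand.\<close>

lemma summand_bsw: "r < 6 \<Longrightarrow> summand r \<subseteq> bsw_eigen (sgn_of r)"
proof -
  assume r: "r < 6"
  have "bsw (hw r) = tscale (sgn_of r) (hw r)"
  proof (rule less6_induct[where P = "\<lambda>r. bsw (hw r) = tscale (sgn_of r) (hw r)"])
    note [simp del] = One_nat_def
    show "bsw (hw 0) = tscale (sgn_of 0) (hw 0)" "bsw (hw 1) = tscale (sgn_of 1) (hw 1)" "bsw (hw 3) = tscale (sgn_of 3) (hw 3)"
      unfolding hw_simps bsw_add bsw_scale
      by (simp_all add: bsw_wdg sgn_of_def) (intro ext; simp add: tadd_def tscale_def algebra_simps)+
    have "(\<lambda>i j. ksign (p i) (p j) * emat 0 0 j i) = (\<lambda>i j. 1 * emat 0 0 i j)"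
      by (intro ext) (auto simp: emat_def)
    then show "bsw (hw 2) = tscale (sgn_of 2) (hw 2)"
      unfolding hw_simps bsw_psi psi_scale[symmetric] by (simp add: sgn_of_def)
    have "(\<lambda>i j. ksign (p i) (p j) * (emat 0 1 j i + (-1) * emat 1 0 j i)) = (\<lambda>i j. (-1) * (emat 0 1 i j + (-1) * emat 1 0 i j))"
      by (intro ext) (auto simp: emat_def)
    then show "bsw (hw 4) = tscale (sgn_of 4) (hw 4)"
      unfolding hw_simps bsw_psi psi_scale[symmetric] by (simp add: sgn_of_def)
    have "ksign (p i) (p j) * Kt j i = 1 * Kt i j" for i j
      unfolding Kt_sym[of j i] by simp
    then have "(\<lambda>i j. ksign (p i) (p j) * Kt j i) = (\<lambda>i j. 1 * Kt i j)" by (intro ext)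
    then show "bsw (hw 5) = tscale (sgn_of 5) (hw 5)"
      unfolding hw_simps bsw_psi psi_scale[symmetric] by (simp add: sgn_of_def)
  qed (rule r)
  then have "hw r \<in> bsw_eigen (sgn_of r)" using hw_in_W[OF r] by (simp add: bsw_eigen_def)
  then show ?thesis unfolding summand_def by (rule gen_subset[OF bsw_eigen_Wsub])
qed

lemma eigen_direct_sum:
  assumes k: "k = 1 \<or> k = -1"
  shows "is_direct_sum (bsw_eigen k) summand {r. r < 6 \<and> sgn_of r = k}"
proof -
  define I where "I = {r. r < 6 \<and> sgn_of r = k}"
  have I: "I \<subseteq> {0..<6}" by (auto simp: I_def)
  have "bsw_eigen k = {tsum u I | u. \<forall>r\<in>I. u r \<in> summand r}"
  proof
    show "{tsum u I | u. \<forall>r\<in>I. u r \<in> summand r} \<subseteq> bsw_eigen k"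
    proof
      fix T assume "T \<in> {tsum u I | u. \<forall>r\<in>I. u r \<in> summand r}"
      then obtain u where u: "T = tsum u I" "\<forall>r\<in>I. u r \<in> summand r" by blast
      have "u r \<in> bsw_eigen k" if "r \<in> I" for r using summand_bsw[of r] u(2) that by (auto simp: I_def)
      then show "T \<in> bsw_eigen k"
        unfolding u(1) using bsw_eigen_Wsub[of k] finite_subset[OF I] by (intro tsum_subspace) (auto simp: Wsub_def)
    qed
    show "bsw_eigen k \<subseteq> {tsum u I | u. \<forall>r\<in>I. u r \<in> summand r}"
    proof
      fix T assume T: "T \<in> bsw_eigen k"
      then have "T \<in> W" by (simp add: bsw_eigen_def)
      then obtain u where u: "T = tsum u {0..<6}" "\<forall>r\<in>{0..<6}. u r \<in> summand r" using summand_span by blast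
      have ub: "bsw (u r) = tscale (sgn_of r) (u r)" if "r < 6" for r
        using summand_bsw[OF that] u(2) that by (auto simp: bsw_eigen_def)
      \<comment> \<open>These are the components of \<open>bsw T\<close> minus k times
        \<open>T\<close>, which is zero; so a component whose sign is not k must vanish.\<close>
      define w where "w r = tscale (sgn_of r - k) (u r)" for r
      have "tsum w {0..<6} = tzero"
      proof (intro ext)
        fix a b c d
        have "bsw T a b c d = (\<Sum>r\<in>{0..<6}. sgn_of r * u r a b c d)"
        proof -
          have "bsw T a b c d = (\<Sum>r\<in>{0..<6}. bsw (u r) a b c d)"
            unfolding u(1) by (simp add: bsw_def tsum_def sum_distrib_left)
          also have "\<dots> = (\<Sum>r\<in>{0..<6}. sgn_of r * u r a b c d)"
            using ub by (intro sum.cong) (auto simp: tscale_def)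
          finally show ?thesis .
        qed
        moreover have "bsw T a b c d = k * (\<Sum>r\<in>{0..<6}. u r a b c d)"
          using T by (simp add: bsw_eigen_def tscale_def u(1) tsum_def)
        ultimately show "tsum w {0..<6} a b c d = tzero a b c d"
          by (simp add: tsum_def w_def tscale_def tzero_def left_diff_distrib sum_subtractf sum_distrib_left)
      qed
      moreover have "w r \<in> summand r" if "r < 6" for r
        using u(2) summand_Wsub[OF that] that by (simp add: w_def Wsub_def is_subspace_def)
      ultimately have "w r = tzero" if "r < 6" for r using summand_independent that by blast
      then have uz: "u r = tzero" if "r < 6" "r \<notin> I" for r
      proof -
        have "sgn_of r - k \<noteq> 0" using that by (simp add: I_def)
        moreover have "tscale (sgn_of r - k) (u r) = tzero"
          using \<open>\<And>r. r < 6 \<Longrightarrow> w r = tzero\<close>[OF that(1)] by (simp add: w_def)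
        ultimately show ?thesis unfolding tscale_def tzero_def fun_eq_iff by simp
      qed
      then have "T = tsum u I"
      proof -
        have "tsum u {0..<6} = tsum (\<lambda>r. if r \<in> I then u r else tzero) {0..<6}"
          unfolding tsum_def using uz by (intro ext sum.cong) auto
        then show ?thesis unfolding u(1) tsum_extend[OF I, of u] .
      qed
      then show "T \<in> {tsum u I | u. \<forall>r\<in>I. u r \<in> summand r}" using u(2) I by blast
    qed
  qed
  then show ?thesis
    unfolding is_direct_sum_def I_def[symmetric] using summand_independent_on[OF I] by blast
qed

end

section \<open>Highest weight vectors for the standard Borel subalgebra\<close>

lemma tadd_tzero: "tadd tzero T = T" "tadd T tzero = T" "tscale k tzero = tzero"
  by (intro ext; simp add: tadd_def tzero_def tscale_def)+

text \<open>\<open>f\<close> and \<open>g\<close> carry delta_1 and delta_2, the two highest letters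
  of the standard order, in this order.\<close>

locale osp_std = osp_generic +
  fixes g :: nat and ht2 :: "nat \<Rightarrow> int"
  assumes g_less: "g < N" and p_g: "p g" and g_neq_f: "g \<noteq> f" and st_f_neq_g: "st f \<noteq> g"
    and ht2_f: "j < N \<Longrightarrow> j \<noteq> f \<Longrightarrow> ht2 j < ht2 f"
    and ht2_g: "j < N \<Longrightarrow> j \<noteq> f \<Longrightarrow> j \<noteq> g \<Longrightarrow> ht2 j < ht2 g"
begin

text \<open>The duals of \<open>f\<close> and \<open>g\<close> are absent, so the second matrix
  entry of a root vector \<open>R x a\<close> never acts on tensors in these letters.\<close>

definition letters :: "nat set" where
  "letters = {0, 1, 2, 3, f, g}"

lemma odd_neq_low: "p x \<Longrightarrow> x \<noteq> 0 \<and> x \<noteq> 1 \<and> x \<noteq> 2 \<and> x \<noteq> 3"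
  using p_simps by metis

lemma fg_simps [simp]:
  "f \<noteq> 0" "f \<noteq> 1" "f \<noteq> 2" "f \<noteq> 3" "g \<noteq> 0" "g \<noteq> 1" "g \<noteq> 2" "g \<noteq> 3" "f \<noteq> Suc 0" "g \<noteq> Suc 0"
  "0 \<noteq> f" "1 \<noteq> f" "2 \<noteq> f" "3 \<noteq> f" "0 \<noteq> g" "1 \<noteq> g" "2 \<noteq> g" "3 \<noteq> g" "Suc 0 \<noteq> f" "Suc 0 \<noteq> g"
  "f \<noteq> g" "g \<noteq> f" "p f" "p g" "f < N" "g < N"
  using odd_neq_low[OF p_f] odd_neq_low[OF p_g] g_neq_f p_f p_g f_less g_less by auto

lemma st_odd_neq: "x < N \<Longrightarrow> p x \<Longrightarrow> st x \<noteq> x"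
  using eta_st[of x] eta_nonzero[of x] by auto

lemma st_letter: "x = f \<or> x = g \<Longrightarrow> st x \<notin> letters"
  using st_odd_neq[of f] st_odd_neq[of g] st_f_neq_g odd_neq_low[of "st x"] st_st[of f] st_st[of g]
  by (auto simp: letters_def)

lemma letters_simps [simp]: "0 \<in> letters" "1 \<in> letters" "Suc 0 \<in> letters" "2 \<in> letters" "3 \<in> letters" "f \<in> letters" "g \<in> letters"
  by (simp_all add: letters_def)

lemma letters_less: "x \<in> letters \<Longrightarrow> x < N"
  by (auto simp: letters_def)

text \<open>An odd root vector of weight delta_j - epsilon_(a+1); on tensors in the letters it
  substitutes e_x for e_a.\<close>

definition R :: "nat \<Rightarrow> nat \<Rightarrow> mat" where
  "R x a = Fm x (st a)"

lemma osp_h_R: "x = f \<or> x = g \<Longrightarrow> a < 4 \<Longrightarrow> osp_h True (R x a)"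
  using osp_h_Fm[of x "st a"] four_le_N p_low[of a] by (auto simp: R_def)

lemma colsum_R:
  assumes x: "x = f \<or> x = g" and a: "a < 4" and b: "b \<in> letters"
  shows "colsum (R x a) b G = (if b = a then G x else 0)"
proof -
  have ea: "eta (st a) = 1" using eta_st[of a] a four_le_N p_low eta_low by simp
  have "b \<noteq> st x" using st_letter[OF x] b by auto
  then have "colsum (R x a) b G = (\<Sum>y<N. (if b = a then G x else 0) * (if y = x then 1 else 0))"
    unfolding colsum_def by (intro sum.cong) (auto simp: R_def Fm_def ea)
  then show ?thesis using sum_delta_mult[of x "\<lambda>_. if b = a then G x else 0" 1] x by auto
qed

lemma Act_R_wdg:
  assumes x: "x = f \<or> x = g" and a: "a < 4" and bcde: "b \<in> letters" "c \<in> letters" "d \<in> letters" "e \<in> letters"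
  shows "Act True (R x a) (wdg b c d e) =
    tadd (tadd (if b = a then wdg x c d e else tzero) (tscale (ksign True (p b)) (if c = a then wdg b x d e else tzero)))
      (tadd (tscale (ksign True (p b) * ksign True (p c)) (if d = a then wdg b c x e else tzero))
        (tscale (ksign True (p b) * ksign True (p c) * ksign True (p d)) (if e = a then wdg b c d x else tzero)))"
  by (intro ext)
    (simp add: Act_wdg[OF osp_h_R[OF x a]] letters_less bcde colsum_R[OF x a] tadd_def tscale_def tzero_def)

lemma Act2_R_emat:
  assumes x: "x = f \<or> x = g" and a: "a < 4" and bc: "b \<in> letters" "c \<in> letters"
  shows "Act2 True (R x a) (emat b c) i j
    = (if b = a then emat x c i j else 0) + ksign True (p b) * (if c = a then emat b x i j else 0)"
  by (simp add: Act2_emat[OF osp_h_R[OF x a]] letters_less bc colsum_R[OF x a])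

text \<open>The coefficients are those produced by the odd operators of
  \<open>hw_std_in_summand\<close>; the 6, for instance, counts the six terms of
  \<open>hw 3\<close>, all of which become \<open>wdg f f f f\<close>.\<close>

definition hw_std :: "nat \<Rightarrow> tens" where
  "hw_std r = [tadd (tadd (wdg f f g g) (wdg g g f f)) (tscale (-2) (wdg f g f g)),
          tadd (tscale (-2) (wdg f f g f)) (tscale 2 (wdg g f f f)),
          psi (\<lambda>i j. emat g f i j + (-1) * emat f g i j),
          tscale 6 (wdg f f f f),
          psi (\<lambda>i j. (-2) * emat f f i j),
          psi Kt] ! r"

lemma hw_std_simps:
  "hw_std 0 = tadd (tadd (wdg f f g g) (wdg g g f f)) (tscale (-2) (wdg f g f g))"
  "hw_std 1 = tadd (tscale (-2) (wdg f f g f)) (tscale 2 (wdg g f f f))"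
  "hw_std 2 = psi (\<lambda>i j. emat g f i j + (-1) * emat f g i j)"
  "hw_std 3 = tscale 6 (wdg f f f f)"
  "hw_std 4 = psi (\<lambda>i j. (-2) * emat f f i j)"
  "hw_std 5 = psi Kt"
  by (simp_all add: hw_std_def eval_nat_numeral)

definition wts2 :: "nat \<Rightarrow> mat \<Rightarrow> complex" where
  "wts2 r H = [2 * H f f + 2 * H g g, 3 * H f f + H g g, H f f + H g g, 4 * H f f, 2 * H f f, 0] ! r"

lemma wts2_simps:
  "wts2 0 H = 2 * H f f + 2 * H g g" "wts2 1 H = 3 * H f f + H g g" "wts2 2 H = H f f + H g g"
  "wts2 3 H = 4 * H f f" "wts2 4 H = 2 * H f f" "wts2 5 H = 0"
  by (simp_all add: wts2_def eval_nat_numeral)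

lemma summand_R: "r < 6 \<Longrightarrow> x = f \<or> x = g \<Longrightarrow> a < 4 \<Longrightarrow> T \<in> summand r \<Longrightarrow> Act True (R x a) T \<in> summand r"
  using summand_Wsub osp_h_R unfolding Wsub_def by blast

lemma odd_flip:
  assumes "p a" "p b"
  shows "wdg b a c d = wdg a b c d" "wdg c d b a = wdg c d a b"
  using assms by (intro ext; simp add: wdg_component)+

lemma hw_std_in_summand: "r < 6 \<Longrightarrow> hw_std r \<in> summand r"
proof (rule less6_induct[where P = "\<lambda>r. hw_std r \<in> summand r"])
  note [simp del] = One_nat_def
  note ev = Act_add Act_scale Act_R_wdg tadd_tzero
  \<comment> \<open>In \<open>hw 0\<close> the letters 0 and 1 occur twice each. One occurrence is
    replaced by \<open>f\<close> and the other by \<open>g\<close>, in all ways, with Koszul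
    signs.\<close>
  have "Act True (R g 1) (Act True (R g 0) (Act True (R f 1) (Act True (R f 0) (hw 0)))) = hw_std 0"
    unfolding hw_simps hw_std_simps
    by (simp add: ev) (simp add: odd_flip[of f g] fun_eq_iff tadd_def tscale_def)
  moreover have "Act True (R g 1) (Act True (R g 0) (Act True (R f 1) (Act True (R f 0) (hw 0)))) \<in> summand 0"
    by (intro summand_R hw_in_summand) simp_all
  ultimately show "hw_std 0 \<in> summand 0" by simp
  have "Act True (R g 0) (Act True (R f 2) (Act True (R f 1) (Act True (R f 0) (hw 1)))) = hw_std 1"
    unfolding hw_simps hw_std_simps
    by (simp add: ev) (simp add: odd_flip[of f g] fun_eq_iff tadd_def tscale_def)
  moreover have "Act True (R g 0) (Act True (R f 2) (Act True (R f 1) (Act True (R f 0) (hw 1)))) \<in> summand 1"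
    by (intro summand_R hw_in_summand) simp_all
  ultimately show "hw_std 1 \<in> summand 1" by simp
  have "Act True (R f 3) (Act True (R f 2) (Act True (R f 1) (Act True (R f 0) (hw 3)))) = hw_std 3"
    unfolding hw_simps hw_std_simps
    by (simp add: ev) (simp add: fun_eq_iff tadd_def tscale_def)
  moreover have "Act True (R f 3) (Act True (R f 2) (Act True (R f 1) (Act True (R f 0) (hw 3)))) \<in> summand 3"
    by (intro summand_R hw_in_summand) simp_all
  ultimately show "hw_std 3 \<in> summand 3" by simp
  have "Act2 True (R f 0) (emat 0 0) = (\<lambda>i j. emat f 0 i j + emat 0 f i j)"
    by (intro ext) (simp add: Act2_R_emat)
  moreover have "Act2 True (R g 0) (\<lambda>i j. emat f 0 i j + emat 0 f i j) = (\<lambda>i j. emat g f i j + (-1) * emat f g i j)"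
    by (intro ext) (simp add: Act2_add Act2_R_emat)
  ultimately have "Act True (R g 0) (Act True (R f 0) (hw 2)) = hw_std 2"
    unfolding hw_simps hw_std_simps by (simp add: Act_psi osp_h_R)
  moreover have "Act True (R g 0) (Act True (R f 0) (hw 2)) \<in> summand 2"
    by (intro summand_R hw_in_summand) simp_all
  ultimately show "hw_std 2 \<in> summand 2" by simp
  have "Act2 True (R f 0) (\<lambda>i j. emat 0 1 i j + (-1) * emat 1 0 i j) = (\<lambda>i j. emat f 1 i j + (-1) * emat 1 f i j)"
    by (intro ext) (simp only: Act2_add Act2_scale, simp add: Act2_R_emat)
  moreover have "Act2 True (R f 1) (\<lambda>i j. emat f 1 i j + (-1) * emat 1 f i j) = (\<lambda>i j. (-2) * emat f f i j)"
    by (intro ext) (simp only: Act2_add Act2_scale, simp add: Act2_R_emat)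
  moreover have "osp_h True (R f 0)" "osp_h True (R f 1)" by (simp_all add: osp_h_R)
  ultimately have "Act True (R f 1) (Act True (R f 0) (hw 4)) = hw_std 4"
    unfolding hw_simps hw_std_simps by (simp only: Act_psi)
  moreover have "Act True (R f 1) (Act True (R f 0) (hw 4)) \<in> summand 4"
    by (intro summand_R hw_in_summand) simp_all
  ultimately show "hw_std 4 \<in> summand 4" by simp
  show "hw_std 5 \<in> summand 5" using hw_in_summand[of 5] by (simp add: hw_simps hw_std_simps)
qed

lemma hw_std_nonzero: "r < 6 \<Longrightarrow> hw_std r \<noteq> tzero"
proof (rule less6_induct[where P = "\<lambda>r. hw_std r \<noteq> tzero"])
  have nz: "T a b c d \<noteq> 0 \<Longrightarrow> T \<noteq> tzero" for T :: tens and a b c d by (auto simp: tzero_def)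
  show "hw_std 0 \<noteq> tzero" by (rule nz[of _ f f g g]) (simp add: hw_std_simps tadd_def tscale_def wdg_component etens_def)
  show "hw_std 1 \<noteq> tzero" by (rule nz[of _ f f g f]) (simp only: hw_std_simps, simp add: tadd_def tscale_def wdg_component etens_def)
  show "hw_std 3 \<noteq> tzero" by (rule nz[of _ f f f f]) (simp add: hw_std_simps tadd_def tscale_def wdg_component etens_def)
  have tr0: "tr tzero a d = 0" for a d by (simp add: tr_def tzero_def)
  have st: "emat x y b (st b) = 0" if "x = f \<or> x = g" "y = f \<or> y = g" for x y b
  proof -
    have "y \<in> letters" using that(2) by auto
    then have "st x \<noteq> y" using st_letter[OF that(1)] by blast
    then show ?thesis by (auto simp: emat_def)
  qed
  \<comment> \<open>Nonvanishing is read off from the contraction: no two of the letters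
    \<open>f\<close>, \<open>g\<close> are dual, so the trace term is absent and M - 2
    remains.\<close>
  have "tr (hw_std 2) g f = sdim - 2"
    unfolding hw_std_simps by (simp add: tr_psi st sdim_def) (simp add: emat_def)
  then show "hw_std 2 \<noteq> tzero" using tr0[of g f] sdim_neq by auto
  have "tr (hw_std 4) f f = -2 * (sdim - 2)"
    unfolding hw_std_simps by (simp add: tr_psi st sdim_def) (simp add: emat_def)
  then show "hw_std 4 \<noteq> tzero" using tr0[of f f] sdim_neq by auto
  show "hw_std 5 \<noteq> tzero" using hw_nonzero[of 5] by (simp add: hw_simps hw_std_simps)
qed

text \<open>Nothing lies above e_f and only e_f lies above e_g. These two letters have the same
  parity, so an odd raising element cannot join them.\<close>

lemma raising2_colsum:
  assumes X: "osp_h z X" "raising ht2 X"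
  shows "colsum X f G = 0" "colsum X g G = X f g * G f" "z \<Longrightarrow> X f g = 0"
proof -
  have z: "X x f = 0" for x
    using X(2) osp_h_supp[OF X(1), of x f] ht2_f[of x] unfolding raising_def by (metis less_asym less_irrefl)
  have zg: "X x g = 0" if "x \<noteq> f" for x
    using X(2) osp_h_supp[OF X(1), of x g] ht2_g[of x] that unfolding raising_def by (metis less_asym less_irrefl)
  show "colsum X f G = 0" by (simp add: colsum_def z)
  have "colsum X g G = (\<Sum>x<N. X x g * G x * (if x = f then 1 else 0))"
    unfolding colsum_def by (intro sum.cong) (auto simp: zg)
  then show "colsum X g G = X f g * G f" by (simp add: sum_delta_mult)
  show "z \<Longrightarrow> X f g = 0" using osp_h_parity[OF X(1), of f g] by auto
qed

lemma hw_std_hwv: "r < 6 \<Longrightarrow> hwv ht2 (hw_std r)"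
proof (rule less6_induct[where P = "\<lambda>r. hwv ht2 (hw_std r)"])
  have wdg: "Act z X (wdg a b c d) = (\<lambda>i j k l. X f g * ((if a = g then wdg f b c d i j k l else 0) + (if b = g then wdg a f c d i j k l else 0)
       + (if c = g then wdg a b f d i j k l else 0) + (if d = g then wdg a b c f i j k l else 0)))"
    if X: "osp_h z X" "raising ht2 X" and l: "a = f \<or> a = g" "b = f \<or> b = g" "c = f \<or> c = g" "d = f \<or> d = g" for z X a b c d
  proof (cases z)
    case True
    have "colsum X y G = 0" if "y = f \<or> y = g" for y G
      using raising2_colsum[OF X] that True by auto
    then show ?thesis using l raising2_colsum(3)[OF X True] by (intro ext) (auto simp: Act_wdg[OF X(1)])
  next
    case False
    have "colsum X y G = (if y = g then X f g * G f else 0)" if "y = f \<or> y = g" for y G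
      using raising2_colsum[OF X] that by auto
    moreover have "osp_h False X" using X(1) False by simp
    ultimately show ?thesis using l False
      by (intro ext) (auto simp: Act_wdg algebra_simps)
  qed
  show "hwv ht2 (hw_std 0)" "hwv ht2 (hw_std 1)" "hwv ht2 (hw_std 3)"
    unfolding hwv_def hw_std_simps Act_add Act_scale
    by (intro allI impI ext; elim conjE; simp add: wdg tadd_def tscale_def tzero_def odd_flip[of f g] algebra_simps)+
  show "hwv ht2 (hw_std 2)"
    unfolding hw_std_simps
  proof (rule hwv_psi)
    fix z X i j assume X: "osp_h z X" "raising ht2 X"
    show "Act2 z X (\<lambda>i j. emat g f i j + (-1) * emat f g i j) i j = 0"
    proof -
      have "Act2 z X (emat g f) i j = X f g * emat f f i j"
        "Act2 z X (emat f g) i j = ksign z True * (X f g * emat f f i j)"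
        by (simp_all add: Act2_emat[OF X(1)] raising2_colsum(1,2)[OF X])
      then show ?thesis
        unfolding Act2_add Act2_scale using raising2_colsum(3)[OF X] by (cases z) simp_all
    qed
  qed
  show "hwv ht2 (hw_std 4)"
    unfolding hw_std_simps
  proof (rule hwv_psi)
    fix z X i j assume X: "osp_h z X" "raising ht2 X"
    show "Act2 z X (\<lambda>i j. (-2) * emat f f i j) i j = 0"
      unfolding Act2_scale using raising2_colsum[OF X] by (simp add: Act2_emat[OF X(1)])
  qed
  show "hwv ht2 (hw_std 5)"
    unfolding hw_std_simps by (rule hwv_psi) (rule Kt_invariant)
qed

lemma hw_std_weight: "r < 6 \<Longrightarrow> weightv (wts2 r) (hw_std r)"
proof (rule less6_induct[where P = "\<lambda>r. weightv (wts2 r) (hw_std r)"])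
  note [simp del] = One_nat_def
  show "weightv (wts2 0) (hw_std 0)" "weightv (wts2 1) (hw_std 1)" "weightv (wts2 3) (hw_std 3)"
    unfolding weightv_def hw_std_simps wts2_simps
    by (intro allI impI ext; elim conjE; simp add: Act_add Act_scale Act_wd_diagonal; simp add: tadd_def tscale_def algebra_simps)+
  show "weightv (wts2 2) (hw_std 2)"
    unfolding weightv_def hw_std_simps wts2_simps
    by (intro allI impI psi_weight; elim conjE; (simp only: Act2_add Act2_scale)?) (simp_all add: Act2_emat colsum_diagonal algebra_simps)
  show "weightv (wts2 4) (hw_std 4)"
    unfolding weightv_def hw_std_simps wts2_simps
    by (intro allI impI psi_weight; elim conjE; (simp only: Act2_add Act2_scale)?) (simp_all add: Act2_emat colsum_diagonal algebra_simps)
  show "weightv (wts2 5) (hw_std 5)"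
    unfolding weightv_def hw_std_simps wts2_simps
    by (intro allI impI psi_weight) (simp_all add: Kt_invariant)
qed

end

section \<open>Transfer to the matrix model\<close>

text \<open>The middle index of odd m is self-dual. Indices beyond the range are fixed, which makes
  this an involution on all natural numbers.\<close>

definition dual :: "nat \<Rightarrow> nat \<Rightarrow> nat \<Rightarrow> nat" where
  "dual m n i = (if i < m div 2 then i + m div 2 else if i < 2 * (m div 2) then i - m div 2
     else if i < m then i else if i < m + n then i + n else if i < m + 2 * n then i - n else i)"

definition sgnB :: "nat \<Rightarrow> nat \<Rightarrow> nat \<Rightarrow> complex" where
  "sgnB m n i = (if m + n \<le> i \<and> i < m + 2 * n then -1 else 1)"

text \<open>The value on the weight of e_i of the functional with values a on the epsilons and b on
  the deltas.\<close>

definition height :: "nat \<Rightarrow> nat \<Rightarrow> (nat \<Rightarrow> int) \<Rightarrow> (nat \<Rightarrow> int) \<Rightarrow> nat \<Rightarrow> int" where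
  "height m n a b i = (if i < m div 2 then a i else if i < 2 * (m div 2) then - a (i - m div 2)
     else if i < m then 0 else if i < m + n then b (i - m) else if i < m + 2 * n then - b (i - m - n) else 0)"

locale osp_model =
  fixes m n :: nat

lemma dual_cases:
  obtains "i < m div 2" "dual m n i = i + m div 2"
  | "m div 2 \<le> i" "i < 2 * (m div 2)" "dual m n i = i - m div 2"
  | "2 * (m div 2) \<le> i" "i < m" "dual m n i = i"
  | "m \<le> i" "i < m + n" "dual m n i = i + n"
  | "m + n \<le> i" "i < m + 2 * n" "dual m n i = i - n"
  | "m + 2 * n \<le> i" "dual m n i = i"
proof -
  have "2 * (m div 2) \<le> m" by simp
  then show ?thesis
    using that unfolding dual_def by (smt (verit) le_trans not_le trans_le_add1)
qed

sublocale osp_model \<subseteq> super_index "idxN m n" "podd m" "dual m n" "sgnB m n"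
proof
  fix i
  define d where "d = m div 2"
  have d: "2 * d \<le> m" by (simp add: d_def)
  note [simp] = d_def[symmetric]
  show "dual m n (dual m n i) = i"
    by (cases i rule: dual_cases[of _ m n]) (use d in \<open>auto simp: dual_def\<close>)
  show "i < idxN m n \<Longrightarrow> dual m n i < idxN m n"
    by (cases i rule: dual_cases[of _ m n]) (use d in \<open>simp_all add: idxN_def\<close>)
  show "podd m (dual m n i) = podd m i"
    by (cases i rule: dual_cases[of _ m n]) (use d in \<open>simp_all add: podd_def\<close>)
  show "sgnB m n i * sgnB m n i = 1" by (simp add: sgnB_def)
  show "i < idxN m n \<Longrightarrow> sgnB m n (dual m n i) = ksign (podd m i) (podd m i) * sgnB m n i"
    by (cases i rule: dual_cases[of _ m n]) (use d in \<open>simp_all add: idxN_def podd_def sgnB_def ksign_def\<close>)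
qed

section \<open>Linear spans of tensors\<close>

lemma lin_span_subspace: "is_subspace (lin_span S)"
  unfolding is_subspace_def
proof (intro conjI ballI allI)
  show "tzero \<in> lin_span S" unfolding lin_span_def tzero_def by (auto intro!: exI[of _ "0::nat"])
next
  fix x y assume "x \<in> lin_span S" "y \<in> lin_span S"
  then obtain K L :: nat and c d :: "nat \<Rightarrow> complex" and v w where x: "x = (\<lambda>i j k l. \<Sum>r<K. c r * v r i j k l)" "\<forall>r<K. v r \<in> S"
    and y: "y = (\<lambda>i j k l. \<Sum>r<L. d r * w r i j k l)" "\<forall>r<L. w r \<in> S"
    unfolding lin_span_def by blast
  define e where "e r = (if r < K then c r else d (r - K))" for r
  define z where "z r = (if r < K then v r else w (r - K))" for r
  have split: "(\<Sum>r<K + L. G r) = (\<Sum>r<K. G r) + (\<Sum>r<L. G (K + r))" for G :: "nat \<Rightarrow> complex"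
    by (induction L) (simp_all add: add.assoc)
  have "tadd x y = (\<lambda>i j k l. \<Sum>r<K + L. e r * z r i j k l)"
    by (intro ext) (simp add: tadd_def x(1) y(1) split e_def z_def)
  moreover have "\<forall>r<K + L. z r \<in> S" using x(2) y(2) by (auto simp: z_def)
  ultimately show "tadd x y \<in> lin_span S" unfolding lin_span_def by blast
next
  fix k x assume "x \<in> lin_span S"
  then obtain K :: nat and c :: "nat \<Rightarrow> complex" and v where x: "x = (\<lambda>i j k l. \<Sum>r<K. c r * v r i j k l)" "\<forall>r<K. v r \<in> S"
    unfolding lin_span_def by blast
  have "tscale k x = (\<lambda>i j q l. \<Sum>r<K. (k * c r) * v r i j q l)"
    by (intro ext) (simp add: tscale_def x(1) sum_distrib_left mult.assoc)
  then show "tscale k x \<in> lin_span S" using x(2) unfolding lin_span_def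
    by (intro CollectI exI[of _ K] exI[of _ "\<lambda>r. k * c r"] exI[of _ v]) auto
qed

lemma lin_span_base: "x \<in> S \<Longrightarrow> x \<in> lin_span S"
  unfolding lin_span_def by (rule CollectI, rule exI[of _ 1], rule exI[of _ "\<lambda>_. 1"], rule exI[of _ "\<lambda>_. x"]) auto

lemma lin_span_least:
  assumes "is_subspace U" "S \<subseteq> U"
  shows "lin_span S \<subseteq> U"
proof
  fix x assume "x \<in> lin_span S"
  then obtain K :: nat and c :: "nat \<Rightarrow> complex" and v where x: "x = (\<lambda>i j k l. \<Sum>r<K. c r * v r i j k l)" "\<forall>r<K. v r \<in> S"
    unfolding lin_span_def by blast
  have "(\<lambda>i j k l. \<Sum>r<L. c r * v r i j k l) \<in> U" if "L \<le> K" for L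
    using that
  proof (induction L)
    case 0
    then show ?case using assms(1) by (simp add: is_subspace_def tzero_def)
  next
    case (Suc L)
    have "(\<lambda>i j k l. \<Sum>r<Suc L. c r * v r i j k l) = tadd (\<lambda>i j k l. \<Sum>r<L. c r * v r i j k l) (tscale (c L) (v L))"
      by (simp add: tadd_def tscale_def)
    moreover have "v L \<in> U" using x(2) Suc.prems assms(2) by auto
    ultimately show ?case using Suc assms(1) by (simp add: is_subspace_def)
  qed
  then show "x \<in> U" unfolding x(1) by blast
qed

section \<open>Raising and lowering the second and fourth index\<close>

context super_index
begin

text \<open>Raises the second leg of each pair with B, which turns a pair of legs into a matrix;
  \<open>Phi\<close> is the inverse on arbitrary arrays.\<close>

definition Psi :: "tens \<Rightarrow> tens" where
  "Psi T = (\<lambda>i j k l. eta (st j) * eta (st l) * T i (st j) k (st l))"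

definition Phi :: "tens \<Rightarrow> tens" where
  "Phi T = (\<lambda>a b c d. eta b * eta d * T a (st b) c (st d))"

lemma Psi_Phi [simp]: "Psi (Phi T) = T" and Phi_Psi [simp]: "Phi (Psi T) = T"
  by (intro ext; simp add: Psi_def Phi_def mult_ac)+

lemma Psi_linear:
  "Psi (tadd S T) = tadd (Psi S) (Psi T)" "Psi (tscale k T) = tscale k (Psi T)" "Psi tzero = tzero"
  "Psi (tsum u I) = tsum (\<lambda>r. Psi (u r)) I"
  by (intro ext; simp add: Psi_def tadd_def tscale_def tzero_def tsum_def algebra_simps sum_distrib_left)+

lemma Phi_linear:
  "Phi (tadd S T) = tadd (Phi S) (Phi T)" "Phi (tscale k T) = tscale k (Phi T)" "Phi tzero = tzero"
  by (intro ext; simp add: Phi_def tadd_def tscale_def tzero_def algebra_simps)+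

lemma Psi_eq_iff: "Psi S = Psi T \<longleftrightarrow> S = T"
  by (metis Phi_Psi)

lemma mem_Psi_image: "T \<in> Psi ` U \<longleftrightarrow> Phi T \<in> U"
proof
  assume "Phi T \<in> U"
  then have "Psi (Phi T) \<in> Psi ` U" by (rule imageI)
  then show "T \<in> Psi ` U" by simp
qed auto

lemma Psi_subspace: "is_subspace U \<Longrightarrow> is_subspace (Psi ` U)"
  unfolding is_subspace_def by (auto simp: mem_Psi_image Phi_linear)

lemma Psi_direct_sum:
  assumes "is_direct_sum U V I"
  shows "is_direct_sum (Psi ` U) (\<lambda>r. Psi ` V r) I"
  unfolding is_direct_sum_def
proof (intro conjI)
  have U: "U = {tsum u I | u. \<forall>r\<in>I. u r \<in> V r}"
    and ind: "\<And>u. \<forall>r\<in>I. u r \<in> V r \<Longrightarrow> tsum u I = tzero \<Longrightarrow> \<forall>r\<in>I. u r = tzero"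
    using assms unfolding is_direct_sum_def by blast+
  show "Psi ` U = {tsum u I | u. \<forall>r\<in>I. u r \<in> Psi ` V r}"
  proof (intro set_eqI iffI)
    fix T assume "T \<in> Psi ` U"
    then obtain u where "T = Psi (tsum u I)" "\<forall>r\<in>I. u r \<in> V r" using U by auto
    then show "T \<in> {tsum u I | u. \<forall>r\<in>I. u r \<in> Psi ` V r}"
      by (auto simp: Psi_linear intro!: exI[of _ "\<lambda>r. Psi (u r)"])
  next
    fix T assume "T \<in> {tsum u I | u. \<forall>r\<in>I. u r \<in> Psi ` V r}"
    then obtain u where u: "T = tsum u I" "\<forall>r\<in>I. u r \<in> Psi ` V r" by blast
    then have "T = Psi (tsum (\<lambda>r. Phi (u r)) I)" by (simp add: Psi_linear)
    moreover have "tsum (\<lambda>r. Phi (u r)) I \<in> U" using u(2) U by (auto simp: mem_Psi_image)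
    ultimately show "T \<in> Psi ` U" by blast
  qed
  show "\<forall>u. (\<forall>r\<in>I. u r \<in> Psi ` V r) \<and> tsum u I = tzero \<longrightarrow> (\<forall>r\<in>I. u r = tzero)"
  proof (intro allI impI)
    fix u assume u: "(\<forall>r\<in>I. u r \<in> Psi ` V r) \<and> tsum u I = tzero"
    have "Psi (tsum (\<lambda>r. Phi (u r)) I) = Psi tzero" using u by (simp add: Psi_linear)
    then have "tsum (\<lambda>r. Phi (u r)) I = tzero" by (simp add: Psi_eq_iff)
    then have "\<forall>r\<in>I. Phi (u r) = tzero" using ind[of "\<lambda>r. Phi (u r)"] u by (auto simp: mem_Psi_image)
    then show "\<forall>r\<in>I. u r = tzero" by (metis Psi_Phi Psi_linear(3))
  qed
qed

text \<open>The identification of a matrix with an element of $V \otimes V$ turns the defining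
  relation of osp into super-antisymmetry.\<close>

lemma osp_h_skew:
  assumes X: "osp_h z X"
  shows "eta a * X b (st a) = - ksign (p a) (p b) * (eta b * X a (st b))"
proof (cases "a < N \<and> b < N")
  case True
  show ?thesis
  proof (cases "X a (st b) = 0")
    case True
    then show ?thesis using osp_h_relation[OF X, of b "st a"] \<open>a < N \<and> b < N\<close> by simp
  next
    case False
    then have "(p a \<noteq> p b) = z" using osp_h_parity[OF X, of a "st b"] by simp
    then have "ksign z (p a) * ksign (p a) (p a) = ksign (p a) (p b)" by (auto simp: ksign_def)
    moreover have "eta a * X b (st a) = - (ksign z (p a) * ksign (p a) (p a)) * (eta b * (eta a * (eta a * X a (st b))))"
      using osp_h_relation[OF X, of b "st a"] True by (simp add: eta_st mult_ac)
    ultimately show ?thesis by simp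
  qed
next
  case False
  then have "X b (st a) = 0" "X a (st b) = 0" using osp_h_supp[OF X, of b "st a"] osp_h_supp[OF X, of a "st b"] by auto
  then show ?thesis by simp
qed

text \<open>In the supercommutator with \<open>Z\<close> the matrix \<open>Z\<close> also multiplies
  from the right. By the relation of osp, after lowering the index, this is the action of
  \<open>Z\<close> on the second leg.\<close>

lemma leg_dual:
  assumes Z: "osp_h z Z"
  shows "- (\<Sum>q<N. ksign z (p i \<noteq> p q) * (eta (st q) * y i (st q)) * Z q j)
    = eta (st j) * (ksign z (p i) * (\<Sum>x<N. Z (st j) x * y i x))"
proof (cases "j < N")
  case True
  have "- (\<Sum>q<N. ksign z (p i \<noteq> p q) * (eta (st q) * y i (st q)) * Z q j)
      = - (\<Sum>x<N. ksign z (p i \<noteq> p x) * (eta x * y i x) * Z (st x) j)"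
    using sum_st[of "\<lambda>x. ksign z (p i \<noteq> p x) * (eta x * y i x) * Z (st x) j"] by simp
  also have "\<dots> = (\<Sum>x<N. eta (st j) * (ksign z (p i) * (Z (st j) x * y i x)))"
    unfolding sum_negf[symmetric]
  proof (intro sum.cong refl)
    fix x assume "x \<in> {..<N}"
    then have x: "x < N" by simp
    show "- (ksign z (p i \<noteq> p x) * (eta x * y i x) * Z (st x) j) = eta (st j) * (ksign z (p i) * (Z (st j) x * y i x))"
    proof (cases "Z (st j) x = 0")
      case True
      then show ?thesis using osp_h_relation[OF Z, of "st x" j] x \<open>j < N\<close> by simp
    next
      case False
      then have "(p j \<noteq> p x) = z" using osp_h_parity[OF Z, of "st j" x] by simp
      then have s: "ksign z (p i \<noteq> p x) * ksign z (p j) * ksign (p x) (p x) = ksign (p j) (p j) * ksign z (p i)"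
        by (auto simp: ksign_def)
      have "- (ksign z (p i \<noteq> p x) * (eta x * y i x) * Z (st x) j)
          = (ksign z (p i \<noteq> p x) * ksign z (p j) * ksign (p x) (p x)) * (eta x * (eta x * (y i x * (eta j * Z (st j) x))))"
        unfolding osp_h_relation[OF Z, of "st x" j, OF st_less[OF x] \<open>j < N\<close>] using x by (simp add: eta_st mult_ac)
      then show ?thesis unfolding s using \<open>j < N\<close> by (simp add: eta_st mult_ac)
    qed
  qed
  finally show ?thesis by (simp add: sum_distrib_left)
next
  case False
  then have "Z q j = 0" "Z (st j) q = 0" for q using osp_h_supp[OF Z, of q j] osp_h_supp[OF Z, of "st j" q] by auto
  then show ?thesis by simp
qed

lemma Phi_tp_Fm: "Phi (tp (Fm a b) (Fm c d)) = wdg a b c d"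
proof (intro ext)
  fix i j k l
  define P :: "nat \<Rightarrow> nat \<Rightarrow> nat \<Rightarrow> nat \<Rightarrow> complex" where "P a b i j = (if i = a \<and> j = b then 1 else 0)" for a b i j
  have e: "eta j * Fm a b i (st j) = P a b i j - ksign (p a) (p b) * P b a i j" for a b i j
  proof -
    have "Fm a b i (st j) = eta j * P a b i j - ksign (p a) (p b) * (eta j * P b a i j)"
      unfolding Fm_def P_def st_eq_iff by (rule arg_cong2[where f = minus]) auto
    then show ?thesis by (simp add: right_diff_distrib mult.left_commute)
  qed
  have t: "etens a b c d i j k l = P a b i j * P c d k l" for a b c d
    by (simp add: etens_def P_def)
  have "Phi (tp (Fm a b) (Fm c d)) i j k l = (eta j * Fm a b i (st j)) * (eta l * Fm c d k (st l))"
    by (simp add: Phi_def tp_def mult_ac)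
  then show "Phi (tp (Fm a b) (Fm c d)) i j k l = wdg a b c d i j k l"
    unfolding e wdg_component t by (simp add: algebra_simps)
qed

text \<open>The expansion in basis tensors is pushed through \<open>skew\<close>, which is 4 on
  \<open>W\<close>. It thereby becomes an expansion in images of pure tensors of elements
  \<open>Fm\<close>.\<close>

lemma W_expand:
  assumes "T \<in> W"
  shows "T = tscale (1 / 4) (tsum (\<lambda>a. tsum (\<lambda>b. tsum (\<lambda>c. tsum (\<lambda>d. tscale (T a b c d) (wdg a b c d)) {..<N}) {..<N}) {..<N}) {..<N})"
proof -
  have e: "tsum (\<lambda>a. tsum (\<lambda>b. tsum (\<lambda>c. tsum (\<lambda>d. tscale (T a b c d) (etens a b c d)) {..<N}) {..<N}) {..<N}) {..<N} = T" (is "?S = T")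
  proof (intro ext)
    fix i j k l
    have *: "(\<Sum>x<N. G x * (if y = x then 1 else 0)) = (if y < N then G y else 0)" for y and G :: "nat \<Rightarrow> complex"
    proof -
      have "(\<Sum>x<N. G x * (if y = x then 1 else 0)) = (\<Sum>x<N. if x = y then G x else 0)" by (rule sum.cong) auto
      then show ?thesis by simp
    qed
    have "?S i j k l = (\<Sum>a<N. (\<Sum>b<N. (\<Sum>c<N. (\<Sum>d<N. T a b c d * (if l = d then 1 else 0)) * (if k = c then 1 else 0)) * (if j = b then 1 else 0)) * (if i = a then 1 else 0))"
      unfolding tsum_def tscale_def sum_distrib_right by (intro sum.cong refl) (simp add: etens_def)
    also have "\<dots> = T i j k l" using assms unfolding * W_iff supp_def by auto
    finally show "?S i j k l = T i j k l" .
  qed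
  have lin: "skew (tsum w I) = tsum (\<lambda>r. skew (w r)) I" "skew (tscale k S) = tscale k (skew S)" for w I k S
    by (intro ext; simp add: skew_def tsum_def tadd_def tscale_def sw12_def sw34_def sum.distrib sum_distrib_left sum_subtractf sum_negf algebra_simps)+
  have "skew T = tscale 4 T"
  proof -
    have T: "sw12 T = tscale (-1) T" "sw34 T = tscale (-1) T" using assms by (simp_all add: W_iff)
    have "sw12 (tscale (-1) T) = tscale (-1) (sw12 T)" by (intro ext) (simp add: sw12_def tscale_def)
    then show ?thesis unfolding skew_def T by (intro ext) (simp add: T tadd_def tscale_def)
  qed
  then have "T = tscale (1 / 4) (skew T)" by (simp add: tscale_def)
  also have "skew T = skew ?S" using e by simp
  finally show ?thesis unfolding lin wdg_def .
qed

end

section \<open>The concrete algebra, its tensor square and its submodules\<close>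

context osp_model
begin

abbreviation (input) "N \<equiv> idxN m n"
abbreviation (input) "p \<equiv> podd m"
abbreviation (input) "st \<equiv> dual m n"
abbreviation (input) "eta \<equiv> sgnB m n"

lemma Bform_eq: "Bform m n a b = (if b = st a \<and> a < N then eta a else 0)"
proof -
  define d where "d = m div 2"
  have d: "2 * d \<le> m" "odd m \<longleftrightarrow> 2 * d < m" "m \<le> 2 * d + 1" unfolding d_def by presburger+
  note [simp] = d_def[symmetric]
  show ?thesis
    by (cases a rule: dual_cases[of _ m n]) (use d in \<open>auto simp: Bform_def Let_def idxN_def sgnB_def simp del: odd_Suc_div_two\<close>)
qed

lemma Bform_sums:
  assumes "a < N" "b < N"
  shows "(\<Sum>c<N. X c * Bform m n c b) = X (st b) * eta (st b)"
    and "(\<Sum>c<N. Bform m n a c * X c) = eta a * X (st a)"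
proof -
  have "(\<Sum>c<N. X c * Bform m n c b) = (\<Sum>c<N. if c = st b then X c * eta c else 0)"
    by (rule sum.cong) (auto simp: Bform_eq)
  then show "(\<Sum>c<N. X c * Bform m n c b) = X (st b) * eta (st b)" using assms by simp
  have "(\<Sum>c<N. Bform m n a c * X c) = (\<Sum>c<N. if c = st a then eta a * X c else 0)"
    using assms by (intro sum.cong) (auto simp: Bform_eq)
  then show "(\<Sum>c<N. Bform m n a c * X c) = eta a * X (st a)" using assms by simp
qed

lemma osp_par_iff: "osp_par m n s X \<longleftrightarrow> osp_h s X"
proof -
  have 1: "(\<forall>i j. (N \<le> i \<or> N \<le> j) \<longrightarrow> X i j = 0) \<longleftrightarrow> (\<forall>i j. X i j \<noteq> 0 \<longrightarrow> i < N \<and> j < N)"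
    by (meson not_le)
  have 2: "(\<forall>i j. ((p i \<noteq> p j) \<noteq> s) \<longrightarrow> X i j = 0) \<longleftrightarrow> homog s X"
    unfolding homog_def by blast
  have k: "(if s \<and> p a then -1 else 1) = ksign s (p a)" for a by (simp add: ksign_def)
  have "(\<forall>a<N. \<forall>b<N. (\<Sum>c<N. X c a * Bform m n c b)
        + (if s \<and> p a then -1 else 1) * (\<Sum>c<N. Bform m n a c * X c b) = 0)
    \<longleftrightarrow> (\<forall>a<N. \<forall>b<N. X (st b) a * eta (st b)
        = - ksign s (p a) * eta a * X (st a) b)"
    unfolding k by (simp add: Bform_sums add_eq_0_iff2 mult.assoc)
  also have "\<dots> \<longleftrightarrow> (\<forall>b<N. \<forall>c<N. X b c * eta b = - ksign s (p c) * eta c * X (st c) (st b))"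
  proof (intro iffI allI impI)
    fix b c assume "\<forall>a<N. \<forall>b<N. X (st b) a * eta (st b)
        = - ksign s (p a) * eta a * X (st a) b" "b < N" "c < N"
    then show "X b c * eta b = - ksign s (p c) * eta c * X (st c) (st b)"
      using st_less[of b] st_st[of b] by metis
  next
    fix a b assume "\<forall>b<N. \<forall>c<N. X b c * eta b = - ksign s (p c) * eta c * X (st c) (st b)"
      "a < N" "b < N"
    then show "X (st b) a * eta (st b) = - ksign s (p a) * eta a * X (st a) b"
      using st_less[of b] st_st[of b] by metis
  qed
  finally show ?thesis unfolding osp_par_def osp_h_def 1 2 by blast
qed

lemma parts_add: "X i j = ev_part m X i j + od_part m X i j"
  by (simp add: ev_part_def od_part_def)

lemma osp_iff: "X \<in> osp m n \<longleftrightarrow> osp_h False (ev_part m X) \<and> osp_h True (od_part m X)"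
proof
  assume "X \<in> osp m n"
  then obtain X0 X1 where X: "X = (\<lambda>i j. X0 i j + X1 i j)" "osp_h False X0" "osp_h True X1"
    unfolding osp_def osp_par_iff by blast
  have "p i \<noteq> p j \<Longrightarrow> X0 i j = 0" "p i = p j \<Longrightarrow> X1 i j = 0" for i j
    using osp_h_parity[OF X(2), of i j] osp_h_parity[OF X(3), of i j] by auto
  then have "ev_part m X = X0" "od_part m X = X1"
    unfolding X(1) by (intro ext; auto simp: ev_part_def od_part_def)+
  then show "osp_h False (ev_part m X) \<and> osp_h True (od_part m X)" using X by simp
next
  assume "osp_h False (ev_part m X) \<and> osp_h True (od_part m X)"
  moreover have "X = (\<lambda>i j. ev_part m X i j + od_part m X i j)" by (intro ext) (rule parts_add)
  ultimately show "X \<in> osp m n" unfolding osp_def osp_par_iff by blast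
qed

lemma osp_h_zero: "osp_h z (\<lambda>i j. 0)"
  by (rule osp_hI) (simp_all add: homog_def)

lemma osp_h_parts:
  assumes "osp_h z X"
  shows "ev_part m X = (if z then (\<lambda>i j. 0) else X)" "od_part m X = (if z then X else (\<lambda>i j. 0))"
proof -
  have "X i j = 0" if "(p i \<noteq> p j) \<noteq> z" for i j using osp_h_parity[OF assms, of i j] that by auto
  then show "ev_part m X = (if z then (\<lambda>i j. 0) else X)" "od_part m X = (if z then X else (\<lambda>i j. 0))"
    by (intro ext; auto simp: ev_part_def od_part_def)+
qed

lemma osp_h_osp: "osp_h z X \<Longrightarrow> X \<in> osp m n"
  by (cases z) (simp_all add: osp_iff osp_h_parts osp_h_zero)

text \<open>The four parity cases of the definition merge into one Koszul sign per summand, read off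
  from the positions of the two entries.\<close>

lemma sbr_formula:
  "sbr m n Z Y i j = (\<Sum>k<N. Z i k * Y k j)
    - (\<Sum>k<N. ksign (p k \<noteq> p j) (p i \<noteq> p k) * Y i k * Z k j)"
proof -
  have "ksign (p k \<noteq> p j) (p i \<noteq> p k) * Y i k * Z k j
    = ev_part m Y i k * ev_part m Z k j + od_part m Y i k * ev_part m Z k j + ev_part m Y i k * od_part m Z k j
      - od_part m Y i k * od_part m Z k j" for k
    by (auto simp: ev_part_def od_part_def ksign_def)
  then show ?thesis
    unfolding sbr_def Let_def mm_def by (simp add: sum.distrib sum_subtractf)
qed

lemma sbr_add: "sbr m n (\<lambda>i j. X i j + Z i j) Y i j = sbr m n X Y i j + sbr m n Z Y i j"
  unfolding sbr_formula by (simp add: algebra_simps sum.distrib sum_subtractf)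

lemma sbr_osp_h:
  assumes Z: "osp_h z Z"
  shows "sbr m n Z (\<lambda>a b. eta (st b) * y a (st b)) i j = eta (st j) * Act2 z Z y i (st j)"
proof -
  have "(\<Sum>k<N. ksign (p k \<noteq> p j) (p i \<noteq> p k) * (eta (st k) * y i (st k)) * Z k j)
     = (\<Sum>k<N. ksign z (p i \<noteq> p k) * (eta (st k) * y i (st k)) * Z k j)"
  proof (intro sum.cong refl)
    fix k
    show "ksign (p k \<noteq> p j) (p i \<noteq> p k) * (eta (st k) * y i (st k)) * Z k j
      = ksign z (p i \<noteq> p k) * (eta (st k) * y i (st k)) * Z k j"
      using osp_h_parity[OF Z, of k j] by (cases "Z k j = 0") simp_all
  qed
  moreover have "(\<Sum>k<N. Z i k * (eta (st j) * y k (st j))) = eta (st j) * (\<Sum>k<N. Z i k * y k (st j))"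
    by (rule sum_pull)
  ultimately show ?thesis
    unfolding sbr_formula using leg_dual[OF Z, of i y j] by (simp add: Act2_def distrib_left)
qed

lemma act_Psi:
  assumes X: "X \<in> osp m n"
  shows "act m n X (Psi T) = Psi (tadd (Act False (ev_part m X) T) (Act True (od_part m X) T))"
proof (intro ext)
  fix i j k l
  define X0 where "X0 = ev_part m X"
  define X1 where "X1 = od_part m X"
  have osp_h: "osp_h False X0" "osp_h True X1" using X by (simp_all add: osp_iff X0_def X1_def)
  have XX: "X = (\<lambda>i j. X0 i j + X1 i j)" unfolding X0_def X1_def by (intro ext) (rule parts_add)
  have a: "sbr m n Z (\<lambda>a b. Psi T a b k l) i j = eta (st j) * eta (st l) * (leg1 Z T i (st j) k (st l) + leg2 z Z T i (st j) k (st l))"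
    if "osp_h z Z" for z Z
  proof -
    have "sbr m n Z (\<lambda>a b. Psi T a b k l) i j = eta (st j) * Act2 z Z (\<lambda>a b. eta (st l) * T a b k (st l)) i (st j)"
      using sbr_osp_h[OF that, of "\<lambda>a b. eta (st l) * T a b k (st l)" i j] by (simp add: Psi_def mult.assoc)
    then show ?thesis unfolding Act2_scale by (simp add: Act2_def leg_defs mult.assoc)
  qed
  have b: "sbr m n Z (\<lambda>a b. s * Psi T i j a b) k l = eta (st j) * eta (st l) * (leg3 z Z T i (st j) k (st l) + leg4 z Z T i (st j) k (st l))"
    if Z: "osp_h z Z" and s: "s = ksign z (p i) * ksign z (p j)" for z Z s
  proof -
    have "sbr m n Z (\<lambda>a b. s * Psi T i j a b) k l = eta (st l) * Act2 z Z (\<lambda>a b. (s * eta (st j)) * T i (st j) a b) k (st l)"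
      using sbr_osp_h[OF Z, of "\<lambda>a b. (s * eta (st j)) * T i (st j) a b" k l] by (simp add: Psi_def mult_ac)
    then show ?thesis unfolding Act2_scale by (simp add: Act2_def leg_defs s algebra_simps)
  qed
  have b0: "sbr m n X0 (\<lambda>a b. 1 * Psi T i j a b) k l = eta (st j) * eta (st l) * (leg3 False X0 T i (st j) k (st l) + leg4 False X0 T i (st j) k (st l))"
    by (rule b[OF osp_h(1)]) simp
  have "act1 m n X (Psi T) i j k l = sbr m n X0 (\<lambda>a b. Psi T a b k l) i j + sbr m n X1 (\<lambda>a b. Psi T a b k l) i j"
    unfolding act1_def by (subst XX) (rule sbr_add)
  moreover have "act2 m n X0 (Psi T) i j k l = sbr m n X0 (\<lambda>a b. 1 * Psi T i j a b) k l"
    by (simp add: act2_def)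
  \<comment> \<open>\<open>par1\<close> supplies the Koszul sign of an odd operator passing the
    first two legs.\<close>
  moreover have "act2 m n X1 (par1 m (Psi T)) i j k l = sbr m n X1 (\<lambda>a b. (ksign True (p i) * ksign True (p j)) * Psi T i j a b) k l"
  proof -
    have "(if p i = p j then 1 else -1) = ksign True (p i) * ksign True (p j)"
      by (simp add: ksign_def)
    then show ?thesis unfolding act2_def par1_def by simp
  qed
  ultimately have "act m n X (Psi T) i j k l = eta (st j) * eta (st l) *
     (leg1 X0 T i (st j) k (st l) + leg2 False X0 T i (st j) k (st l) + leg3 False X0 T i (st j) k (st l) + leg4 False X0 T i (st j) k (st l)
      + (leg1 X1 T i (st j) k (st l) + leg2 True X1 T i (st j) k (st l) + leg3 True X1 T i (st j) k (st l) + leg4 True X1 T i (st j) k (st l)))"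
    unfolding act_def tadd_def X0_def[symmetric] X1_def[symmetric]
    by (simp only: a[OF osp_h(1)] a[OF osp_h(2)] b0 b[OF osp_h(2) refl])
      (simp add: algebra_simps)
  then show "act m n X (Psi T) i j k l = Psi (tadd (Act False (ev_part m X) T) (Act True (od_part m X) T)) i j k l"
    unfolding X0_def[symmetric] X1_def[symmetric] by (simp add: Psi_def tadd_def Act_def)
qed

lemma act_Psi_osp_h: "osp_h z X \<Longrightarrow> act m n X (Psi T) = Psi (Act z X T)"
  by (cases z) (simp_all add: act_Psi osp_h_osp osp_h_parts Act_zero_matrix tadd_tzero)

lemma Phi_tp_in_W:
  assumes X: "X \<in> osp m n" and Y: "Y \<in> osp m n"
  shows "Phi (tp X Y) \<in> W"
proof -
  define fl where "fl X a b = eta b * X a (st b)" for X :: mat and a b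
  have P: "Phi (tp X Y) a b c d = fl X a b * fl Y c d" for a b c d
    by (simp add: Phi_def tp_def fl_def mult_ac)
  have sk: "fl X b a = - ksign (p a) (p b) * fl X a b" if "X \<in> osp m n" for X a b
  proof -
    have o: "osp_h False (ev_part m X)" "osp_h True (od_part m X)" using that by (simp_all add: osp_iff)
    have "fl X b a = eta a * ev_part m X b (st a) + eta a * od_part m X b (st a)"
      unfolding fl_def by (subst parts_add) (rule distrib_left)
    also have "\<dots> = - ksign (p a) (p b) * (eta b * (ev_part m X a (st b) + od_part m X a (st b)))"
      unfolding osp_h_skew[OF o(1), of a b] osp_h_skew[OF o(2), of a b] by (simp add: algebra_simps)
    finally show ?thesis unfolding fl_def by (simp only: parts_add[symmetric])
  qed
  have su: "a < N \<and> b < N" if "X \<in> osp m n" "fl X a b \<noteq> 0" for X a b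
  proof -
    have o: "osp_h False (ev_part m X)" "osp_h True (od_part m X)" using that by (simp_all add: osp_iff)
    have "ev_part m X a (st b) \<noteq> 0 \<or> od_part m X a (st b) \<noteq> 0"
      using that(2) parts_add[of X a "st b"] unfolding fl_def by auto
    then show ?thesis using osp_h_supp[OF o(1), of a "st b"] osp_h_supp[OF o(2), of a "st b"] by auto
  qed
  show ?thesis
    unfolding W_def P
  proof (intro CollectI conjI allI impI)
    fix a b c d
    show "fl X b a * fl Y c d = - ksign (p a) (p b) * (fl X a b * fl Y c d)"
      unfolding sk[OF X, of b a] by simp
    show "fl X a b * fl Y d c = - ksign (p c) (p d) * (fl X a b * fl Y c d)"
      unfolding sk[OF Y, of d c] by simp
  qed (use su[OF X] su[OF Y] in auto)
qed

text \<open>Stated for a linear map \<open>g\<close> because it is used twice: with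
  \<open>Psi\<close> alone, and with \<open>Psi\<close> after a multiple of the projection onto an
  eigenspace of the flip.\<close>

lemma tens_span:
  assumes U: "is_subspace U" and T: "T \<in> W" and F: "\<And>a b c d. a < N \<Longrightarrow> b < N \<Longrightarrow> c < N \<Longrightarrow> d < N \<Longrightarrow> g (wdg a b c d) \<in> U"
    and g: "\<And>k S. g (tscale k S) = tscale k (g S)" "\<And>(w :: nat \<Rightarrow> tens) I. g (tsum w I) = tsum (\<lambda>r. g (w r)) I"
  shows "g T \<in> U"
proof -
  have sc: "S \<in> U \<Longrightarrow> tscale k S \<in> U" for S k using U by (simp add: is_subspace_def)
  show ?thesis
    by (subst W_expand[OF T], unfold g) (intro sc tsum_subspace[OF U] F; simp)
qed

lemma gtg_eq: "gtg m n = Psi ` W"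
proof
  show "gtg m n \<subseteq> Psi ` W"
    unfolding gtg_def
    by (rule lin_span_least[OF Psi_subspace[OF W_subspace]]) (auto simp: mem_Psi_image Phi_tp_in_W)
  show "Psi ` W \<subseteq> gtg m n"
  proof (rule image_subsetI)
    fix T assume T: "T \<in> W"
    show "Psi T \<in> gtg m n"
      unfolding gtg_def
    proof (rule tens_span[OF lin_span_subspace T, where g = Psi])
      fix a b c d assume "a < N" "b < N" "c < N" "d < N"
      then have "Fm a b \<in> osp m n" "Fm c d \<in> osp m n" using osp_h_Fm osp_h_osp by blast+
      moreover have "Psi (wdg a b c d) = tp (Fm a b) (Fm c d)" by (simp add: Phi_tp_Fm[symmetric])
      ultimately show "Psi (wdg a b c d) \<in> lin_span {tp X Y |X Y. X \<in> osp m n \<and> Y \<in> osp m n}"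
        by (intro lin_span_base) auto
    qed (simp_all add: Psi_linear)
  qed
qed

lemma bsw_tp:
  assumes X: "osp_h s X" and Y: "osp_h t Y"
  shows "bsw (Phi (tp X Y)) = tscale (ksign s t) (Phi (tp Y X))"
proof (intro ext)
  fix a b c d
  show "bsw (Phi (tp X Y)) a b c d = tscale (ksign s t) (Phi (tp Y X)) a b c d"
  proof (cases "X c (st d) = 0 \<or> Y a (st b) = 0")
    case True
    then show ?thesis by (auto simp: bsw_def Phi_def tp_def tscale_def)
  next
    case False
    then have "(p c \<noteq> p d) = s" "(p a \<noteq> p b) = t"
      using osp_h_parity[OF X, of c "st d"] osp_h_parity[OF Y, of a "st b"] by simp_all
    then show ?thesis by (simp only: bsw_def Phi_def tp_def tscale_def ksign_commute[of t s]) simp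
  qed
qed

lemma eigen_eq:
  assumes k: "k = 1 \<or> k = -1"
  shows "lin_span {tadd (tp X Y) (tscale (k * ksign s t) (tp Y X)) | X Y s t. osp_par m n s X \<and> osp_par m n t Y} = Psi ` bsw_eigen k"
    (is "lin_span ?S = _")
proof
  have kk: "k * k = 1" using k by auto
  have sub: "is_subspace (bsw_eigen k)" using bsw_eigen_Wsub by (simp add: Wsub_def)
  show "lin_span ?S \<subseteq> Psi ` bsw_eigen k"
  proof (rule lin_span_least[OF Psi_subspace[OF sub]], rule subsetI)
    fix T assume "T \<in> ?S"
    then obtain X Y s t where T: "T = tadd (tp X Y) (tscale (k * ksign s t) (tp Y X))" and o: "osp_h s X" "osp_h t Y"
      by (auto simp: osp_par_iff)
    have "Phi T \<in> W" unfolding T Phi_linear using o by (intro W_add W_scale Phi_tp_in_W osp_h_osp)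
    moreover have "bsw (Phi T) = tscale k (Phi T)"
      unfolding T Phi_linear bsw_add bsw_scale bsw_tp[OF o] bsw_tp[OF o(2,1)]
      using kk by (intro ext) (simp add: tadd_def tscale_def ksign_commute[of t s] algebra_simps)
    ultimately show "T \<in> Psi ` bsw_eigen k" by (simp add: mem_Psi_image bsw_eigen_def)
  qed
  show "Psi ` bsw_eigen k \<subseteq> lin_span ?S"
  proof (rule image_subsetI)
    fix T assume T: "T \<in> bsw_eigen k"
    \<comment> \<open>On the eigenspace for k this is twice \<open>Psi\<close>, while it sends a
      pure tensor of elements \<open>Fm\<close> to one of the generators of the span.\<close>
    define g where "g S = Psi (tadd S (tscale k (bsw S)))" for S
    have "g T \<in> lin_span ?S"
    proof (rule tens_span[OF lin_span_subspace, where g = g])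
      show "T \<in> W" using T by (simp add: bsw_eigen_def)
    next
      fix a b c d assume i: "a < N" "b < N" "c < N" "d < N"
      note o = osp_h_Fm[OF i(1,2)] osp_h_Fm[OF i(3,4)]
      have "g (wdg a b c d) = tadd (tp (Fm a b) (Fm c d)) (tscale (k * ksign (p a \<noteq> p b) (p c \<noteq> p d)) (tp (Fm c d) (Fm a b)))"
        unfolding g_def Phi_tp_Fm[symmetric] bsw_tp[OF o] Psi_linear Psi_Phi
        by (intro ext) (simp add: tadd_def tscale_def mult.assoc)
      then show "g (wdg a b c d) \<in> lin_span ?S"
        using o by (intro lin_span_base) (auto simp: osp_par_iff)
    next
      fix c S show "g (tscale c S) = tscale c (g S)"
        unfolding g_def bsw_scale Psi_linear by (intro ext) (simp add: tadd_def tscale_def algebra_simps)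
    next
      fix w :: "nat \<Rightarrow> tens" and I
      have "bsw (tsum w I) = tsum (\<lambda>r. bsw (w r)) I" by (intro ext) (simp add: bsw_def tsum_def sum_distrib_left)
      then show "g (tsum w I) = tsum (\<lambda>r. g (w r)) I"
        unfolding g_def Psi_linear by (intro ext) (simp add: tadd_def tscale_def tsum_def sum.distrib sum_distrib_left Psi_linear Psi_def)
    qed
    moreover have "g T = tscale 2 (Psi T)"
      unfolding g_def using T kk by (intro ext) (simp add: bsw_eigen_def Psi_def tadd_def tscale_def algebra_simps)
    ultimately have "tscale (1 / 2) (tscale 2 (Psi T)) \<in> lin_span ?S"
      using lin_span_subspace[of ?S] by (simp add: is_subspace_def)
    then show "Psi T \<in> lin_span ?S" by (simp add: tscale_def)
  qed
qed

lemma gsym_eq: "gsym m n = Psi ` bsw_eigen 1"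
  unfolding gsym_def eigen_eq[of 1, simplified, symmetric] by (simp add: ksign_def)

lemma gwedge_eq: "gwedge m n = Psi ` bsw_eigen (-1)"
proof -
  have "(if s \<and> t then 1 else -1) = (-1) * ksign s t" for s t by (simp add: ksign_def)
  then show ?thesis unfolding gwedge_def eigen_eq[of "-1", simplified, symmetric] by simp
qed

lemma Psi_submodule:
  assumes "Wsub U"
  shows "submodule m n (Psi ` U)"
  unfolding submodule_def gtg_eq
proof (intro conjI ballI)
  show "Psi ` U \<subseteq> Psi ` W" "is_subspace (Psi ` U)"
    using assms by (auto simp: Wsub_def intro: Psi_subspace)
  fix X S assume X: "X \<in> osp m n" and "S \<in> Psi ` U"
  then obtain T where T: "S = Psi T" "T \<in> U" by blast
  have "tadd (Act False (ev_part m X) T) (Act True (od_part m X) T) \<in> U"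
    using assms X T(2) unfolding Wsub_def is_subspace_def osp_iff by blast
  then show "act m n X S \<in> Psi ` U" unfolding T(1) act_Psi[OF X] by (rule imageI)
qed

lemma submodule_Phi:
  assumes "submodule m n U"
  shows "Wsub {T. Psi T \<in> U}"
  unfolding Wsub_def
proof (intro conjI allI impI)
  show "{T. Psi T \<in> U} \<subseteq> W"
  proof
    fix T assume "T \<in> {T. Psi T \<in> U}"
    then have "Psi T \<in> Psi ` W" using assms by (auto simp: submodule_def gtg_eq)
    then show "T \<in> W" by (simp only: mem_Psi_image Phi_Psi)
  qed
  show "is_subspace {T. Psi T \<in> U}"
    using assms by (auto simp: submodule_def is_subspace_def Psi_linear)
  fix z X T assume "osp_h z X" "T \<in> {T. Psi T \<in> U}"
  then show "Act z X T \<in> {T. Psi T \<in> U}"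
    using assms osp_h_osp by (auto simp: submodule_def act_Psi_osp_h[symmetric])
qed

lemma height_dual: "height m n a b (st i) = - height m n a b i"
  by (cases i rule: dual_cases[of _ m n]) (auto simp: height_def add.commute)

lemma cartan_iff: "H \<in> cartan m n \<longleftrightarrow> osp_h False H \<and> diagonal H"
proof
  assume "H \<in> cartan m n"
  then have H: "H \<in> osp m n" "diagonal H" by (auto simp: cartan_def diagonal_def)
  have "H i j = 0" if "p i \<noteq> p j" for i j using H(2) that by (cases "i = j") (auto simp: diagonal_def)
  then have "ev_part m H = H" by (intro ext) (simp add: ev_part_def)
  then show "osp_h False H \<and> diagonal H" using H by (simp add: osp_iff)
qed (auto simp: cartan_def diagonal_def osp_h_osp)

text \<open>Positivity of a root is stated through a functional on roots, raising through heights of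
  indices. The link is the Cartan element whose diagonal is the height: its eigenvalue on a root
  vector is the functional evaluated at the root.\<close>

lemma hw_transfer:
  assumes T: "T \<in> U" "T \<noteq> tzero" "weightv w T" "hwv (height m n a b) T"
    and w: "\<And>H. w H = wt m n (coef (fst x)) (coef (snd x)) H"
    and pos: "\<And>c e. pos c e \<Longrightarrow> (\<Sum>i<m div 2. c i * a i) + (\<Sum>j<n. e j * b j) > 0"
  shows "has_hw_vector m n pos (Psi ` U) x"
  unfolding has_hw_vector_def
proof (intro bexI[of _ "Psi T"] conjI ballI allI impI)
  show "Psi T \<in> Psi ` U" using T by blast
  show "Psi T \<noteq> tzero" using T(2) Psi_eq_iff[of T tzero] by (simp add: Psi_linear)
  show "act m n H (Psi T) = tscale (wt m n (coef (fst x)) (coef (snd x)) H) (Psi T)" if "H \<in> cartan m n" for H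
    using that T(3) by (simp add: cartan_iff act_Psi_osp_h[of False] weightv_def w Psi_linear)
  fix X c e assume X: "X \<in> osp m n"
  assume "pos c e \<and> (\<forall>H\<in>cartan m n. sbr m n H X = (\<lambda>i j. wt m n (\<lambda>k. of_int (c k)) (\<lambda>k. of_int (e k)) H * X i j))"
  then have ce: "pos c e" and root: "\<And>H. H \<in> cartan m n \<Longrightarrow> sbr m n H X = (\<lambda>i j. wt m n (\<lambda>k. of_int (c k)) (\<lambda>k. of_int (e k)) H * X i j)"
    by auto
  \<comment> \<open>Bracketing with \<open>?H\<close> multiplies the entry (i, j) by the height of i
    minus the height of j. The root condition makes this equal to s > 0 at every nonzero
    entry.\<close>
  let ?h = "height m n a b" and ?H = "dmat (\<lambda>i. of_int (height m n a b i))"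
  define s where "s = (\<Sum>i<m div 2. c i * a i) + (\<Sum>j<n. e j * b j)"
  have s: "s > 0" unfolding s_def by (rule pos[OF ce])
  have d: "2 * (m div 2) \<le> m" by simp
  have wtH: "wt m n (\<lambda>k. of_int (c k)) (\<lambda>k. of_int (e k)) ?H = of_int s"
  proof -
    have less: "i < m div 2 \<Longrightarrow> i < N" "j < n \<Longrightarrow> m + j < N" for i j by (simp_all add: idxN_def)
    have "(\<Sum>i<m div 2. of_int (c i) * ?H i i) = (\<Sum>i<m div 2. of_int (c i * a i))"
      using less by (intro sum.cong) (auto simp: dmat_def height_def)
    moreover have "(\<Sum>j<n. of_int (e j) * ?H (m + j) (m + j)) = (\<Sum>j<n. of_int (e j * b j))"
      using less by (intro sum.cong) (auto simp: dmat_def height_def)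
    ultimately show ?thesis unfolding wt_def s_def by simp
  qed
  have sbrH: "sbr m n ?H X i j = (of_int (?h i) - of_int (?h j)) * X i j" if ij: "i < N" "j < N" for i j
  proof -
    have "(\<Sum>k<N. ?H i k * X k j) = (\<Sum>k<N. if k = i then of_int (?h i) * X i j else 0)"
      by (rule sum.cong) (auto simp: dmat_def)
    moreover have "(\<Sum>k<N. ksign (p k \<noteq> p j) (p i \<noteq> p k) * X i k * ?H k j)
        = (\<Sum>k<N. if k = j then of_int (?h j) * X i j else 0)"
      by (rule sum.cong) (auto simp: dmat_def)
    ultimately show ?thesis unfolding sbr_formula using ij by (simp add: left_diff_distrib)
  qed
  have up: "?h j < ?h i" if nz: "X i j \<noteq> 0" for i j
  proof -
    have "ev_part m X i j \<noteq> 0 \<or> od_part m X i j \<noteq> 0" using nz parts_add[of X i j] by auto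
    then have ij: "i < N" "j < N"
      using X osp_h_supp[of False "ev_part m X" i j] osp_h_supp[of True "od_part m X" i j] by (auto simp: osp_iff)
    have "?H \<in> cartan m n" by (simp add: cartan_iff osp_h_dmat diagonal_dmat height_dual)
    from root[OF this] have "sbr m n ?H X i j = of_int s * X i j" by (simp add: wtH)
    then have "of_int (?h i - ?h j) = (of_int s :: complex)" using nz by (simp add: sbrH[OF ij])
    then have "?h i - ?h j = s" by (simp only: of_int_eq_iff)
    then show ?thesis using s by simp
  qed
  have "raising ?h (ev_part m X)" "raising ?h (od_part m X)"
    using up by (auto simp: raising_def ev_part_def od_part_def)
  then show "act m n X (Psi T) = tzero"
    using X T(4) by (simp add: act_Psi osp_iff hwv_def tadd_tzero Psi_linear)
qed

end

theorem theorem3p1: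
  fixes m n :: nat
  assumes "m > 7" and "n > 1"
    and "int m - 2 * int n \<notin> {0, 1, 2}"
  shows "\<exists>V :: nat \<Rightarrow> tens set.
           (\<forall>i<6. irreducible_submodule m n (V i)) \<and>
           is_direct_sum (gtg m n) V {0..<6} \<and>
           (\<forall>i<6. has_hw_vector m n (pos_nonstd m n) (V i) (K_weights ! i)) \<and>
           (\<forall>i<6. has_hw_vector m n (pos_std m n) (V i) (L_weights ! i)) \<and>
           is_direct_sum (gsym m n) V {0, 2, 3, 5} \<and>
           is_direct_sum (gwedge m n) V {1, 4}"
proof -
  define d where "d = m div 2"
  have d: "4 \<le> d" "2 * d \<le> m" "m \<le> 2 * d + 1" using assms(1) by (auto simp: d_def)
  \<comment> \<open>The coefficients are copied from \<open>pos_nonstd\<close> and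
    \<open>pos_std\<close>, so that the positivity required by \<open>hw_transfer\<close> is the
    definition itself.\<close>
  define hn where "hn = height m n (\<lambda>i. int (n + m div 2 - i)) (\<lambda>j. int (n - j))"
  define hs where "hs = height m n (\<lambda>i. int (m div 2 - i)) (\<lambda>j. int (m div 2 + n - j))"
  interpret M: osp_model m n .
  have sdim: "M.sdim = of_int (int m - 2 * int n)"
  proof -
    have "M.sdim = (\<Sum>b<m. ksign (podd m b) (podd m b)) + (\<Sum>b<2 * n. ksign (podd m (m + b)) (podd m (m + b)))"
    proof -
      have "(\<Sum>r<m + L. G r) = (\<Sum>r<m. G r) + (\<Sum>r<L. G (m + r))" for G :: "nat \<Rightarrow> complex" and L
        by (induction L) (simp_all add: add.assoc)
      from this[of _ "2 * n"] show ?thesis unfolding M.sdim_def by (simp only: idxN_def)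
    qed
    also have "\<dots> = (\<Sum>b<m. 1) + (\<Sum>b<2 * n. -1)"
      by (intro arg_cong2[where f = plus] sum.cong) (auto simp: podd_def)
    finally show ?thesis by simp
  qed
  interpret S: osp_std "idxN m n" "podd m" "dual m n" "sgnB m n" hn m "m + 1" hs
  proof
    note [simp] = d_def[symmetric]
    show "4 \<le> idxN m n" "m < idxN m n" "m + 1 < idxN m n" "podd m m" "podd m (m + 1)" "m + 1 \<noteq> m"
      using assms d by (auto simp: idxN_def podd_def)
    \<comment> \<open>The dual of the index m is m + n, so n > 1 is what keeps it apart from m +
      1.\<close>
    show "dual m n m \<noteq> m + 1" using assms d by (simp add: dual_def)
    fix i :: nat assume i: "i < 4"
    then show "\<not> podd m i" "sgnB m n i = 1" "4 \<le> dual m n i" using d by (auto simp: podd_def sgnB_def dual_def)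
    show "i < j \<Longrightarrow> j < idxN m n \<Longrightarrow> hn j < hn i" for j
      using i d unfolding hn_def height_def idxN_def by (auto simp: of_nat_diff)
  next
    show "hn (dual m n i) = - hn i" for i unfolding hn_def by (rule M.height_dual)
    \<comment> \<open>The epsilons have heights n + 1, ..., n + d and the deltas 1, ..., n, the
      duals have the negatives, and only the middle index of odd m has height 0.\<close>
    show "inj_on hn {..<idxN m n}"
      using d unfolding hn_def height_def idxN_def inj_on_def d_def[symmetric] by auto
    fix j assume j: "j < idxN m n" "j \<noteq> m"
    then show "hs j < hs m" using d assms unfolding hs_def height_def idxN_def d_def[symmetric] by auto
    assume "j \<noteq> m + 1"
    then show "hs j < hs (m + 1)" using j d assms unfolding hs_def height_def idxN_def d_def[symmetric] by auto
  next
    have "of_int (int m - 2 * int n) \<noteq> (of_int k :: complex)" if "k \<in> {0, 1, 2}" for k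
      using assms(3) that by (simp only: of_int_eq_iff) auto
    from this[of 0] this[of 1] this[of 2] show "M.sdim \<noteq> 0" "M.sdim \<noteq> 1" "M.sdim \<noteq> 2"
      unfolding sdim by simp_all
  qed
  define V where "V r = M.Psi ` S.summand r" for r
  have V: "V = (\<lambda>r. M.Psi ` S.summand r)" by (intro ext) (simp add: V_def)
  have irr: "irreducible_submodule m n (V r)" if r: "r < 6" for r
    unfolding irreducible_submodule_def
  proof (intro conjI allI impI)
    show "submodule m n (V r)" unfolding V_def by (rule M.Psi_submodule[OF S.summand_Wsub[OF r]])
    have "M.Psi (S.hw r) \<in> V r" "M.Psi (S.hw r) \<noteq> tzero"
      using S.hw_in_summand S.hw_nonzero[OF r] M.Psi_eq_iff[of "S.hw r" tzero] by (auto simp: V_def M.Psi_linear)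
    then show "V r \<noteq> {tzero}" by blast
    fix U assume "submodule m n U \<and> U \<subseteq> V r"
    then have U: "submodule m n U" "U \<subseteq> V r" by auto
    define U' where "U' = {T. M.Psi T \<in> U}"
    have "M.Wsub U'" unfolding U'_def by (rule M.submodule_Phi[OF U(1)])
    moreover have "U' \<subseteq> S.summand r" using U(2) by (auto simp: U'_def V_def M.Psi_eq_iff)
    ultimately have "U' = {tzero} \<or> U' = S.summand r" using S.summand_irreducible[OF r] by blast
    moreover have "U = M.Psi ` U'" by (auto simp: U'_def M.mem_Psi_image)
    ultimately show "U = {tzero} \<or> U = V r" by (auto simp: V_def M.Psi_linear)
  qed
  \<comment> \<open>Weights are given as short lists padded by zeros; the sums reduce to the listed
    coefficients once d and n are at least the list lengths.\<close>
  have low: "(\<Sum>i<k. coef xs i * G i) = (\<Sum>i<length xs. xs ! i * G i)" if "length xs \<le> k" for xs G and k :: nat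
  proof -
    have "(\<Sum>i<k. coef xs i * G i) = (\<Sum>i<length xs. coef xs i * G i)"
      using that by (intro sum.mono_neutral_right) (auto simp: coef_def)
    then show ?thesis by (simp add: coef_def)
  qed
  note wt = wt_def d_def[symmetric]
  have wtK: "S.wts r H = wt m n (coef (fst (K_weights ! r))) (coef (snd (K_weights ! r))) H" if "r < 6" for r H
    using S.less6_cases[OF that]
    by (elim disjE; hypsubst; unfold S.wts_simps wt K_weights_def; use d assms(2) in \<open>(simp add: low; (simp add: eval_nat_numeral)?)\<close>)
  have wtL: "S.wts2 r H = wt m n (coef (fst (L_weights ! r))) (coef (snd (L_weights ! r))) H" if "r < 6" for r H
    using S.less6_cases[OF that]
    by (elim disjE; hypsubst; unfold S.wts2_simps wt L_weights_def; use d assms(2) in \<open>(simp add: low; (simp add: eval_nat_numeral)?)\<close>)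
  have K: "has_hw_vector m n (pos_nonstd m n) (V r) (K_weights ! r)" if r: "r < 6" for r
    unfolding V_def
    by (rule M.hw_transfer[OF S.hw_in_summand S.hw_nonzero[OF r] S.hw_weight[OF r] S.hw_hwv[OF r, unfolded hn_def] wtK[OF r]])
      (simp add: pos_nonstd_def)
  have L: "has_hw_vector m n (pos_std m n) (V r) (L_weights ! r)" if r: "r < 6" for r
    unfolding V_def
    by (rule M.hw_transfer[OF S.hw_std_in_summand[OF r] S.hw_std_nonzero[OF r] S.hw_std_weight[OF r] S.hw_std_hwv[OF r, unfolded hs_def] wtL[OF r]])
      (simp add: pos_std_def)
  have sets: "{r. r < 6 \<and> S.sgn_of r = 1} = {0, 2, 3, 5}" "{r. r < 6 \<and> S.sgn_of r = -1} = {1, 4}"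
    using S.less6_cases by (auto simp: S.sgn_of_def split: if_splits)
  have "is_direct_sum (gtg m n) V {0..<6}"
    unfolding M.gtg_eq V by (rule M.Psi_direct_sum[OF S.W_direct_sum])
  moreover have "is_direct_sum (gsym m n) V {0, 2, 3, 5}"
    using M.Psi_direct_sum[OF S.eigen_direct_sum[of 1]] unfolding M.gsym_eq V sets by simp
  moreover have "is_direct_sum (gwedge m n) V {1, 4}"
    using M.Psi_direct_sum[OF S.eigen_direct_sum[of "-1"]] unfolding M.gwedge_eq V sets by simp
  ultimately show ?thesis using irr K L by blast
qed

end
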